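(* Let $n \geq 3$ be an integer. Then the group $\mathrm{P}\Sigma_n$ does not satisfy the Andreadakis equality, i.e. it is not true that $\Gamma_k(\mathrm{P}\Sigma_n) = \mathcal{A}_k(F_n) \cap \mathrm{P}\Sigma_n$ for all $k \geq 1$. In fact, the quotient group $$\frac{\mathcal{A}_7(F_n) \cap \mathrm{P}\Sigma_n}{\Gamma_7(\mathrm{P}\Sigma_n)}$$ has a central subgroup which is free abelian of rank $\binom{n}{3}$.
   Context: For a group $G$, $G=\Gamma_1(G) \supseteq \Gamma_2(G) \supseteq \cdots$ denotes the lower central series of $G$. $F_n$ is the free group with basis $x_1,\dots,x_n$. For $k \geq 1$, $\mathcal{A}_k(F_n)$ is the kernel of the natural homomorphism $\mathrm{Aut}(F_n) \to \mathrm{Aut}(F_n/\Gamma_{k+1}(F_n))$, i.e. the group of automorphisms of $F_n$ acting trivially on $F_n/\Gamma_{k+1}(F_n)$. $\mathrm{P}\Sigma_n$ (the McCool group) is the subgroup of $\mathrm{Aut}(F_n)$ consisting of the automorphisms sending each basis element $x_i$ to a conjugate of $x_i$ in $F_n$. It is contained in $\mathcal{A}_1(F_n)$, and $\Gamma_k(\mathrm{P}\Sigma_n) \subseteq \mathcal{A}_k(F_n) \cap \mathrm{P}\Sigma_n$ for all $k \geq 1$; moreover $\Gamma_k(\mathrm{P}\Sigma_n)$ is normal in $\mathrm{P}\Sigma_n$. *)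

theory Defs
  imports "HOL-Algebra.Bij" "HOL-Algebra.Generated_Groups" "HOL-Algebra.Free_Abelian_Groups"
begin

section \<open>Free groups\<close>

text \<open>
  A letter is a pair \<open>(i, s)\<close>; it stands for the generator \<open>x\<^sub>i\<close> if \<open>s\<close> is true and for its
  inverse otherwise. The elements of the free group are the freely reduced words.
\<close>

type_synonym 'a word = "('a \<times> bool) list"

definition letter_inv :: "'a \<times> bool \<Rightarrow> 'a \<times> bool"
  where "letter_inv a = (fst a, \<not> snd a)"

definition reduced :: "'a word \<Rightarrow> bool"
  where "reduced w \<longleftrightarrow> successively (\<lambda>a b. b \<noteq> letter_inv a) w"

definition letter_mult :: "'a \<times> bool \<Rightarrow> 'a word \<Rightarrow> 'a word"
  where "letter_mult a w =
    (case w of [] \<Rightarrow> [a] | b # v \<Rightarrow> if b = letter_inv a then v else a # w)"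

definition free_group :: "'a set \<Rightarrow> 'a word monoid"
  where "free_group S =
    \<lparr>carrier = {w. reduced w \<and> fst ` set w \<subseteq> S},
     monoid.mult = (\<lambda>u v. foldr letter_mult u v),
     one = []\<rparr>"

definition free_gen :: "'a \<Rightarrow> 'a word"
  where "free_gen i = [(i, True)]"

lemma letter_inv_inv [simp]: "letter_inv (letter_inv a) = a"
  by (simp add: letter_inv_def)

lemma fst_letter_inv [simp]: "fst (letter_inv a) = fst a"
  by (simp add: letter_inv_def)

lemma reduced_simps [simp]:
  "reduced []"
  "reduced [a]"
  "reduced (a # b # w) \<longleftrightarrow> b \<noteq> letter_inv a \<and> reduced (b # w)"
  by (simp_all add: reduced_def)

lemma reduced_tl: "reduced (a # w) \<Longrightarrow> reduced w"
  by (cases w) auto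

lemma reduced_letter_mult: "reduced w \<Longrightarrow> reduced (letter_mult a w)"
  by (auto simp: letter_mult_def split: list.split dest: reduced_tl)

lemma reduced_foldr: "reduced w \<Longrightarrow> reduced (foldr letter_mult u w)"
  by (induction u) (auto intro: reduced_letter_mult)

lemma letter_mult_cancel: "reduced w \<Longrightarrow> letter_mult (letter_inv a) (letter_mult a w) = w"
  by (cases w; cases "tl w") (auto simp: letter_mult_def)

lemma letter_mult_reduced: "reduced (a # w) \<Longrightarrow> letter_mult a w = a # w"
  by (cases w) (auto simp: letter_mult_def)

lemma foldr_letter_mult:
  "reduced w \<Longrightarrow> foldr letter_mult (letter_mult a v) w = letter_mult a (foldr letter_mult v w)"
proof (cases "\<exists>u. v = letter_inv a # u")
  case True
  then obtain u where v: "v = letter_inv a # u" by blast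
  moreover assume "reduced w"
  ultimately show ?thesis
    using letter_mult_cancel[of "foldr letter_mult u w" "letter_inv a"]
    by (simp add: reduced_foldr letter_mult_def[of a "letter_inv a # u"])
next
  case False
  then have "letter_mult a v = a # v"
    by (cases v) (auto simp: letter_mult_def)
  then show ?thesis by simp
qed

lemma foldr_assoc:
  "reduced w \<Longrightarrow>
    foldr letter_mult (foldr letter_mult u v) w = foldr letter_mult u (foldr letter_mult v w)"
  by (induction u) (auto simp: foldr_letter_mult)

lemma set_letter_mult: "set (letter_mult a w) \<subseteq> insert a (set w)"
  by (auto simp: letter_mult_def split: list.splits if_splits)

lemma set_foldr_letter_mult: "set (foldr letter_mult u w) \<subseteq> set u \<union> set w"
  by (induction u) (use set_letter_mult in fastforce)+

lemma foldr_inverse: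
  "reduced w \<Longrightarrow> foldr letter_mult (rev (map letter_inv w)) w = []"
proof (induction w)
  case (Cons a w)
  moreover have "letter_mult (letter_inv a) (a # w) = w"
    by (simp add: letter_mult_def)
  ultimately show ?case by (auto dest: reduced_tl)
qed auto

lemma carrier_free_group: "w \<in> carrier (free_group S) \<longleftrightarrow> reduced w \<and> fst ` set w \<subseteq> S"
  by (simp add: free_group_def)

lemma mult_free_group: "u \<otimes>\<^bsub>free_group S\<^esub> v = foldr letter_mult u v"
  by (simp add: free_group_def)

lemma one_free_group: "\<one>\<^bsub>free_group S\<^esub> = []"
  by (simp add: free_group_def)

theorem group_free_group: "group (free_group S)"
proof (rule groupI)
  fix u v assume "u \<in> carrier (free_group S)" "v \<in> carrier (free_group S)"
  then show "u \<otimes>\<^bsub>free_group S\<^esub> v \<in> carrier (free_group S)"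
    using set_foldr_letter_mult[of u v]
    by (fastforce simp: carrier_free_group mult_free_group reduced_foldr)
next
  fix w assume w: "w \<in> carrier (free_group S)"
  let ?r = "rev (map letter_inv w)"
  have "foldr letter_mult (foldr letter_mult ?r []) w = []"
    using w by (simp add: foldr_assoc carrier_free_group foldr_inverse)
  moreover have "foldr letter_mult ?r [] \<in> carrier (free_group S)"
    using w set_foldr_letter_mult[of ?r "[]"]
    by (fastforce simp: carrier_free_group reduced_foldr)
  ultimately show "\<exists>v\<in>carrier (free_group S). v \<otimes>\<^bsub>free_group S\<^esub> w = \<one>\<^bsub>free_group S\<^esub>"
    by (auto simp: mult_free_group one_free_group)
qed (auto simp: carrier_free_group mult_free_group one_free_group foldr_assoc)

lemma free_gen_closed: "i \<in> S \<Longrightarrow> free_gen i \<in> carrier (free_group S)"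
  by (simp add: carrier_free_group free_gen_def)

lemma inv_free_gen: "i \<in> S \<Longrightarrow> inv\<^bsub>free_group S\<^esub> (free_gen i) = [(i, False)]"
  by (rule group.inv_equality[OF group_free_group])
     (auto simp: carrier_free_group mult_free_group one_free_group free_gen_def letter_mult_def
        letter_inv_def)

theorem (in group) free_group_universal:
  assumes g: "g \<in> S \<rightarrow> carrier G"
  shows "\<exists>!h. h \<in> extensional (carrier (free_group S)) \<and> h \<in> hom (free_group S) G \<and>
           (\<forall>i\<in>S. h (free_gen i) = g i)"
proof -
  let ?F = "free_group S"
  define l where "l a = (if snd a then g (fst a) else inv (g (fst a)))" for a
  define e where "e w = foldr (\<lambda>a x. l a \<otimes> x) w \<one>" for w
  have l: "l a \<in> carrier G" if "fst a \<in> S" for a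
    using that g by (auto simp: l_def)
  have linv: "l (letter_inv a) = inv (l a)" if "fst a \<in> S" for a
  proof -
    from that g have "g (fst a) \<in> carrier G" by auto
    then show ?thesis by (simp add: l_def letter_inv_def)
  qed
  have e: "e w \<in> carrier G" if "fst ` set w \<subseteq> S" for w
    using that by (induction w) (auto simp: e_def l)
  have e_Cons: "e (a # w) = l a \<otimes> e w" for a w
    by (simp add: e_def)
  have e_mult1: "e (letter_mult a w) = l a \<otimes> e w" if "fst a \<in> S" "fst ` set w \<subseteq> S" for a w
  proof (cases w)
    case (Cons b v)
    then show ?thesis
      using that l[of a] e[of v] linv[of a]
      by (auto simp: letter_mult_def e_Cons m_assoc[symmetric])
  qed (simp add: letter_mult_def e_Cons)
  have e_mult: "e (foldr letter_mult u v) = e u \<otimes> e v"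
    if "fst ` set u \<subseteq> S" "fst ` set v \<subseteq> S" for u v
    using that
  proof (induction u)
    case Nil
    then show ?case using e[of v] by (simp add: e_def)
  next
    case (Cons a u)
    have "fst ` set (foldr letter_mult u v) \<subseteq> S"
      using Cons.prems set_foldr_letter_mult[of u v] by fastforce
    with Cons show ?case by (simp add: e_mult1 e_Cons m_assoc l e)
  qed
  have gen: "free_gen i \<in> carrier ?F" if "i \<in> S" for i
    using that by (rule free_gen_closed)
  show ?thesis
  proof (rule ex1I[of _ "restrict e (carrier ?F)"], intro conjI ballI)
    show "restrict e (carrier ?F) \<in> hom ?F G"
    proof (rule homI)
      fix u v assume "u \<in> carrier ?F" "v \<in> carrier ?F"
      moreover from this have "u \<otimes>\<^bsub>?F\<^esub> v \<in> carrier ?F"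
        using group_free_group group.subgroup_self subgroup.m_closed by metis
      ultimately show "restrict e (carrier ?F) (u \<otimes>\<^bsub>?F\<^esub> v) =
          restrict e (carrier ?F) u \<otimes> restrict e (carrier ?F) v"
        by (simp add: mult_free_group e_mult carrier_free_group)
    qed (simp add: carrier_free_group e)
    fix i assume "i \<in> S"
    then show "restrict e (carrier ?F) (free_gen i) = g i"
      using gen[of i] r_one[of "g i"] Pi_mem[OF g] by (simp add: e_def free_gen_def l_def)
  next
    fix h assume h: "h \<in> extensional (carrier ?F) \<and> h \<in> hom ?F G \<and> (\<forall>i\<in>S. h (free_gen i) = g i)"
    interpret h: group_hom ?F G h
      using h by (simp add: group_hom_def group_hom_axioms_def group_free_group is_group)
    have "h [a] = l a" if "fst a \<in> S" for a
      using that h h.hom_inv[OF gen[of "fst a"]] inv_free_gen[of "fst a" S]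
      by (cases a) (auto simp: l_def free_gen_def)
    moreover have "a # w = [a] \<otimes>\<^bsub>?F\<^esub> w" if "reduced (a # w)" for a w
      using that by (simp add: mult_free_group letter_mult_reduced)
    ultimately have "h w = e w" if "w \<in> carrier ?F" for w
      using that
    proof (induction w)
      case Nil
      then show ?case using h.hom_one by (simp add: one_free_group e_def)
    next
      case (Cons a w)
      then have aw: "reduced (a # w)" "w \<in> carrier ?F" "[a] \<in> carrier ?F" "fst a \<in> S"
        by (auto simp: carrier_free_group dest: reduced_tl)
      then show ?case
        using Cons h.hom_mult[of "[a]" w] by (metis e_Cons)
    qed
    then show "h = restrict e (carrier ?F)"
      using h by (intro extensionalityI[of _ "carrier ?F"]) auto
  qed auto
qed


section \<open>The lower central series\<close>

text \<open>
  The series is indexed from 1, with first term the whole group; the index 0 is given the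
  whole group as a dummy value.
\<close>

fun lower_central :: "('a, 'b) monoid_scheme \<Rightarrow> nat \<Rightarrow> 'a set"
  where
    "lower_central G 0 = carrier G"
  | "lower_central G (Suc 0) = carrier G"
  | "lower_central G (Suc (Suc k)) = generate G
       {g \<otimes>\<^bsub>G\<^esub> h \<otimes>\<^bsub>G\<^esub> inv\<^bsub>G\<^esub> g \<otimes>\<^bsub>G\<^esub> inv\<^bsub>G\<^esub> h | g h.
          g \<in> carrier G \<and> h \<in> lower_central G (Suc k)}"

lemma (in group) subgroup_lower_central: "subgroup (lower_central G k) G"
proof (induction k rule: induct_nat_012)
  case (ge2 k)
  then have "lower_central G (Suc k) \<subseteq> carrier G"
    by (simp add: subgroup.subset)
  then show ?case
    by (simp only: lower_central.simps) (rule generate_is_subgroup, auto)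
qed (simp_all add: subgroup_self)

lemma (in group_hom) lower_central_img: "h ` lower_central G k \<subseteq> lower_central H k"
proof (induction k rule: induct_nat_012)
  case (ge2 k)
  let ?C = "\<lambda>G k. {x \<otimes>\<^bsub>G\<^esub> y \<otimes>\<^bsub>G\<^esub> inv\<^bsub>G\<^esub> x \<otimes>\<^bsub>G\<^esub> inv\<^bsub>G\<^esub> y | x y.
    x \<in> carrier G \<and> y \<in> lower_central G (Suc k)}"
  have *: "lower_central G (Suc k) \<subseteq> carrier G"
    using G.subgroup_lower_central subgroup.subset by blast
  have "h ` ?C G k \<subseteq> ?C H k"
  proof (rule image_subsetI)
    fix z assume "z \<in> ?C G k"
    then obtain x y where xy: "x \<in> carrier G" "y \<in> lower_central G (Suc k)"
        "z = x \<otimes> y \<otimes> inv x \<otimes> inv y" by blast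
    moreover from this * have "y \<in> carrier G" by blast
    ultimately have "h z = h x \<otimes>\<^bsub>H\<^esub> h y \<otimes>\<^bsub>H\<^esub> inv\<^bsub>H\<^esub> h x \<otimes>\<^bsub>H\<^esub> inv\<^bsub>H\<^esub> h y" by simp
    moreover have "h x \<in> carrier H" using xy(1) by simp
    moreover have "h y \<in> lower_central H (Suc k)" using ge2.IH(2) xy(2) by (rule subsetD[OF _ imageI])
    ultimately show "h z \<in> ?C H k" by (intro CollectI exI[of _ "h x"] exI[of _ "h y"] conjI)
  qed
  then have "generate H (h ` ?C G k) \<subseteq> generate H (?C H k)"
    by (rule H.mono_generate)
  moreover have "?C G k \<subseteq> carrier G"
  proof
    fix z assume "z \<in> ?C G k"
    then obtain x y where xy: "x \<in> carrier G" "y \<in> lower_central G (Suc k)"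
        "z = x \<otimes> y \<otimes> inv x \<otimes> inv y" by blast
    moreover from this * have "y \<in> carrier G" by blast
    ultimately show "z \<in> carrier G" by simp
  qed
  then have "h ` generate G (?C G k) = generate H (h ` ?C G k)"
    by (rule generate_img[symmetric])
  ultimately show ?case
    by (simp only: lower_central.simps)
qed auto

lemma (in group) normal_lower_central: "lower_central G k \<lhd> G"
proof -
  have "x \<otimes> h \<otimes> inv x \<in> lower_central G k"
    if x: "x \<in> carrier G" and h: "h \<in> lower_central G k" for x h
  proof -
    have "(\<lambda>y. x \<otimes> y \<otimes> inv x) \<in> hom G G"
    proof (rule homI)
      fix y z assume "y \<in> carrier G" "z \<in> carrier G"
      then have "x \<otimes> (y \<otimes> z) \<otimes> inv x = x \<otimes> y \<otimes> (inv x \<otimes> x) \<otimes> z \<otimes> inv x"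
        using x by (simp add: m_assoc)
      also have "\<dots> = x \<otimes> y \<otimes> inv x \<otimes> (x \<otimes> z \<otimes> inv x)"
        using x \<open>y \<in> carrier G\<close> \<open>z \<in> carrier G\<close> by (simp only: m_assoc m_closed inv_closed)
      finally show "x \<otimes> (y \<otimes> z) \<otimes> inv x = x \<otimes> y \<otimes> inv x \<otimes> (x \<otimes> z \<otimes> inv x)" .
    qed (use x in simp)
    then interpret c: group_hom G G "\<lambda>y. x \<otimes> y \<otimes> inv x"
      by unfold_locales
    show ?thesis using c.lower_central_img h by blast
  qed
  then show ?thesis
    using subgroup_lower_central by (simp add: normal_inv_iff)
qed


section \<open>The Andreadakis filtration and the McCool group\<close>

definition induced_aut :: "('a, 'b) monoid_scheme \<Rightarrow> 'a set \<Rightarrow> ('a \<Rightarrow> 'a) \<Rightarrow> 'a set \<Rightarrow> 'a set"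
  where "induced_aut G N f = (\<lambda>X\<in>carrier (G Mod N). f ` X)"

text \<open>
  Lower central subgroups are invariant under automorphisms, so \<open>induced_aut\<close> is the natural
  homomorphism on automorphism groups.
\<close>

lemma (in group) lower_central_auto_image:
  assumes "f \<in> auto G"
  shows "f ` lower_central G k = lower_central G k"
proof
  have f: "f \<in> iso G G"
    using assms by (auto simp: auto_def Bij_def iso_def)
  interpret f: group_hom G G f
    using f by unfold_locales (auto simp: iso_def)
  interpret f': group_hom G G "inv_into (carrier G) f"
    using iso_set_sym[OF f] by unfold_locales (auto simp: iso_def)
  show "f ` lower_central G k \<subseteq> lower_central G k"
    by (rule f.lower_central_img)
  show "lower_central G k \<subseteq> f ` lower_central G k"
  proof
    fix y assume y: "y \<in> lower_central G k"
    then have "y \<in> carrier G" using subgroup_lower_central subgroup.mem_carrier by metis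
    then have "f (inv_into (carrier G) f y) = y"
      using f by (metis iso_iff f_inv_into_f)
    with y show "y \<in> f ` lower_central G k"
      using f'.lower_central_img by (metis image_eqI image_subset_iff)
  qed
qed

lemma (in group) induced_aut_coset:
  assumes f: "f \<in> auto G" and w: "w \<in> carrier G" and N: "N = lower_central G k"
  shows "induced_aut G N f (N #> w) = N #> f w"
proof -
  have NG: "N \<subseteq> carrier G" using N subgroup_lower_central subgroup.subset by metis
  have "f ` (N #> w) = (f ` N) #> f w"
  proof -
    have "f (x \<otimes> w) = f x \<otimes> f w" if "x \<in> N" for x
      using f w NG that by (auto simp: auto_def hom_def)
    then show ?thesis by (simp add: r_coset_def image_UN image_image)
  qed
  then show ?thesis
    using lower_central_auto_image[OF f, of k] w N
    by (auto simp: induced_aut_def carrier_FactGroup)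
qed

theorem (in group) induced_aut_hom:
  "induced_aut G (lower_central G k) \<in> hom (AutoGroup G) (AutoGroup (G Mod lower_central G k))"
proof -
  define N where "N = lower_central G k"
  interpret N: normal N G using normal_lower_central by (simp add: N_def)
  note coset = induced_aut_coset[OF _ _ N_def]
  have carr: "carrier (G Mod N) = (\<lambda>x. N #> x) ` carrier G"
    by (rule carrier_FactGroup)
  have fw: "f w \<in> carrier G" if "f \<in> auto G" "w \<in> carrier G" for f w
    using that by (auto simp: auto_def hom_def)
  have fmult: "f (x \<otimes> y) = f x \<otimes> f y" if "f \<in> auto G" "x \<in> carrier G" "y \<in> carrier G" for f x y
    using that hom_mult[of f G G] by (simp add: auto_def)
  have "induced_aut G N f \<in> auto (G Mod N)" if f: "f \<in> auto G" for f
  proof -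
    have onto: "f ` carrier G = carrier G" and inj: "inj_on f (carrier G)"
      using f by (auto simp: auto_def Bij_def bij_betw_def)
    have "induced_aut G N f \<in> hom (G Mod N) (G Mod N)"
    proof (rule homI)
      fix X assume "X \<in> carrier (G Mod N)"
      then obtain x where x: "x \<in> carrier G" "X = N #> x" unfolding carr by blast
      then show "induced_aut G N f X \<in> carrier (G Mod N)"
        unfolding carr by (simp only: coset[OF f x(1)]) (rule imageI, rule fw[OF f x(1)])
    next
      fix X Y assume "X \<in> carrier (G Mod N)" "Y \<in> carrier (G Mod N)"
      then obtain x y where xy: "x \<in> carrier G" "X = N #> x" "y \<in> carrier G" "Y = N #> y"
        unfolding carr by blast
      then show "induced_aut G N f (X \<otimes>\<^bsub>G Mod N\<^esub> Y) =
          induced_aut G N f X \<otimes>\<^bsub>G Mod N\<^esub> induced_aut G N f Y"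
        by (simp add: N.rcos_sum coset[OF f] fw[OF f] fmult[OF f])
    qed
    moreover have "induced_aut G N f ` carrier (G Mod N) = carrier (G Mod N)"
    proof -
      have "induced_aut G N f ` carrier (G Mod N) = (\<lambda>x. N #> x) ` f ` carrier G"
        unfolding carr image_image by (rule image_cong) (simp_all add: coset f)
      then show ?thesis by (simp add: onto carr)
    qed
    moreover have "inj_on (induced_aut G N f) (carrier (G Mod N))"
    proof (rule inj_onI)
      fix X Y assume XY: "X \<in> carrier (G Mod N)" "Y \<in> carrier (G Mod N)"
        and "induced_aut G N f X = induced_aut G N f Y"
      then have "f ` X = f ` Y" by (simp add: induced_aut_def)
      moreover have "X \<subseteq> carrier G" "Y \<subseteq> carrier G"
        using XY N.subset r_coset_subset_G unfolding carr by blast+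
      ultimately show "X = Y" using inj_on_image_eq_iff[OF inj] by blast
    qed
    moreover have "induced_aut G N f \<in> extensional (carrier (G Mod N))"
      by (simp add: induced_aut_def)
    ultimately show ?thesis
      unfolding auto_def Bij_def bij_betw_def by blast
  qed
  moreover have "induced_aut G N (compose (carrier G) f g) =
      compose (carrier (G Mod N)) (induced_aut G N f) (induced_aut G N g)"
    if fg: "f \<in> auto G" "g \<in> auto G" "compose (carrier G) f g \<in> auto G" for f g
  proof (rule extensionalityI[of _ "carrier (G Mod N)"])
    fix X assume "X \<in> carrier (G Mod N)"
    then obtain w where w: "w \<in> carrier G" "X = N #> w" by (auto simp: carr)
    have "induced_aut G N (compose (carrier G) f g) X = N #> f (g w)"
      using coset[OF fg(3) w(1)] w by (simp add: compose_eq)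
    moreover have "induced_aut G N f (induced_aut G N g X) = N #> f (g w)"
      using coset[OF fg(2) w(1)] coset[OF fg(1) fw[OF fg(2) w(1)]] w by simp
    ultimately show "induced_aut G N (compose (carrier G) f g) X =
        compose (carrier (G Mod N)) (induced_aut G N f) (induced_aut G N g) X"
      using \<open>X \<in> carrier (G Mod N)\<close> by (simp add: compose_eq)
  qed (simp_all add: induced_aut_def compose_def)
  moreover have "compose (carrier G) f g \<in> auto G" if "f \<in> auto G" "g \<in> auto G" for f g
  proof -
    have "compose (carrier G) f g \<in> hom G G"
    proof (rule homI)
      fix x y assume "x \<in> carrier G" "y \<in> carrier G"
      with that show "compose (carrier G) f g (x \<otimes> y) =
          compose (carrier G) f g x \<otimes> compose (carrier G) f g y"
        by (simp add: compose_eq fmult fw)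
    qed (simp add: compose_eq fw that)
    then show ?thesis using that by (simp add: auto_def compose_Bij)
  qed
  ultimately show ?thesis
    unfolding N_def[symmetric]
    by (intro homI) (simp_all add: AutoGroup_def BijGroup_def, simp_all add: auto_def)
qed

definition andreadakis :: "('a, 'b) monoid_scheme \<Rightarrow> nat \<Rightarrow> ('a \<Rightarrow> 'a) set"
  where "andreadakis G k =
    kernel (AutoGroup G) (AutoGroup (G Mod lower_central G (k + 1)))
      (induced_aut G (lower_central G (k + 1)))"

lemma (in group) andreadakis_iff:
  "f \<in> andreadakis G k \<longleftrightarrow> f \<in> auto G \<and>
     (\<forall>w\<in>carrier G. lower_central G (k + 1) #> f w = lower_central G (k + 1) #> w)"
proof -
  define N where "N = lower_central G (k + 1)"
  note coset = induced_aut_coset[OF _ _ N_def]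
  have "induced_aut G N f = (\<lambda>X\<in>carrier (G Mod N). X) \<longleftrightarrow>
      (\<forall>w\<in>carrier G. N #> f w = N #> w)" if f: "f \<in> auto G"
  proof
    assume *: "induced_aut G N f = (\<lambda>X\<in>carrier (G Mod N). X)"
    show "\<forall>w\<in>carrier G. N #> f w = N #> w"
    proof
      fix w assume w: "w \<in> carrier G"
      then have "induced_aut G N f (N #> w) = N #> w"
        unfolding * by (simp add: carrier_FactGroup)
      then show "N #> f w = N #> w" using coset[OF f w] by simp
    qed
  next
    assume *: "\<forall>w\<in>carrier G. N #> f w = N #> w"
    show "induced_aut G N f = (\<lambda>X\<in>carrier (G Mod N). X)"
    proof (rule extensionalityI[of _ "carrier (G Mod N)"])
      fix X assume "X \<in> carrier (G Mod N)"
      then obtain w where "w \<in> carrier G" "X = N #> w" by (auto simp: carrier_FactGroup)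
      then show "induced_aut G N f X = (\<lambda>X\<in>carrier (G Mod N). X) X"
        using * coset[OF f] by (simp add: carrier_FactGroup)
    qed (auto simp: induced_aut_def)
  qed
  then show ?thesis
    unfolding andreadakis_def N_def[symmetric] kernel_def
    by (auto simp: AutoGroup_def BijGroup_def)
qed

definition mccool :: "'a set \<Rightarrow> ('a word \<Rightarrow> 'a word) set"
  where "mccool S = {f \<in> carrier (AutoGroup (free_group S)).
    \<forall>i\<in>S. \<exists>w\<in>carrier (free_group S).
      f (free_gen i) = w \<otimes>\<^bsub>free_group S\<^esub> free_gen i \<otimes>\<^bsub>free_group S\<^esub> inv\<^bsub>free_group S\<^esub> w}"

theorem subgroup_mccool: "subgroup (mccool S) (AutoGroup (free_group S))"
proof -
  let ?F = "free_group S" and ?A = "AutoGroup (free_group S)"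
  interpret F: group ?F by (rule group_free_group)
  interpret A: group ?A by (rule F.AutoGroup)
  have carr: "carrier ?A = auto ?F" by (simp add: AutoGroup_def)
  have one: "\<one>\<^bsub>?A\<^esub> = (\<lambda>w\<in>carrier ?F. w)" by (simp add: AutoGroup_def BijGroup_def)
  have mult: "(f \<otimes>\<^bsub>?A\<^esub> g) w = f (g w)"
    if "f \<in> auto ?F" "g \<in> auto ?F" "w \<in> carrier ?F" for f g w
    using that by (simp add: AutoGroup_def BijGroup_def auto_def compose_eq)
  have hom: "group_hom ?F ?F f" if "f \<in> auto ?F" for f
    using that by unfold_locales (simp add: auto_def)
  have conj: "\<exists>w\<in>carrier ?F. f (free_gen i) = w \<otimes>\<^bsub>?F\<^esub> free_gen i \<otimes>\<^bsub>?F\<^esub> inv\<^bsub>?F\<^esub> w"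
    if "f \<in> mccool S" "i \<in> S" for f i
    using that unfolding mccool_def by blast
  show ?thesis
  proof (rule A.subgroupI)
    have "\<one>\<^bsub>?A\<^esub> \<in> mccool S"
      unfolding mccool_def
    proof (intro CollectI conjI ballI)
      fix i assume "i \<in> S"
      then show "\<exists>w\<in>carrier ?F. \<one>\<^bsub>?A\<^esub> (free_gen i) = w \<otimes>\<^bsub>?F\<^esub> free_gen i \<otimes>\<^bsub>?F\<^esub> inv\<^bsub>?F\<^esub> w"
        by (intro bexI[of _ "\<one>\<^bsub>?F\<^esub>"]) (simp_all add: one free_gen_closed)
    qed (rule A.one_closed)
    then show "mccool S \<noteq> {}" by blast
  next
    fix f assume f: "f \<in> mccool S"
    then have fA: "f \<in> carrier ?A" by (simp add: mccool_def)
    then have f': "inv\<^bsub>?A\<^esub> f \<in> carrier ?A" by simp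
    let ?g = "inv\<^bsub>?A\<^esub> f"
    interpret g: group_hom ?F ?F ?g using f' carr hom by blast
    have gf: "?g (f w) = w" if "w \<in> carrier ?F" for w
      using mult[of ?g f w, unfolded A.l_inv[OF fA] one] that fA f' by (simp add: carr)
    show "?g \<in> mccool S"
      unfolding mccool_def
    proof (intro CollectI conjI ballI)
      fix i assume i: "i \<in> S"
      then obtain w where w: "w \<in> carrier ?F"
          "f (free_gen i) = w \<otimes>\<^bsub>?F\<^esub> free_gen i \<otimes>\<^bsub>?F\<^esub> inv\<^bsub>?F\<^esub> w"
        using conj[OF f i] by blast
      note x = free_gen_closed[OF i]
      let ?u = "?g w" and ?y = "?g (free_gen i)"
      have uy: "?u \<in> carrier ?F" "?y \<in> carrier ?F"
        using w x by (simp_all only: g.hom_closed)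
      have "free_gen i = ?g (w \<otimes>\<^bsub>?F\<^esub> free_gen i \<otimes>\<^bsub>?F\<^esub> inv\<^bsub>?F\<^esub> w)"
        using gf[OF x] w by simp
      also have "\<dots> = ?u \<otimes>\<^bsub>?F\<^esub> ?y \<otimes>\<^bsub>?F\<^esub> inv\<^bsub>?F\<^esub> ?u"
        using w x by simp
      finally have "inv\<^bsub>?F\<^esub> ?u \<otimes>\<^bsub>?F\<^esub> free_gen i \<otimes>\<^bsub>?F\<^esub> ?u =
          inv\<^bsub>?F\<^esub> ?u \<otimes>\<^bsub>?F\<^esub> (?u \<otimes>\<^bsub>?F\<^esub> ?y \<otimes>\<^bsub>?F\<^esub> inv\<^bsub>?F\<^esub> ?u) \<otimes>\<^bsub>?F\<^esub> ?u"
        by simp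
      also have "\<dots> = (inv\<^bsub>?F\<^esub> ?u \<otimes>\<^bsub>?F\<^esub> ?u) \<otimes>\<^bsub>?F\<^esub> ?y \<otimes>\<^bsub>?F\<^esub> (inv\<^bsub>?F\<^esub> ?u \<otimes>\<^bsub>?F\<^esub> ?u)"
        using uy by (simp only: F.m_assoc F.m_closed F.inv_closed)
      also have "\<dots> = ?y"
        using uy by (simp only: F.l_inv F.l_one F.r_one)
      finally have "?y = inv\<^bsub>?F\<^esub> ?u \<otimes>\<^bsub>?F\<^esub> free_gen i \<otimes>\<^bsub>?F\<^esub> inv\<^bsub>?F\<^esub> (inv\<^bsub>?F\<^esub> ?u)"
        using uy by simp
      then show "\<exists>w\<in>carrier ?F. ?g (free_gen i) = w \<otimes>\<^bsub>?F\<^esub> free_gen i \<otimes>\<^bsub>?F\<^esub> inv\<^bsub>?F\<^esub> w"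
        using uy(1) F.inv_closed by blast
    qed (rule f')
  next
    fix f g assume f: "f \<in> mccool S" and g: "g \<in> mccool S"
    then have fA: "f \<in> carrier ?A" and gA: "g \<in> carrier ?A" by (simp_all add: mccool_def)
    interpret f: group_hom ?F ?F f using fA carr hom by blast
    show "f \<otimes>\<^bsub>?A\<^esub> g \<in> mccool S"
      unfolding mccool_def
    proof (intro CollectI conjI ballI)
      fix i assume i: "i \<in> S"
      note x = free_gen_closed[OF i]
      obtain v where v: "v \<in> carrier ?F"
          "f (free_gen i) = v \<otimes>\<^bsub>?F\<^esub> free_gen i \<otimes>\<^bsub>?F\<^esub> inv\<^bsub>?F\<^esub> v"
        using conj[OF f i] by blast
      obtain w where w: "w \<in> carrier ?F"
          "g (free_gen i) = w \<otimes>\<^bsub>?F\<^esub> free_gen i \<otimes>\<^bsub>?F\<^esub> inv\<^bsub>?F\<^esub> w"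
        using conj[OF g i] by blast
      have "(f \<otimes>\<^bsub>?A\<^esub> g) (free_gen i) =
          f w \<otimes>\<^bsub>?F\<^esub> (v \<otimes>\<^bsub>?F\<^esub> free_gen i \<otimes>\<^bsub>?F\<^esub> inv\<^bsub>?F\<^esub> v) \<otimes>\<^bsub>?F\<^esub> inv\<^bsub>?F\<^esub> (f w)"
        using mult[OF fA[unfolded carr] gA[unfolded carr] x] v(1) w x by (simp add: v(2))
      also have "\<dots> = (f w \<otimes>\<^bsub>?F\<^esub> v) \<otimes>\<^bsub>?F\<^esub> free_gen i \<otimes>\<^bsub>?F\<^esub> inv\<^bsub>?F\<^esub> (f w \<otimes>\<^bsub>?F\<^esub> v)"
        using v w x by (simp add: F.m_assoc F.inv_mult_group)
      finally show "\<exists>w\<in>carrier ?F. (f \<otimes>\<^bsub>?A\<^esub> g) (free_gen i) =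
          w \<otimes>\<^bsub>?F\<^esub> free_gen i \<otimes>\<^bsub>?F\<^esub> inv\<^bsub>?F\<^esub> w"
        using v(1) w(1) F.m_closed f.hom_closed by blast
    qed (rule A.m_closed[OF fA gA])
  qed (simp add: mccool_def)
qed

definition mccool_group :: "'a set \<Rightarrow> ('a word \<Rightarrow> 'a word) monoid"
  where "mccool_group S = AutoGroup (free_group S) \<lparr>carrier := mccool S\<rparr>"


section \<open>Central subgroups\<close>

definition central_subgroup :: "'a set \<Rightarrow> ('a, 'b) monoid_scheme \<Rightarrow> bool"
  where "central_subgroup C G \<longleftrightarrow> subgroup C G \<and>
    (\<forall>c\<in>C. \<forall>g\<in>carrier G. c \<otimes>\<^bsub>G\<^esub> g = g \<otimes>\<^bsub>G\<^esub> c)"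

end

theory Submission
  imports Defs
begin

text \<open>
  Take three of the basis elements, \<open>x\<^sub>i, x\<^sub>j, x\<^sub>k\<close>, and let \<open>a, b, c\<close> be the partial conjugations
  \<open>x\<^sub>i \<mapsto> x\<^sub>j x\<^sub>i x\<^sub>j\<^sup>-\<^sup>1\<close>, \<open>x\<^sub>j \<mapsto> x\<^sub>k x\<^sub>j x\<^sub>k\<^sup>-\<^sup>1\<close>, \<open>x\<^sub>k \<mapsto> x\<^sub>i x\<^sub>k x\<^sub>i\<^sup>-\<^sup>1\<close>. Modulo inner automorphisms they freely
  generate the McCool group of the free group on these three elements. The lower central
  quotients of that outer group therefore form the free Lie ring on \<open>a, b, c\<close>. The Johnson
  homomorphism sends this Lie ring to the outer derivations of the free Lie ring on
  \<open>x\<^sub>i, x\<^sub>j, x\<^sub>k\<close>, and it is not injective: in degree six the element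
  \<open>[a,[c,[[a,b],[b,c]]]] + [b,[a,[[b,c],[c,a]]]] + [c,[b,[[c,a],[a,b]]]]\<close>, which is nonzero in the
  free Lie ring, acts as the inner derivation by \<open>[[x\<^sub>i,[x\<^sub>j,x\<^sub>k]],[x\<^sub>j,[x\<^sub>k,x\<^sub>i]]]\<close>
  (\<open>exotic_deriv_zero\<close>). The corresponding product of group commutators, corrected by the inner
  automorphism, is \<open>exotic_aut\<close>. It lies in the sixth term of the lower central series of the
  McCool group, and it should act trivially modulo the eighth term of that of the free group. It
  cannot lie in the seventh lower central term, since its outer class does not.

  Three ingredients turn this into a proof.

  The first is to pass from identities between noncommutative polynomials to membership in a lower
  central term of a free group. Instead of proving that the graded Lie ring of a free group is
  torsion-free, the argument of Dynkin, Specht and Wever is used: expand an iterated commutator of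
  degree \<open>m\<close> into words and replace each word by its left-normed commutator; the result is its
  \<open>m\<close>-th power modulo the next term (\<open>dynkin_specht_wever\<close>). So if the expansion vanishes, the
  \<open>m\<close>-th power lies in the next term. Here \<open>m = 7\<close>, and so it is the seventh power of \<open>exotic_aut\<close>
  that is shown to lie in the seventh Andreadakis term (\<open>exotic_aut_pow_andreadakis\<close>). Powers
  do no harm to the conclusion.

  The second is to detect that no nontrivial power of this element lies in the seventh lower
  central term. The McCool group of the free group on \<open>n\<close> generators maps to that of any three of
  them by killing the others (\<open>restrict_aut_hom\<close>), then to the free group on \<open>a, b, c\<close>
  (\<open>outer_word_hom\<close>), then to the group of noncommutative power series with constant term one. On
  the sixth lower central term the coefficient of a fixed word of length six is a homomorphism to
  the integers that vanishes on the seventh. At the word \<open>iijjkk\<close> the exotic element has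
  coefficient \<open>- 1\<close>. If a different triple is used for the projection, one of the
  three indices of the exotic element is killed, and with it every commutator in the word. Thus
  the elements of the \<open>n choose 3\<close> triples are independent. Since they lie in the sixth
  lower central term, they are central modulo the seventh.

  The third is the homomorphism to the free group on \<open>a, b, c\<close>. The partial conjugations generate the
  McCool group (\<open>mccool_generated\<close>), by reduction of the total length of the conjugating words.
  That \<open>a, b, c\<close> are free modulo inner automorphisms is a ping-pong argument
  (\<open>pingpong_word\<close>): the images of the generators translate along axes in the Cayley tree, and
  the last letter of a reduced word in \<open>a, b, c\<close> can be read off from the relative position of the
  three axes.
\<close>

section \<open>Commutator calculus modulo the lower central series\<close>

definition commut :: "('a, 'b) monoid_scheme \<Rightarrow> 'a \<Rightarrow> 'a \<Rightarrow> 'a"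
  where "commut G g h = g \<otimes>\<^bsub>G\<^esub> h \<otimes>\<^bsub>G\<^esub> inv\<^bsub>G\<^esub> g \<otimes>\<^bsub>G\<^esub> inv\<^bsub>G\<^esub> h"

definition lc_eq :: "('a, 'b) monoid_scheme \<Rightarrow> nat \<Rightarrow> 'a \<Rightarrow> 'a \<Rightarrow> bool"
  where "lc_eq G k g h \<longleftrightarrow>
    g \<in> carrier G \<and> h \<in> carrier G \<and> g \<otimes>\<^bsub>G\<^esub> inv\<^bsub>G\<^esub> h \<in> lower_central G k"

context group
begin

lemma inv_mult_cancel:
  assumes "x \<in> carrier G" "y \<in> carrier G"
  shows "inv x \<otimes> (x \<otimes> y) = y" "x \<otimes> (inv x \<otimes> y) = y"
  using assms by (simp_all add: m_assoc[symmetric])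

lemmas group_word = m_assoc inv_mult_group inv_mult_cancel

lemma commut_closed [simp, intro]:
  "g \<in> carrier G \<Longrightarrow> h \<in> carrier G \<Longrightarrow> commut G g h \<in> carrier G"
  by (simp add: commut_def)

lemma inv_commut: "g \<in> carrier G \<Longrightarrow> h \<in> carrier G \<Longrightarrow> inv (commut G g h) = commut G h g"
  by (simp add: commut_def group_word)

lemma commut_one [simp]:
  "g \<in> carrier G \<Longrightarrow> commut G g \<one> = \<one>" "g \<in> carrier G \<Longrightarrow> commut G \<one> g = \<one>"
  by (simp_all add: commut_def)

lemma commut_mult_left:
  assumes "g \<in> carrier G" "h \<in> carrier G" "k \<in> carrier G"
  shows "commut G (g \<otimes> h) k = g \<otimes> commut G h k \<otimes> inv g \<otimes> commut G g k"
  using assms by (simp add: commut_def group_word)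

text \<open>
  The Jacobi identity of the graded Lie ring is the leading term of this identity.
\<close>

lemma hall_witt:
  assumes "x \<in> carrier G" "y \<in> carrier G" "z \<in> carrier G"
  shows "commut G (commut G x y) (y \<otimes> z \<otimes> inv y) \<otimes> commut G (commut G y z) (z \<otimes> x \<otimes> inv z)
     \<otimes> commut G (commut G z x) (x \<otimes> y \<otimes> inv x) = \<one>"
  using assms by (simp add: commut_def group_word)

lemma lower_central_carrier: "g \<in> lower_central G k \<Longrightarrow> g \<in> carrier G"
  using subgroup_lower_central subgroup.mem_carrier by metis

lemma lc_mult: "g \<in> lower_central G k \<Longrightarrow> h \<in> lower_central G k \<Longrightarrow> g \<otimes> h \<in> lower_central G k"
  using subgroup_lower_central subgroup.m_closed by metis

lemma lc_inv: "g \<in> lower_central G k \<Longrightarrow> inv g \<in> lower_central G k"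
  using subgroup_lower_central subgroup.m_inv_closed by metis

lemma lc_one [simp]: "\<one> \<in> lower_central G k"
  using subgroup_lower_central subgroup.one_closed by metis

lemma lc_conj: "h \<in> lower_central G k \<Longrightarrow> g \<in> carrier G \<Longrightarrow> g \<otimes> h \<otimes> inv g \<in> lower_central G k"
  using normal_lower_central normal.inv_op_closed2 by metis

lemma lc_eq_coset: 
  "lc_eq G k g h \<longleftrightarrow> g \<in> carrier G \<and> h \<in> carrier G \<and> lower_central G k #> g = lower_central G k #> h"
proof (cases "g \<in> carrier G \<and> h \<in> carrier G")
  case True
  interpret N: normal "lower_central G k" G by (rule normal_lower_central)
  have "g \<otimes> inv h \<in> lower_central G k \<longleftrightarrow> lower_central G k #> g = lower_central G k #> h"
    using True rcos_self[OF _ subgroup_lower_central] repr_independence[OF _ _ subgroup_lower_central]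
      N.rcos_module[OF group_axioms] by (metis N.rcos_module_imp N.rcos_module_rev is_group)
  with True show ?thesis by (simp add: lc_eq_def)
qed (auto simp: lc_eq_def)

lemma lc_eqD: "lc_eq G k g h \<Longrightarrow> g \<in> carrier G" "lc_eq G k g h \<Longrightarrow> h \<in> carrier G"
  by (simp_all add: lc_eq_def)

lemma lc_eq_refl: "g \<in> carrier G \<Longrightarrow> lc_eq G k g g"
  by (simp add: lc_eq_coset)

lemma lc_eq_sym: "lc_eq G k g h \<Longrightarrow> lc_eq G k h g"
  by (simp add: lc_eq_coset)

lemma lc_eq_trans [trans]: "lc_eq G k g h \<Longrightarrow> lc_eq G k h l \<Longrightarrow> lc_eq G k g l"
  by (simp add: lc_eq_coset)

lemma lc_eq_mult:
  assumes "lc_eq G k g g'" "lc_eq G k h h'"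
  shows "lc_eq G k (g \<otimes> h) (g' \<otimes> h')"
proof -
  interpret N: normal "lower_central G k" G by (rule normal_lower_central)
  show ?thesis using assms N.rcos_sum by (simp add: lc_eq_coset) metis
qed

lemma lc_eq_inv:
  assumes "lc_eq G k g g'"
  shows "lc_eq G k (inv g) (inv g')"
proof -
  interpret N: normal "lower_central G k" G by (rule normal_lower_central)
  show ?thesis using assms N.rcos_inv by (simp add: lc_eq_coset) metis
qed

lemma lc_eq_pow: "lc_eq G k g g' \<Longrightarrow> lc_eq G k (g [^] (n::nat)) (g' [^] n)"
  by (induction n) (auto intro: lc_eq_mult lc_eq_refl dest: lc_eqD)

lemma lc_eq_one: "lc_eq G k g \<one> \<longleftrightarrow> g \<in> lower_central G k"
  using lower_central_carrier by (auto simp: lc_eq_def)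

lemma lc_eq_mem: "lc_eq G k g h \<Longrightarrow> h \<in> lower_central G k \<Longrightarrow> g \<in> lower_central G k"
  using lc_eq_one lc_eq_trans by blast

lemma lc_eq_absorb:
  assumes "h \<in> lower_central G k" "g \<in> carrier G"
  shows "lc_eq G k (g \<otimes> h) g" "lc_eq G k (h \<otimes> g) g"
  using lc_eq_mult[OF lc_eq_refl[of g] iffD2[OF lc_eq_one assms(1)]]
    lc_eq_mult[OF iffD2[OF lc_eq_one assms(1)] lc_eq_refl[of g]] assms lower_central_carrier
  by auto

lemma lc_eq_commute:
  assumes "commut G g h \<in> lower_central G k" "g \<in> carrier G" "h \<in> carrier G"
  shows "lc_eq G k (g \<otimes> h) (h \<otimes> g)"
  using assms by (simp add: lc_eq_def commut_def inv_mult_group m_assoc)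

lemma lc_Suc: "k \<ge> 1 \<Longrightarrow> lower_central G (Suc k) = generate G {commut G g h | g h. g \<in> carrier G \<and> h \<in> lower_central G k}"
  by (cases k) (simp_all add: commut_def)

lemma commut_lc_Suc:
  assumes "g \<in> carrier G" "h \<in> lower_central G k" "k \<ge> 1"
  shows "commut G g h \<in> lower_central G (Suc k)"
  unfolding lc_Suc[OF assms(3)] using assms by (intro generate.incl) blast

lemma lc_Suc_induct:
  assumes "k \<ge> 1" and "subgroup H G"
    and "\<And>g h. g \<in> carrier G \<Longrightarrow> h \<in> lower_central G k \<Longrightarrow> commut G g h \<in> H"
  shows "lower_central G (Suc k) \<subseteq> H"
  unfolding lc_Suc[OF assms(1)] by (rule generate_subgroup_incl) (use assms in blast)+

lemma lc_antimono_Suc: "lower_central G (Suc k) \<subseteq> lower_central G k"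
proof (cases k)
  case (Suc m)
  show ?thesis
  proof (rule lc_Suc_induct)
    fix g h assume g: "g \<in> carrier G" and h: "h \<in> lower_central G k"
    then show "commut G g h \<in> lower_central G k"
      using lc_mult[OF lc_conj[OF h g] lc_inv[OF h]] by (simp add: commut_def)
  qed (use Suc subgroup_lower_central in auto)
qed simp

lemma lc_antimono: "k \<le> l \<Longrightarrow> lower_central G l \<subseteq> lower_central G k"
  using lc_antimono_Suc lift_Suc_antimono_le by metis

lemma lc_eq_mono: "lc_eq G l g h \<Longrightarrow> k \<le> l \<Longrightarrow> lc_eq G k g h"
  using lc_antimono by (auto simp: lc_eq_def)

lemma subgroup_commuting_mod:
  assumes Z: "Z \<subseteq> carrier G"
  shows "subgroup {g \<in> carrier G. \<forall>z\<in>Z. commut G g z \<in> lower_central G k} G"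
proof (rule subgroupI)
  fix a assume a: "a \<in> {g \<in> carrier G. \<forall>z\<in>Z. commut G g z \<in> lower_central G k}"
  have "commut G (inv a) z \<in> lower_central G k" if "z \<in> Z" for z
  proof -
    have "commut G (inv a) z = inv a \<otimes> inv (commut G a z) \<otimes> inv (inv a)"
      using a that Z by (simp add: commut_def group_word subset_iff)
    moreover have "inv (commut G a z) \<in> lower_central G k" using a that lc_inv by blast
    ultimately show ?thesis using lc_conj[of _ k "inv a"] a by simp
  qed
  then show "inv a \<in> {g \<in> carrier G. \<forall>z\<in>Z. commut G g z \<in> lower_central G k}"
    using a by simp
next
  fix a b assume a: "a \<in> {g \<in> carrier G. \<forall>z\<in>Z. commut G g z \<in> lower_central G k}"
    and b: "b \<in> {g \<in> carrier G. \<forall>z\<in>Z. commut G g z \<in> lower_central G k}"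
  then show "a \<otimes> b \<in> {g \<in> carrier G. \<forall>z\<in>Z. commut G g z \<in> lower_central G k}"
    using Z by (auto simp: commut_mult_left subset_iff intro!: lc_mult lc_conj)
qed (use Z in \<open>auto intro!: exI[of _ \<one>]\<close>)

text \<open>
  Induction on the first index: by the Hall-Witt identity a commutator \<open>[[x, y], z]\<close> is the inverse
  of a product of two commutators in which the bracket with \<open>x\<close> has moved outwards, so that the
  induction hypothesis for \<open>y\<close> applies to both.
\<close>

theorem commut_lower_central:
  assumes "g \<in> lower_central G i" "h \<in> lower_central G j" "i \<ge> 1" "j \<ge> 1"
  shows "commut G g h \<in> lower_central G (i + j)"
  using assms(3,1,2,4)
proof (induction i arbitrary: g h j rule: dec_induct)
  case base
  then show ?case using commut_lc_Suc by simp
next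
  case (step i)
  let ?H = "{g \<in> carrier G. \<forall>z\<in>lower_central G j. commut G g z \<in> lower_central G (Suc i + j)}"
  have "lower_central G (Suc i) \<subseteq> ?H"
  proof (rule lc_Suc_induct)
    fix x y assume x: "x \<in> carrier G" and y: "y \<in> lower_central G i"
    have yG: "y \<in> carrier G" using y lower_central_carrier by blast
    have "commut G (commut G x y) z \<in> lower_central G (Suc i + j)" if z: "z \<in> lower_central G j" for z
    proof -
      define t where "t = inv y \<otimes> z \<otimes> y"
      have zG: "z \<in> carrier G" using z lower_central_carrier by blast
      have t: "t \<in> lower_central G j" using lc_conj[OF z, of "inv y"] yG by (simp add: t_def)
      then have tG: "t \<in> carrier G" using lower_central_carrier by blast
      have z_t: "z = y \<otimes> t \<otimes> inv y" using yG zG by (simp add: t_def group_word)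
      have 1: "commut G (commut G y t) (t \<otimes> x \<otimes> inv t) \<in> lower_central G (Suc (i + j))"
      proof -
        have "commut G (t \<otimes> x \<otimes> inv t) (commut G y t) \<in> lower_central G (Suc (i + j))"
          using step.IH[OF y t] step.prems step.hyps x tG by (intro commut_lc_Suc) auto
        from lc_inv[OF this] show ?thesis using x yG tG by (simp add: inv_commut)
      qed
      have 2: "commut G (commut G t x) (x \<otimes> y \<otimes> inv x) \<in> lower_central G (Suc (i + j))"
      proof -
        have "commut G t x \<in> lower_central G (Suc j)"
          using lc_inv[OF commut_lc_Suc[OF x t]] step.prems x tG by (simp add: inv_commut)
        then have "commut G (x \<otimes> y \<otimes> inv x) (commut G t x) \<in> lower_central G (i + Suc j)"
          using step.IH[OF lc_conj[OF y x], of _ "Suc j"] by simp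
        from lc_inv[OF this] show ?thesis using x yG tG by (simp add: inv_commut)
      qed
      let ?A = "commut G (commut G x y) z" and ?B = "commut G (commut G y t) (t \<otimes> x \<otimes> inv t)"
        and ?C = "commut G (commut G t x) (x \<otimes> y \<otimes> inv x)"
      have "?A \<otimes> ?B \<otimes> ?C = \<one>"
        using hall_witt[OF x yG tG] z_t by simp
      then have "?A = inv (?B \<otimes> ?C)"
        using x yG zG tG by (intro inv_equality[symmetric]) (simp_all add: m_assoc)
      then show ?thesis using lc_inv[OF lc_mult[OF 1 2]] by simp
    qed
    then show "commut G x y \<in> ?H" using x yG by simp
  next
    show "subgroup ?H G" by (rule subgroup_commuting_mod) (use lower_central_carrier in blast)
  qed (use step in simp)
  then show ?case using step.prems by blast
qed

text \<open>
  The lemmas up to \<open>jacobi_mod\<close> say that the successive quotients of the lower central series form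
  a graded Lie ring. They are phrased as congruences between group elements, so that no
  quotient groups have to be formed.
\<close>

lemma lc_eq_swap:
  assumes "g \<in> lower_central G i" "h \<in> lower_central G j" "i \<ge> 1" "j \<ge> 1" "k \<le> i + j"
  shows "lc_eq G k (g \<otimes> h) (h \<otimes> g)"
  using commut_lower_central[OF assms(1-4)] lc_antimono[OF assms(5)] assms(1,2) lower_central_carrier
  by (intro lc_eq_commute) auto

lemma lc_eq_conj:
  assumes "g \<in> lower_central G i" "h \<in> lower_central G j" "i \<ge> 1" "j \<ge> 1" "k \<le> i + j"
  shows "lc_eq G k (g \<otimes> h \<otimes> inv g) h"
proof -
  have G: "g \<in> carrier G" "h \<in> carrier G" using assms lower_central_carrier by blast+
  have "lc_eq G k (g \<otimes> h \<otimes> inv g) (h \<otimes> g \<otimes> inv g)"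
    using lc_eq_mult[OF lc_eq_swap[OF assms] lc_eq_refl[of "inv g"]] G by simp
  then show ?thesis using G by (simp add: m_assoc)
qed

lemma commut_mult_left_mod:
  assumes "g \<in> lower_central G i" "g' \<in> lower_central G i" "h \<in> lower_central G j" "i \<ge> 1" "j \<ge> 1"
  shows "lc_eq G (Suc (i + j)) (commut G (g \<otimes> g') h) (commut G g h \<otimes> commut G g' h)"
proof -
  have G: "g \<in> carrier G" "g' \<in> carrier G" "h \<in> carrier G" using assms lower_central_carrier by blast+
  have c: "commut G g h \<in> lower_central G (i + j)" "commut G g' h \<in> lower_central G (i + j)"
    using assms commut_lower_central by auto
  have "lc_eq G (Suc (i + j)) (g \<otimes> commut G g' h \<otimes> inv g \<otimes> commut G g h) (commut G g' h \<otimes> commut G g h)"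
    using assms c G by (intro lc_eq_mult lc_eq_conj[of g i _ "i + j"] lc_eq_refl) auto
  also have "lc_eq G (Suc (i + j)) \<dots> (commut G g h \<otimes> commut G g' h)"
    using assms c by (intro lc_eq_swap[of _ "i + j" _ "i + j"]) auto
  finally show ?thesis using G by (simp add: commut_mult_left)
qed

lemma commut_mult_right_mod:
  assumes "g \<in> lower_central G i" "h \<in> lower_central G j" "h' \<in> lower_central G j" "i \<ge> 1" "j \<ge> 1"
  shows "lc_eq G (Suc (i + j)) (commut G g (h \<otimes> h')) (commut G g h \<otimes> commut G g h')"
proof -
  have G: "g \<in> carrier G" "h \<in> carrier G" "h' \<in> carrier G" using assms lower_central_carrier by blast+
  have "lc_eq G (Suc (i + j)) (inv (commut G (h \<otimes> h') g)) (inv (commut G h g \<otimes> commut G h' g))"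
    using commut_mult_left_mod[OF assms(2,3,1,5,4)] by (intro lc_eq_inv) (simp add: add.commute)
  also have "inv (commut G h g \<otimes> commut G h' g) = commut G g h' \<otimes> commut G g h"
    using G by (simp add: inv_mult_group inv_commut)
  also have "lc_eq G (Suc (i + j)) \<dots> (commut G g h \<otimes> commut G g h')"
    using assms commut_lower_central by (intro lc_eq_swap[of _ "i + j" _ "i + j"]) auto
  finally show ?thesis using G by (simp add: inv_commut)
qed

lemma commut_inv_left_mod:
  assumes "g \<in> lower_central G i" "h \<in> lower_central G j" "i \<ge> 1" "j \<ge> 1"
  shows "lc_eq G (Suc (i + j)) (commut G (inv g) h) (inv (commut G g h))"
proof -
  have G: "g \<in> carrier G" "h \<in> carrier G" using assms lower_central_carrier by blast+
  have "commut G (inv g) h = inv g \<otimes> inv (commut G g h) \<otimes> inv (inv g)"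
    using G by (simp add: commut_def group_word)
  then show ?thesis
    using lc_eq_conj[OF lc_inv[OF assms(1)] lc_inv[OF commut_lower_central[OF assms]], of "Suc (i + j)"] assms
    by simp
qed

lemma commut_inv_right_mod:
  assumes "g \<in> lower_central G i" "h \<in> lower_central G j" "i \<ge> 1" "j \<ge> 1"
  shows "lc_eq G (Suc (i + j)) (commut G g (inv h)) (inv (commut G g h))"
  using lc_eq_inv[OF commut_inv_left_mod[OF assms(2,1,4,3)]] assms lower_central_carrier
  by (simp add: inv_commut add.commute)

lemma commut_pow_left_mod:
  assumes "g \<in> lower_central G i" "h \<in> lower_central G j" "i \<ge> 1" "j \<ge> 1"
  shows "lc_eq G (Suc (i + j)) (commut G (g [^] (n::nat)) h) (commut G g h [^] n)"
proof (induction n)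
  case 0
  then show ?case using assms lower_central_carrier by (auto intro: lc_eq_refl)
next
  case (Suc n)
  have G: "g \<in> carrier G" "h \<in> carrier G" using assms lower_central_carrier by blast+
  have p: "g [^] n \<in> lower_central G i" by (induction n) (auto intro: lc_mult assms)
  have "lc_eq G (Suc (i + j)) (commut G (g [^] Suc n) h) (commut G (g [^] n) h \<otimes> commut G g h)"
    using commut_mult_left_mod[OF p assms] by simp
  also have "lc_eq G (Suc (i + j)) \<dots> (commut G g h [^] Suc n)"
    using Suc G by (simp add: lc_eq_mult lc_eq_refl)
  finally show ?case .
qed

text \<open>
  A bracket with an element of depth \<open>j\<close> gains \<open>j\<close> degrees of precision.
\<close>

lemma lc_eq_commut_left:
  assumes "lc_eq G p g g'" "h \<in> lower_central G j" "p \<ge> 1" "j \<ge> 1"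
  shows "lc_eq G (p + j) (commut G g h) (commut G g' h)"
proof -
  define d where "d = g \<otimes> inv g'"
  have G: "g \<in> carrier G" "g' \<in> carrier G" "h \<in> carrier G"
    using assms lower_central_carrier by (auto simp: lc_eq_def)
  have d: "d \<in> lower_central G p" using assms(1) by (simp add: lc_eq_def d_def)
  have dG: "d \<in> carrier G" using d lower_central_carrier by blast
  have g: "g = d \<otimes> g'" using G by (simp add: d_def group_word)
  have c: "commut G g' h \<in> lower_central G j"
    using commut_lower_central[of g' 1 h j] assms G lc_antimono_Suc by auto
  have "lc_eq G (p + j) (d \<otimes> commut G g' h \<otimes> inv d \<otimes> commut G d h) (commut G g' h \<otimes> \<one>)"
    using commut_lower_central[OF d assms(2)] assms lc_eq_one
    by (intro lc_eq_mult lc_eq_conj[OF d c]) auto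
  then show ?thesis using g commut_mult_left[OF dG G(2,3)] G by simp
qed

lemma lc_eq_commut_right:
  assumes "lc_eq G p g g'" "h \<in> lower_central G j" "p \<ge> 1" "j \<ge> 1"
  shows "lc_eq G (j + p) (commut G h g) (commut G h g')"
  using lc_eq_inv[OF lc_eq_commut_left[OF assms]] assms lower_central_carrier
  by (simp add: inv_commut add.commute lc_eq_def)

lemma commut_absorb_left_mod:
  assumes "lc_eq G (Suc i) g g'" "h \<in> lower_central G j" "i \<ge> 1" "j \<ge> 1"
  shows "lc_eq G (Suc (i + j)) (commut G g h) (commut G g' h)"
  using lc_eq_commut_left[OF assms(1,2)] assms(4) by simp

lemma commut_absorb_right_mod:
  assumes "lc_eq G (Suc j) h h'" "g \<in> lower_central G i" "i \<ge> 1" "j \<ge> 1"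
  shows "lc_eq G (Suc (i + j)) (commut G g h) (commut G g h')"
  using lc_eq_commut_right[OF assms(1,2)] assms(3) by simp

lemma jacobi_mod:
  assumes "x \<in> lower_central G i" "y \<in> lower_central G j" "z \<in> lower_central G k" "i \<ge> 1" "j \<ge> 1" "k \<ge> 1"
  shows "lc_eq G (Suc (i + j + k)) (commut G x (commut G y z))
    (commut G (commut G x y) z \<otimes> inv (commut G (commut G x z) y))"
proof -
  let ?s = "Suc (i + j + k)"
  have G: "x \<in> carrier G" "y \<in> carrier G" "z \<in> carrier G" using assms lower_central_carrier by blast+
  note lc = commut_lower_central
  have xy: "commut G x y \<in> lower_central G (i + j)" and yz: "commut G y z \<in> lower_central G (j + k)"
    and zx: "commut G z x \<in> lower_central G (k + i)" and xz: "commut G x z \<in> lower_central G (i + k)"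
    using assms lc by auto
  have le: "Suc k \<le> j + k" "Suc i \<le> k + i" "Suc j \<le> i + j" using assms by auto
  let ?A = "commut G (commut G x y) z" and ?B = "commut G (commut G y z) x"
    and ?C = "commut G (commut G z x) y"
  have 1: "lc_eq G ?s (commut G (commut G x y) (y \<otimes> z \<otimes> inv y)) ?A"
    using commut_absorb_right_mod[OF lc_eq_conj[OF assms(2,3,5,6) le(1)] xy] assms
    by (simp add: add_ac)
  have 2: "lc_eq G ?s (commut G (commut G y z) (z \<otimes> x \<otimes> inv z)) ?B"
    using commut_absorb_right_mod[OF lc_eq_conj[OF assms(3,1,6,4) le(2)] yz] assms
    by (simp add: add_ac)
  have 3: "lc_eq G ?s (commut G (commut G z x) (x \<otimes> y \<otimes> inv x)) ?C"
    using commut_absorb_right_mod[OF lc_eq_conj[OF assms(1,2,4,5) le(3)] zx] assms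
    by (simp add: add_ac)
  have ABC: "lc_eq G ?s (?A \<otimes> ?B \<otimes> ?C) \<one>"
    using lc_eq_sym[OF lc_eq_mult[OF lc_eq_mult[OF 1 2] 3]] hall_witt[OF G] by simp
  have C: "lc_eq G ?s ?C (inv (commut G (commut G x z) y))"
    using commut_inv_left_mod[OF xz assms(2)] assms G by (simp add: inv_commut add_ac)
  have mem: "?A \<in> lower_central G (i + j + k)" "?B \<in> lower_central G (i + j + k)" "?C \<in> lower_central G (i + j + k)"
    using lc[OF xy assms(3)] lc[OF yz assms(1)] lc[OF zx assms(2)] assms by (simp_all add: add_ac)
  have "lc_eq G ?s (inv ?B) (inv ?B \<otimes> (?A \<otimes> ?B \<otimes> ?C))"
    using lc_eq_mult[OF lc_eq_refl lc_eq_sym[OF ABC], of "inv ?B"] G by simp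
  also have "lc_eq G ?s \<dots> (inv ?B \<otimes> (?B \<otimes> ?A \<otimes> ?C))"
    using G mem assms
    by (intro lc_eq_mult lc_eq_refl lc_eq_swap[of _ "i + j + k" _ "i + j + k"]) auto
  also have "inv ?B \<otimes> (?B \<otimes> ?A \<otimes> ?C) = ?A \<otimes> ?C" using G by (simp add: group_word)
  also have "lc_eq G ?s \<dots> (?A \<otimes> inv (commut G (commut G x z) y))"
    using C G by (intro lc_eq_mult lc_eq_refl) auto
  finally show ?thesis using G by (simp add: inv_commut)
qed

end

section \<open>Noncommutative power series\<close>

text \<open>
  The convolution product of functions on words. The recursion peels the first letter off the word;
  this gives associativity by a plain induction and lets single coefficients be computed
  by rewriting.
\<close>

fun nc_mult :: "('a list \<Rightarrow> int) \<Rightarrow> ('a list \<Rightarrow> int) \<Rightarrow> 'a list \<Rightarrow> int"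
  where
    "nc_mult f g [] = f [] * g []"
  | "nc_mult f g (a # w) = f [] * g (a # w) + nc_mult (\<lambda>u. f (a # u)) g w"

lemma nc_mult_add:
  "nc_mult (\<lambda>u. f u + f' u) g w = nc_mult f g w + nc_mult f' g w"
  "nc_mult f (\<lambda>u. g u + g' u) w = nc_mult f g w + nc_mult f g' w"
  by (induction w arbitrary: f f') (simp_all add: algebra_simps)

lemma nc_mult_scale: "nc_mult (\<lambda>u. c * f u) g w = c * nc_mult f g w"
  by (induction w arbitrary: f) (simp_all add: algebra_simps)

lemma nc_mult_zero: "nc_mult (\<lambda>u. 0) g w = 0"
  by (induction w) simp_all

lemma nc_mult_assoc: "nc_mult (nc_mult f g) h w = nc_mult f (nc_mult g h) w"
  by (induction w arbitrary: f) (simp_all add: algebra_simps nc_mult_add nc_mult_scale)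

text \<open>
  Power series, and not only polynomials, because \<open>1 + X\<close> has to be invertible in the Magnus
  representation. The same ring also contains the expansions of Lie expressions.
\<close>

typedef 'a ncps = "UNIV :: ('a list \<Rightarrow> int) set"
  morphisms coeff NCPS by simp

lemma coeff_NCPS [simp]: "coeff (NCPS f) = f"
  by (simp add: NCPS_inverse)

lemma ncps_eqI: "(\<And>w. coeff f w = coeff g w) \<Longrightarrow> f = g"
  by (metis coeff_inject ext)

instantiation ncps :: (type) ring_1
begin

definition "0 = NCPS (\<lambda>w. 0)"
definition "1 = NCPS (\<lambda>w. if w = [] then 1 else 0)"
definition "f + g = NCPS (\<lambda>w. coeff f w + coeff g w)"
definition "f - g = NCPS (\<lambda>w. coeff f w - coeff g w)"
definition "- f = NCPS (\<lambda>w. - coeff f w)"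
definition "f * g = NCPS (nc_mult (coeff f) (coeff g))"

lemma coeff_simps [simp]:
  "coeff 0 w = 0"
  "coeff 1 w = (if w = [] then 1 else 0)"
  "coeff (f + g) w = coeff f w + coeff g w"
  "coeff (f - g) w = coeff f w - coeff g w"
  "coeff (- f) w = - coeff f w"
  by (simp_all add: zero_ncps_def one_ncps_def plus_ncps_def minus_ncps_def uminus_ncps_def)

lemma coeff_mult: "coeff (f * g) w = nc_mult (coeff f) (coeff g) w"
  by (simp add: times_ncps_def)

instance
proof
  fix f g h :: "'a ncps"
  show "f * g * h = f * (g * h)"
    by (rule ncps_eqI) (simp add: times_ncps_def nc_mult_assoc)
  have [abs_def]: "coeff (f + g) w = coeff f w + coeff g w" for f g :: "'a ncps" and w by simp
  then show "(f + g) * h = f * h + g * h" "f * (g + h) = f * g + f * h"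
    by (auto intro!: ncps_eqI simp: coeff_mult nc_mult_add)
  have "nc_mult (coeff 1) (coeff f) w = coeff f w" for w
    by (cases w) (simp_all add: nc_mult_zero)
  then show "1 * f = f" by (auto intro!: ncps_eqI simp: coeff_mult)
  have "nc_mult c (coeff 1) w = c w" for w and c :: "'a list \<Rightarrow> int"
    by (induction w arbitrary: c) simp_all
  then show "f * 1 = f" by (auto intro!: ncps_eqI simp: coeff_mult)
  show "(0::'a ncps) \<noteq> 1"
    by (metis coeff_simps(1,2) zero_neq_one)
qed (auto intro!: ncps_eqI)

end

definition nc_var :: "'a \<Rightarrow> 'a ncps"
  where "nc_var a = NCPS (\<lambda>w. if w = [a] then 1 else 0)"

lemma coeff_nc_var [simp]: "coeff (nc_var a) w = (if w = [a] then 1 else 0)"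
  by (simp add: nc_var_def)

lemma coeff_mult_var: "coeff (f * nc_var a) (w @ [b]) = (if b = a then coeff f w else 0)"
proof -
  have "nc_mult c (coeff (nc_var a)) (w @ [b]) = (if b = a then c w else 0)" for c
    by (induction w arbitrary: c) auto
  then show ?thesis by (simp add: coeff_mult)
qed

lemma coeff_var_mult: "coeff (nc_var a * f) w = (case w of [] \<Rightarrow> 0 | b # u \<Rightarrow> if b = a then coeff f u else 0)"
proof (cases w)
  case (Cons b u)
  have "nc_mult (\<lambda>v. if v = [] then 1 else 0) c u = c u" for c :: "'a list \<Rightarrow> int"
    by (cases u) (simp_all add: nc_mult_zero)
  then show ?thesis using Cons by (auto simp: coeff_mult nc_mult_zero)
qed (simp add: coeff_mult)

section \<open>Lie expressions and left-normed commutators\<close>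

text \<open>
  Formal expressions, and not elements of a free Lie ring: derivations can then be defined by
  recursion, and equality of Lie elements is only ever tested after evaluation in an associative
  ring.
\<close>

datatype 'a lie_exp = Zero | Gen 'a | Add "'a lie_exp" "'a lie_exp" | Neg "'a lie_exp"
  | Br "'a lie_exp" "'a lie_exp"

primrec lie_eval :: "('a \<Rightarrow> 'r::ring_1) \<Rightarrow> 'a lie_exp \<Rightarrow> 'r"
  where
    "lie_eval X Zero = 0"
  | "lie_eval X (Gen a) = X a"
  | "lie_eval X (Add s t) = lie_eval X s + lie_eval X t"
  | "lie_eval X (Neg s) = - lie_eval X s"
  | "lie_eval X (Br s t) = lie_eval X s * lie_eval X t - lie_eval X t * lie_eval X s"

text \<open>
  \<open>lie_rep G J x m g e\<close> says that \<open>g\<close>, modulo the term of index \<open>m + 1\<close>, is the value of the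
  homogeneous expression \<open>e\<close> of degree \<open>m\<close> in the graded Lie ring of \<open>G\<close>, where the generator \<open>j\<close>
  is read as the class of \<open>x j\<close>.
\<close>

inductive lie_rep :: "('g, 'b) monoid_scheme \<Rightarrow> 'a set \<Rightarrow> ('a \<Rightarrow> 'g) \<Rightarrow> nat \<Rightarrow> 'g \<Rightarrow> 'a lie_exp \<Rightarrow> bool"
  for G J x
  where
    zero: "m \<ge> 1 \<Longrightarrow> lie_rep G J x m \<one>\<^bsub>G\<^esub> Zero"
  | gen: "j \<in> J \<Longrightarrow> lie_rep G J x 1 (x j) (Gen j)"
  | add: "lie_rep G J x m g s \<Longrightarrow> lie_rep G J x m h t \<Longrightarrow> lie_rep G J x m (g \<otimes>\<^bsub>G\<^esub> h) (Add s t)"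
  | neg: "lie_rep G J x m g s \<Longrightarrow> lie_rep G J x m (inv\<^bsub>G\<^esub> g) (Neg s)"
  | br: "lie_rep G J x k g s \<Longrightarrow> lie_rep G J x l h t \<Longrightarrow> lie_rep G J x (k + l) (commut G g h) (Br s t)"
  | absorb: "lie_rep G J x m g s \<Longrightarrow> h \<in> lower_central G (Suc m) \<Longrightarrow> lie_rep G J x m (g \<otimes>\<^bsub>G\<^esub> h) s"

definition list_prod :: "('g, 'b) monoid_scheme \<Rightarrow> ('a \<Rightarrow> 'g) \<Rightarrow> 'a list \<Rightarrow> 'g"
  where "list_prod G t js = foldr (\<lambda>j y. t j \<otimes>\<^bsub>G\<^esub> y) js \<one>\<^bsub>G\<^esub>"

lemma list_prod_simps [simp]:
  "list_prod G t [] = \<one>\<^bsub>G\<^esub>"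
  "list_prod G t (j # js) = t j \<otimes>\<^bsub>G\<^esub> list_prod G t js"
  by (simp_all add: list_prod_def)

text \<open>
  For a function \<open>Q\<close> on words this is the product of the left-normed commutators
  \<open>[\<dots>[x\<^sub>1, x\<^sub>2], \<dots>, x\<^sub>m]\<close> over the words of length \<open>m\<close>, each with exponent \<open>Q\<close> of the word. Sorting the words
  by their last letter replaces the product over all words by nested products over the alphabet.
\<close>

fun left_normed :: "('g, 'b) monoid_scheme \<Rightarrow> 'a list \<Rightarrow> ('a \<Rightarrow> 'g) \<Rightarrow> nat \<Rightarrow> ('a list \<Rightarrow> int) \<Rightarrow> 'g"
  where
    "left_normed G js x 0 Q = \<one>\<^bsub>G\<^esub>"
  | "left_normed G js x (Suc 0) Q = list_prod G (\<lambda>j. x j [^]\<^bsub>G\<^esub> Q [j]) js"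
  | "left_normed G js x (Suc (Suc m)) Q =
      list_prod G (\<lambda>j. commut G (left_normed G js x (Suc m) (\<lambda>u. Q (u @ [j]))) (x j)) js"

lemma left_normed_Suc:
  "m \<ge> 1 \<Longrightarrow> left_normed G js x (Suc m) Q =
      list_prod G (\<lambda>j. commut G (left_normed G js x m (\<lambda>u. Q (u @ [j]))) (x j)) js"
  by (cases m) simp_all

context group
begin

lemma lie_rep_mem:
  assumes "lie_rep G J x m g s" "x ` J \<subseteq> carrier G"
  shows "m \<ge> 1 \<and> g \<in> lower_central G m"
  using assms(1)
proof induction
  case (absorb m g s h)
  then show ?case using lc_antimono_Suc by (auto intro: lc_mult)
qed (use assms(2) in \<open>auto intro: lc_mult lc_inv commut_lower_central\<close>)

lemma list_prod_mem:
  "(\<And>j. j \<in> set js \<Longrightarrow> t j \<in> lower_central G m) \<Longrightarrow> list_prod G t js \<in> lower_central G m"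
  by (induction js) (auto intro: lc_mult)

lemma list_prod_one: "(\<And>j. j \<in> set js \<Longrightarrow> t j = \<one>) \<Longrightarrow> list_prod G t js = \<one>"
  by (induction js) auto

lemma list_prod_single:
  assumes "distinct js" "i \<in> set js" "t i \<in> carrier G" "\<And>j. j \<in> set js \<Longrightarrow> j \<noteq> i \<Longrightarrow> t j = \<one>"
  shows "list_prod G t js = t i"
  using assms
proof (induction js)
  case (Cons a js)
  show ?case
  proof (cases "a = i")
    case True
    then have "list_prod G t js = \<one>" using Cons.prems by (intro list_prod_one) auto
    then show ?thesis using True Cons.prems by simp
  next
    case False
    then show ?thesis using Cons by simp
  qed
qed simp

lemma list_prod_mult_mod:
  assumes "m \<ge> 1" "\<And>j. j \<in> set js \<Longrightarrow> u j \<in> lower_central G m" "\<And>j. j \<in> set js \<Longrightarrow> v j \<in> lower_central G m"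
    and "\<And>j. j \<in> set js \<Longrightarrow> lc_eq G (Suc m) (t j) (u j \<otimes> v j)"
  shows "lc_eq G (Suc m) (list_prod G t js) (list_prod G u js \<otimes> list_prod G v js)"
  using assms
proof (induction js)
  case Nil
  then show ?case by (simp add: lc_eq_refl)
next
  case (Cons a js)
  let ?u = "list_prod G u js" and ?v = "list_prod G v js"
  have m: "u a \<in> lower_central G m" "v a \<in> lower_central G m" "?u \<in> lower_central G m" "?v \<in> lower_central G m"
    using Cons.prems by (auto intro: list_prod_mem)
  then have c: "u a \<in> carrier G" "v a \<in> carrier G" "?u \<in> carrier G" "?v \<in> carrier G"
    using lower_central_carrier by blast+
  have "lc_eq G (Suc m) (t a \<otimes> list_prod G t js) ((u a \<otimes> v a) \<otimes> (?u \<otimes> ?v))"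
    using Cons by (intro lc_eq_mult) auto
  also have "(u a \<otimes> v a) \<otimes> (?u \<otimes> ?v) = u a \<otimes> ((v a \<otimes> ?u) \<otimes> ?v)" using c by (simp add: m_assoc)
  also have "lc_eq G (Suc m) \<dots> (u a \<otimes> ((?u \<otimes> v a) \<otimes> ?v))"
    using c m Cons.prems(1) by (intro lc_eq_mult lc_eq_refl lc_eq_swap[of _ m _ m]) auto
  also have "u a \<otimes> ((?u \<otimes> v a) \<otimes> ?v) = (u a \<otimes> ?u) \<otimes> (v a \<otimes> ?v)" using c by (simp add: m_assoc)
  finally show ?case by simp
qed

context
  fixes js :: "'i list" and x :: "'i \<Rightarrow> 'a"
  assumes js: "distinct js" and x: "\<And>j. j \<in> set js \<Longrightarrow> x j \<in> carrier G"
begin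

lemma left_normed_mem: "m \<ge> 1 \<Longrightarrow> left_normed G js x m Q \<in> lower_central G m"
proof (induction m arbitrary: Q rule: dec_induct)
  case base
  show ?case using x list_prod_mem[of js _ 1] by simp
next
  case (step m)
  have "commut G (left_normed G js x m (\<lambda>u. Q (u @ [j]))) (x j) \<in> lower_central G (Suc m)"
    if "j \<in> set js" for j
    using commut_lower_central[OF step.IH, of "x j" 1] step.hyps x that by simp
  then show ?case
    unfolding left_normed_Suc[OF step.hyps(1)] by (rule list_prod_mem)
qed

lemma left_normed_carrier: "left_normed G js x m Q \<in> carrier G"
  using left_normed_mem[of m Q] lower_central_carrier by (cases m) auto

lemma left_normed_zero: "left_normed G js x m (\<lambda>u. 0) = \<one>"
  using x by (induction m rule: induct_nat_012) (auto intro: list_prod_one)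

lemma left_normed_add:
  assumes "m \<ge> 1"
  shows "lc_eq G (Suc m) (left_normed G js x m (\<lambda>u. Q u + R u))
    (left_normed G js x m Q \<otimes> left_normed G js x m R)"
  using assms
proof (induction m arbitrary: Q R rule: dec_induct)
  case base
  show ?case unfolding One_nat_def left_normed.simps
    using x by (intro list_prod_mult_mod) (auto simp: int_pow_mult lc_eq_refl)
next
  case (step m)
  show ?case
    unfolding left_normed_Suc[OF step.hyps(1)]
  proof (rule list_prod_mult_mod)
    fix j assume j: "j \<in> set js"
    let ?c = "\<lambda>Q. left_normed G js x m (\<lambda>u. Q (u @ [j]))"
    have xj: "x j \<in> lower_central G 1" using x j by simp
    show "commut G (?c Q) (x j) \<in> lower_central G (Suc m)" for Q
      using commut_lower_central[OF left_normed_mem xj] step.hyps by simp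
    then show "commut G (?c R) (x j) \<in> lower_central G (Suc m)" .
    have "lc_eq G (Suc (m + 1)) (commut G (?c (\<lambda>u. Q u + R u)) (x j)) (commut G (?c Q \<otimes> ?c R) (x j))"
      using step xj by (intro commut_absorb_left_mod lc_mult left_normed_mem) auto
    also have "lc_eq G (Suc (m + 1)) \<dots> (commut G (?c Q) (x j) \<otimes> commut G (?c R) (x j))"
      using step.hyps xj by (intro commut_mult_left_mod left_normed_mem) auto
    finally show "lc_eq G (Suc (Suc m)) (commut G (?c (\<lambda>u. Q u + R u)) (x j))
        (commut G (?c Q) (x j) \<otimes> commut G (?c R) (x j))" by simp
  qed simp
qed

lemma left_normed_neg:
  assumes "m \<ge> 1"
  shows "lc_eq G (Suc m) (left_normed G js x m (\<lambda>u. - Q u)) (inv (left_normed G js x m Q))"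
proof -
  let ?c = "left_normed G js x m"
  have "lc_eq G (Suc m) (inv (?c Q) \<otimes> (?c Q \<otimes> ?c (\<lambda>u. - Q u))) (inv (?c Q) \<otimes> \<one>)"
    using lc_eq_sym[OF left_normed_add[OF assms, of Q "\<lambda>u. - Q u"]] left_normed_carrier
    by (intro lc_eq_mult lc_eq_refl) (auto simp: left_normed_zero)
  then show ?thesis using left_normed_carrier by (simp add: inv_mult_cancel)
qed

lemma left_normed_diff:
  assumes "m \<ge> 1"
  shows "lc_eq G (Suc m) (left_normed G js x m (\<lambda>u. Q u - R u))
    (left_normed G js x m Q \<otimes> inv (left_normed G js x m R))"
proof -
  have "lc_eq G (Suc m) (left_normed G js x m (\<lambda>u. Q u - R u))
      (left_normed G js x m Q \<otimes> left_normed G js x m (\<lambda>u. - R u))"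
    using left_normed_add[OF assms, of Q "\<lambda>u. - R u"] by simp
  also have "lc_eq G (Suc m) \<dots> (left_normed G js x m Q \<otimes> inv (left_normed G js x m R))"
    using assms left_normed_carrier by (intro lc_eq_mult lc_eq_refl left_normed_neg)
  finally show ?thesis .
qed

text \<open>
  Bracketing with the Lie element \<open>h\<close> corresponds to right multiplication by the expansion of \<open>h\<close>. For
  a generator this is how left-normed commutators are formed, and both sides turn brackets into
  commutators of operators, by the Jacobi identity.
\<close>

lemma left_normed_mult_rep:
  assumes "lie_rep G (set js) x l h e" "m \<ge> 1"
  shows "lc_eq G (Suc (m + l)) (left_normed G js x (m + l) (coeff (S * lie_eval nc_var e)))
    (commut G (left_normed G js x m (coeff S)) h)"
  using assms
proof (induction arbitrary: m S)
  case (zero l)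
  have "coeff (S * lie_eval nc_var Zero) = (\<lambda>u. 0)" by auto
  then show ?case using left_normed_carrier by (simp add: left_normed_zero lc_eq_refl)
next
  case (gen j)
  have "left_normed G js x (Suc m) (coeff (S * nc_var j)) = commut G (left_normed G js x m (coeff S)) (x j)"
    unfolding left_normed_Suc[OF gen.prems]
  proof (subst list_prod_single[OF js gen.hyps])
    have "(\<lambda>u. coeff (S * nc_var j) (u @ [i])) = (\<lambda>u. 0)" if "i \<noteq> j" for i
      using that by (simp add: coeff_mult_var)
    then show "commut G (left_normed G js x m (\<lambda>u. coeff (S * nc_var j) (u @ [i]))) (x i) = \<one>"
      if "i \<in> set js" "i \<noteq> j" for i
      using that x by (simp add: left_normed_zero)
  qed (use x gen.hyps left_normed_carrier in \<open>simp_all add: coeff_mult_var\<close>)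
  then show ?case using left_normed_carrier x gen.hyps by (simp add: lc_eq_refl)
next
  case (add l g s h t)
  let ?c = "left_normed G js x m (coeff S)"
  have mem: "g \<in> lower_central G l" "h \<in> lower_central G l" "l \<ge> 1"
    using add.hyps lie_rep_mem x by blast+
  have eq: "coeff (S * lie_eval nc_var (Add s t)) =
      (\<lambda>u. coeff (S * lie_eval nc_var s) u + coeff (S * lie_eval nc_var t) u)"
    by (simp add: distrib_left coeff_simps(3)[abs_def])
  have "lc_eq G (Suc (m + l)) (left_normed G js x (m + l) (coeff (S * lie_eval nc_var (Add s t))))
      (left_normed G js x (m + l) (coeff (S * lie_eval nc_var s)) \<otimes> left_normed G js x (m + l) (coeff (S * lie_eval nc_var t)))"
    unfolding eq using add.prems by (intro left_normed_add) simp
  also have "lc_eq G (Suc (m + l)) \<dots> (commut G ?c g \<otimes> commut G ?c h)"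
    using add.IH add.prems by (intro lc_eq_mult) auto
  also have "lc_eq G (Suc (m + l)) \<dots> (commut G ?c (g \<otimes> h))"
    using mem add.prems by (intro lc_eq_sym[OF commut_mult_right_mod] left_normed_mem) auto
  finally show ?case .
next
  case (neg l g s)
  let ?c = "left_normed G js x m (coeff S)"
  have mem: "g \<in> lower_central G l" "l \<ge> 1"
    using neg.hyps lie_rep_mem x by blast+
  have eq: "coeff (S * lie_eval nc_var (Neg s)) = (\<lambda>u. - coeff (S * lie_eval nc_var s) u)"
    by (simp add: coeff_simps(5)[abs_def])
  have "lc_eq G (Suc (m + l)) (left_normed G js x (m + l) (coeff (S * lie_eval nc_var (Neg s))))
      (inv (left_normed G js x (m + l) (coeff (S * lie_eval nc_var s))))"
    unfolding eq using neg.prems by (intro left_normed_neg) simp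
  also have "lc_eq G (Suc (m + l)) \<dots> (inv (commut G ?c g))"
    using neg.IH neg.prems by (intro lc_eq_inv) auto
  also have "lc_eq G (Suc (m + l)) \<dots> (commut G ?c (inv g))"
    using mem neg.prems by (intro lc_eq_sym[OF commut_inv_right_mod] left_normed_mem) auto
  finally show ?case .
next
  case (br k g s l h t)
  let ?c = "left_normed G js x m (coeff S)" and ?E = "lie_eval nc_var"
  let ?n = "Suc (m + (k + l))"
  have mem: "g \<in> lower_central G k" "k \<ge> 1" "h \<in> lower_central G l" "l \<ge> 1"
    using br.hyps lie_rep_mem x by blast+
  have c: "?c \<in> lower_central G m" using br.prems left_normed_mem by blast
  have cg: "commut G ?c g \<in> lower_central G (m + k)" and ch: "commut G ?c h \<in> lower_central G (m + l)"
    using c mem br.prems by (auto intro: commut_lower_central)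
  have eq: "coeff (S * ?E (Br s t)) = (\<lambda>u. coeff ((S * ?E s) * ?E t) u - coeff ((S * ?E t) * ?E s) u)"
    by (simp add: right_diff_distrib mult.assoc coeff_simps(4)[abs_def])
  have 1: "lc_eq G ?n (left_normed G js x (m + (k + l)) (coeff ((S * ?E s) * ?E t))) (commut G (commut G ?c g) h)"
  proof -
    have "lc_eq G (Suc (m + k + l)) (left_normed G js x (m + k + l) (coeff ((S * ?E s) * ?E t)))
        (commut G (left_normed G js x (m + k) (coeff (S * ?E s))) h)"
      using br.IH(2)[of "m + k"] br.prems by simp
    also have "lc_eq G (Suc (m + k + l)) \<dots> (commut G (commut G ?c g) h)"
      using br.IH(1) br.prems mem cg by (intro commut_absorb_left_mod) auto
    finally show ?thesis by (simp add: add_ac)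
  qed
  have 2: "lc_eq G ?n (left_normed G js x (m + (k + l)) (coeff ((S * ?E t) * ?E s))) (commut G (commut G ?c h) g)"
  proof -
    have "lc_eq G (Suc (m + l + k)) (left_normed G js x (m + l + k) (coeff ((S * ?E t) * ?E s)))
        (commut G (left_normed G js x (m + l) (coeff (S * ?E t))) g)"
      using br.IH(1)[of "m + l"] br.prems by simp
    also have "lc_eq G (Suc (m + l + k)) \<dots> (commut G (commut G ?c h) g)"
      using br.IH(2) br.prems mem ch by (intro commut_absorb_left_mod) auto
    finally show ?thesis by (simp add: add_ac)
  qed
  have "lc_eq G ?n (left_normed G js x (m + (k + l)) (coeff (S * ?E (Br s t))))
    (left_normed G js x (m + (k + l)) (coeff ((S * ?E s) * ?E t)) \<otimes>
     inv (left_normed G js x (m + (k + l)) (coeff ((S * ?E t) * ?E s))))"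
    unfolding eq using br.prems by (intro left_normed_diff) simp
  also have "lc_eq G ?n \<dots> (commut G (commut G ?c g) h \<otimes> inv (commut G (commut G ?c h) g))"
    using 1 2 by (intro lc_eq_mult lc_eq_inv)
  also have "lc_eq G ?n \<dots> (commut G ?c (commut G g h))"
    using lc_eq_sym[OF jacobi_mod[OF c mem(1,3) br.prems mem(2,4)]] by (simp add: add_ac)
  finally show ?case .
next
  case (absorb l g s h)
  let ?c = "left_normed G js x m (coeff S)"
  have mem: "g \<in> lower_central G l" "l \<ge> 1"
    using absorb.hyps lie_rep_mem x by blast+
  then have "lc_eq G (Suc (m + l)) (commut G ?c g) (commut G ?c (g \<otimes> h))"
    using absorb lower_central_carrier
    by (intro lc_eq_sym[OF commut_absorb_right_mod] lc_eq_absorb left_normed_mem) auto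
  then show ?case using absorb.IH[OF absorb.prems] lc_eq_trans by blast
qed

text \<open>
  In the step for a bracket \<open>[g, h]\<close> of degrees \<open>k\<close> and \<open>l\<close> the two halves of the
  expansion contribute \<open>[g\<^sup>k, h]\<close> and the inverse of \<open>[h\<^sup>l, g]\<close>, which together make \<open>[g, h]\<^sup>k\<^sup>+\<^sup>l\<close>.
\<close>

theorem dynkin_specht_wever:
  assumes "lie_rep G (set js) x m g e"
  shows "lc_eq G (Suc m) (left_normed G js x m (coeff (lie_eval nc_var e))) (g [^] m)"
  using assms
proof induction
  case (zero m)
  have "coeff (lie_eval nc_var Zero) = (\<lambda>u. 0)" by auto
  then show ?case by (simp add: left_normed_zero lc_eq_refl)
next
  case (gen j)
  have "list_prod G (\<lambda>i. x i [^] coeff (nc_var j) [i]) js = x j"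
    using x gen by (subst list_prod_single[OF js, of j]) auto
  then show ?case using x gen by (simp add: lc_eq_refl)
next
  case (add m g s h t)
  have mem: "g \<in> lower_central G m" "h \<in> lower_central G m" "m \<ge> 1"
    using add.hyps lie_rep_mem x by blast+
  then have G: "g \<in> carrier G" "h \<in> carrier G" using lower_central_carrier by blast+
  have pow: "lc_eq G (Suc m) ((g \<otimes> h) [^] n) (g [^] n \<otimes> h [^] n)" for n :: nat
  proof (induction n)
    case (Suc n)
    have hn: "h [^] n \<in> lower_central G m" by (induction n) (auto intro: lc_mult mem)
    have "lc_eq G (Suc m) ((g \<otimes> h) [^] n \<otimes> (g \<otimes> h)) ((g [^] n \<otimes> h [^] n) \<otimes> (g \<otimes> h))"
      using Suc G by (intro lc_eq_mult lc_eq_refl) auto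
    also have "(g [^] n \<otimes> h [^] n) \<otimes> (g \<otimes> h) = g [^] n \<otimes> ((h [^] n \<otimes> g) \<otimes> h)"
      using G by (simp add: m_assoc)
    also have "lc_eq G (Suc m) \<dots> (g [^] n \<otimes> ((g \<otimes> h [^] n) \<otimes> h))"
      using G mem hn by (intro lc_eq_mult lc_eq_refl lc_eq_swap[of _ m _ m]) auto
    also have "g [^] n \<otimes> ((g \<otimes> h [^] n) \<otimes> h) = (g [^] n \<otimes> g) \<otimes> (h [^] n \<otimes> h)"
      using G by (simp add: m_assoc)
    finally show ?case by simp
  qed (simp add: lc_eq_refl)
  have eq: "coeff (lie_eval nc_var (Add s t)) =
      (\<lambda>u. coeff (lie_eval nc_var s) u + coeff (lie_eval nc_var t) u)"
    by (simp add: coeff_simps(3)[abs_def])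
  have "lc_eq G (Suc m) (left_normed G js x m (coeff (lie_eval nc_var (Add s t))))
     (left_normed G js x m (coeff (lie_eval nc_var s)) \<otimes> left_normed G js x m (coeff (lie_eval nc_var t)))"
    unfolding eq using mem by (intro left_normed_add)
  also have "lc_eq G (Suc m) \<dots> (g [^] m \<otimes> h [^] m)"
    using add.IH by (rule lc_eq_mult)
  also have "lc_eq G (Suc m) \<dots> ((g \<otimes> h) [^] m)" by (rule lc_eq_sym[OF pow])
  finally show ?case .
next
  case (neg m g s)
  have mem: "g \<in> lower_central G m" "m \<ge> 1"
    using neg.hyps lie_rep_mem x by blast+
  have eq: "coeff (lie_eval nc_var (Neg s)) = (\<lambda>u. - coeff (lie_eval nc_var s) u)"
    by (simp add: coeff_simps(5)[abs_def])
  have "lc_eq G (Suc m) (left_normed G js x m (coeff (lie_eval nc_var (Neg s))))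
     (inv (left_normed G js x m (coeff (lie_eval nc_var s))))"
    unfolding eq using mem by (intro left_normed_neg)
  also have "lc_eq G (Suc m) \<dots> (inv (g [^] m))"
    using neg.IH by (rule lc_eq_inv)
  also have "inv (g [^] m) = inv g [^] m"
    using lower_central_carrier[OF mem(1)] by (simp add: nat_pow_inv)
  finally show ?case .
next
  case (br k g s l h t)
  let ?E = "lie_eval nc_var" and ?c = "left_normed G js x"
  let ?n = "Suc (k + l)"
  have mem: "g \<in> lower_central G k" "k \<ge> 1" "h \<in> lower_central G l" "l \<ge> 1"
    using br.hyps lie_rep_mem x by blast+
  then have G: "g \<in> carrier G" "h \<in> carrier G" using lower_central_carrier by blast+
  have pw: "y [^] (n::nat) \<in> lower_central G i" if "y \<in> lower_central G i" for y n i
    using that by (induction n) (auto intro: lc_mult)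
  have eq: "coeff (?E (Br s t)) = (\<lambda>u. coeff (?E s * ?E t) u - coeff (?E t * ?E s) u)"
    by (simp add: coeff_simps(4)[abs_def])
  have 1: "lc_eq G ?n (?c (k + l) (coeff (?E s * ?E t))) (commut G g h [^] k)"
  proof -
    have "lc_eq G ?n (?c (k + l) (coeff (?E s * ?E t))) (commut G (?c k (coeff (?E s))) h)"
      using left_normed_mult_rep[OF br.hyps(2) mem(2)] by simp
    also have "lc_eq G ?n \<dots> (commut G (g [^] k) h)"
      using mem br.IH(1) pw by (intro commut_absorb_left_mod) auto
    also have "lc_eq G ?n \<dots> (commut G g h [^] k)"
      using mem by (intro commut_pow_left_mod)
    finally show ?thesis .
  qed
  have 2: "lc_eq G ?n (?c (k + l) (coeff (?E t * ?E s))) (commut G h g [^] l)"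
  proof -
    have "lc_eq G (Suc (l + k)) (?c (l + k) (coeff (?E t * ?E s))) (commut G (?c l (coeff (?E t))) g)"
      using left_normed_mult_rep[OF br.hyps(1) mem(4)] by simp
    also have "lc_eq G (Suc (l + k)) \<dots> (commut G (h [^] l) g)"
      using mem br.IH(2) pw by (intro commut_absorb_left_mod) auto
    also have "lc_eq G (Suc (l + k)) \<dots> (commut G h g [^] l)"
      using mem by (intro commut_pow_left_mod)
    finally show ?thesis by (simp add: add.commute)
  qed
  have "lc_eq G ?n (?c (k + l) (coeff (?E (Br s t))))
      (?c (k + l) (coeff (?E s * ?E t)) \<otimes> inv (?c (k + l) (coeff (?E t * ?E s))))"
    unfolding eq using mem by (intro left_normed_diff) simp
  also have "lc_eq G ?n \<dots> (commut G g h [^] k \<otimes> inv (commut G h g [^] l))"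
    using 1 2 by (intro lc_eq_mult lc_eq_inv)
  also have "commut G g h [^] k \<otimes> inv (commut G h g [^] l) = commut G g h [^] (k + l)"
    using G by (simp add: nat_pow_inv[symmetric] inv_commut nat_pow_mult del: nat_pow_inv)
  finally show ?case .
next
  case (absorb m g s h)
  then have "lc_eq G (Suc m) (g [^] m) ((g \<otimes> h) [^] m)"
    using lie_rep_mem[OF absorb.hyps(1)] x lower_central_carrier
    by (intro lc_eq_sym[OF lc_eq_pow] lc_eq_absorb) auto
  then show ?case using absorb.IH lc_eq_trans by blast
qed

text \<open>
  The substitute for torsion-freeness of the graded Lie ring: an element whose expansion vanishes is
  torsion of known order.
\<close>

corollary lie_rep_pow_zero:
  assumes "lie_rep G (set js) x m g e" "lie_eval (nc_var :: 'i \<Rightarrow> 'i ncps) e = 0"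
  shows "g [^] m \<in> lower_central G (Suc m)"
proof -
  have "coeff (0::'i ncps) = (\<lambda>u. 0)" by auto
  then have "lc_eq G (Suc m) \<one> (g [^] m)"
    using dynkin_specht_wever[OF assms(1)] by (simp add: assms(2) left_normed_zero)
  then show ?thesis using lc_eq_sym lc_eq_one by blast
qed

end

end

section \<open>Automorphisms acting as derivations\<close>

definition displacement :: "('a, 'b) monoid_scheme \<Rightarrow> ('a \<Rightarrow> 'a) \<Rightarrow> 'a \<Rightarrow> 'a"
  where "displacement G f y = f y \<otimes>\<^bsub>G\<^esub> inv\<^bsub>G\<^esub> y"

primrec lie_deriv :: "('a \<Rightarrow> 'a lie_exp) \<Rightarrow> 'a lie_exp \<Rightarrow> 'a lie_exp"
  where
    "lie_deriv d Zero = Zero"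
  | "lie_deriv d (Gen a) = d a"
  | "lie_deriv d (Add s t) = Add (lie_deriv d s) (lie_deriv d t)"
  | "lie_deriv d (Neg s) = Neg (lie_deriv d s)"
  | "lie_deriv d (Br s t) = Add (Br (lie_deriv d s) t) (Br s (lie_deriv d t))"

type_synonym 'a lie_derivation = "'a \<Rightarrow> 'a lie_exp"

definition deriv_bracket :: "'a lie_derivation \<Rightarrow> 'a lie_derivation \<Rightarrow> 'a lie_derivation"
  where "deriv_bracket d d' = (\<lambda>p. Add (lie_deriv d (d' p)) (Neg (lie_deriv d' (d p))))"

definition deriv_add :: "'a lie_derivation \<Rightarrow> 'a lie_derivation \<Rightarrow> 'a lie_derivation"
  where "deriv_add d d' = (\<lambda>p. Add (d p) (d' p))"

definition deriv_neg :: "'a lie_derivation \<Rightarrow> 'a lie_derivation"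
  where "deriv_neg d = (\<lambda>p. Neg (d p))"

text \<open>
  The Johnson homomorphism in explicit form: the displacement of \<open>f\<close> on the generators is given
  by the values of a derivation of degree \<open>k\<close>.
\<close>

definition acts_by :: "('g, 'b) monoid_scheme \<Rightarrow> 'a set \<Rightarrow> ('a \<Rightarrow> 'g) \<Rightarrow> nat \<Rightarrow> ('g \<Rightarrow> 'g) \<Rightarrow> ('a \<Rightarrow> 'a lie_exp) \<Rightarrow> bool"
  where "acts_by G J x k f d \<longleftrightarrow> f \<in> andreadakis G k \<and>
    (\<forall>j\<in>J. lie_rep G J x (Suc k) (displacement G f (x j)) (d j))"

context group
begin

lemma auto_group_hom: "f \<in> auto G \<Longrightarrow> group_hom G G f"
  by unfold_locales (simp add: auto_def)

lemma auto_closed: "f \<in> auto G \<Longrightarrow> w \<in> carrier G \<Longrightarrow> f w \<in> carrier G"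
  using group_hom.hom_closed[OF auto_group_hom] by blast

lemma carrier_AutoGroup: "carrier (AutoGroup G) = auto G"
  by (simp add: AutoGroup_def)

lemma AutoGroup_mult:
  "f \<in> auto G \<Longrightarrow> g \<in> auto G \<Longrightarrow> w \<in> carrier G \<Longrightarrow> (f \<otimes>\<^bsub>AutoGroup G\<^esub> g) w = f (g w)"
  by (simp add: AutoGroup_def BijGroup_def auto_def compose_eq)

lemma AutoGroup_one: "w \<in> carrier G \<Longrightarrow> \<one>\<^bsub>AutoGroup G\<^esub> w = w"
  by (simp add: AutoGroup_def BijGroup_def)

lemma AutoGroup_inv:
  assumes "f \<in> auto G"
  shows "inv\<^bsub>AutoGroup G\<^esub> f \<in> auto G"
    "w \<in> carrier G \<Longrightarrow> (inv\<^bsub>AutoGroup G\<^esub> f) (f w) = w"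
    "w \<in> carrier G \<Longrightarrow> f ((inv\<^bsub>AutoGroup G\<^esub> f) w) = w"
proof -
  interpret A: group "AutoGroup G" by (rule AutoGroup)
  show *: "inv\<^bsub>AutoGroup G\<^esub> f \<in> auto G" using assms A.inv_closed by (simp add: carrier_AutoGroup)
  show "w \<in> carrier G \<Longrightarrow> (inv\<^bsub>AutoGroup G\<^esub> f) (f w) = w"
    using AutoGroup_mult[OF * assms] A.l_inv[of f] assms AutoGroup_one by (simp add: carrier_AutoGroup)
  show "w \<in> carrier G \<Longrightarrow> f ((inv\<^bsub>AutoGroup G\<^esub> f) w) = w"
    using AutoGroup_mult[OF assms *] A.r_inv[of f] assms AutoGroup_one by (simp add: carrier_AutoGroup)
qed

lemma auto_eqI:
  assumes "f \<in> auto G" "g \<in> auto G" "\<And>w. w \<in> carrier G \<Longrightarrow> f w = g w"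
  shows "f = g"
  using assms by (intro extensionalityI[of _ "carrier G"]) (auto simp: auto_def Bij_def)

lemma andreadakis_lc_eq:
  "f \<in> andreadakis G k \<longleftrightarrow> f \<in> auto G \<and> (\<forall>w\<in>carrier G. lc_eq G (Suc k) (f w) w)"
  using andreadakis_iff[of f k] auto_closed by (auto simp: lc_eq_coset)

lemma andreadakis_auto: "f \<in> andreadakis G k \<Longrightarrow> f \<in> auto G"
  by (simp add: andreadakis_lc_eq)

lemma subgroup_andreadakis: "subgroup (andreadakis G k) (AutoGroup G)"
proof -
  interpret N: normal "lower_central G (k + 1)" G by (rule normal_lower_central)
  interpret h: group_hom "AutoGroup G" "AutoGroup (G Mod lower_central G (k + 1))"
    "induced_aut G (lower_central G (k + 1))"
    using induced_aut_hom AutoGroup group.AutoGroup[OF N.factorgroup_is_group]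
    by (simp add: group_hom_def group_hom_axioms_def)
  show ?thesis unfolding andreadakis_def by (rule h.subgroup_kernel)
qed

text \<open>
  The definition of the filtration only controls the displacement on the whole group; on deeper terms
  the displacement is deeper by the same amount, by induction along the commutators that generate
  the next term.
\<close>

lemma andreadakis_lower_central:
  assumes f: "f \<in> andreadakis G k" and "m \<ge> 1" and "y \<in> lower_central G m"
  shows "lc_eq G (m + k) (f y) y"
  using assms(2,3)
proof (induction m arbitrary: y rule: dec_induct)
  case base
  then show ?case using f by (simp add: andreadakis_lc_eq)
next
  case (step m)
  have fa: "f \<in> auto G" using f by (rule andreadakis_auto)
  interpret f: group_hom G G f using fa by (rule auto_group_hom)
  let ?H = "{y \<in> carrier G. lc_eq G (Suc m + k) (f y) y}"
  have "lower_central G (Suc m) \<subseteq> ?H"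
  proof (rule lc_Suc_induct)
    fix g h assume g: "g \<in> carrier G" and h: "h \<in> lower_central G m"
    have hG: "h \<in> carrier G" using h lower_central_carrier by blast
    have "f (commut G g h) = commut G (f g) (f h)"
      using g hG by (simp add: commut_def)
    also have "lc_eq G (Suc m + k) \<dots> (commut G (f g) h)"
      using lc_eq_commut_right[OF step.IH[OF h], of "f g" 1] step.hyps g by simp
    also have "lc_eq G (Suc m + k) \<dots> (commut G g h)"
      using lc_eq_commut_left[of "Suc k" "f g" g h m] f g h step.hyps
      by (simp add: andreadakis_lc_eq add.commute)
    finally show "commut G g h \<in> ?H" using g hG by simp
  next
    show "subgroup ?H G"
      by (rule subgroupI) (auto intro!: lc_eq_mult lc_eq_inv lc_eq_refl exI[of _ \<one>])
  qed (use step.hyps in simp)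
  then show ?case using step.prems by blast
qed

lemma displacement_mem:
  assumes "f \<in> andreadakis G k" "m \<ge> 1" "y \<in> lower_central G m"
  shows "displacement G f y \<in> lower_central G (m + k)"
  using andreadakis_lower_central[OF assms] by (simp add: displacement_def lc_eq_def)

lemma displacement_carrier: "f \<in> auto G \<Longrightarrow> y \<in> carrier G \<Longrightarrow> displacement G f y \<in> carrier G"
  using auto_closed by (simp add: displacement_def)

lemma auto_displacement: "f \<in> auto G \<Longrightarrow> y \<in> carrier G \<Longrightarrow> f y = displacement G f y \<otimes> y"
  using auto_closed by (simp add: displacement_def m_assoc)

lemma displacement_one [simp]: "f \<in> auto G \<Longrightarrow> displacement G f \<one> = \<one>"
  using group_hom.hom_one[OF auto_group_hom[of f]] by (simp add: displacement_def is_group)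

lemma displacement_mult_mod:
  assumes f: "f \<in> andreadakis G k" and "m \<ge> 1" "k \<ge> 1" "y \<in> lower_central G m" "z \<in> lower_central G m"
  shows "lc_eq G (Suc (m + k)) (displacement G f (y \<otimes> z)) (displacement G f y \<otimes> displacement G f z)"
proof -
  have fa: "f \<in> auto G" using f by (rule andreadakis_auto)
  interpret f: group_hom G G f using fa by (rule auto_group_hom)
  have G: "y \<in> carrier G" "z \<in> carrier G" using assms lower_central_carrier by blast+
  have eq: "displacement G f (y \<otimes> z) = displacement G f y \<otimes> (y \<otimes> displacement G f z \<otimes> inv y)"
    using G by (simp add: displacement_def group_word)
  show ?thesis unfolding eq
    using assms fa G displacement_mem[OF f]
    by (intro lc_eq_mult lc_eq_refl lc_eq_conj[of y m _ "m + k"]) (auto simp: displacement_carrier)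
qed

lemma displacement_inv_mod:
  assumes f: "f \<in> andreadakis G k" and "m \<ge> 1" "k \<ge> 1" "y \<in> lower_central G m"
  shows "lc_eq G (Suc (m + k)) (displacement G f (inv y)) (inv (displacement G f y))"
proof -
  have fa: "f \<in> auto G" using f by (rule andreadakis_auto)
  have G: "y \<in> carrier G" using assms lower_central_carrier by blast
  have "lc_eq G (Suc (m + k)) (inv (displacement G f y) \<otimes> (displacement G f y \<otimes> displacement G f (inv y))) (inv (displacement G f y) \<otimes> \<one>)"
    using lc_eq_sym[OF displacement_mult_mod[OF assms lc_inv[OF assms(4)]]] G fa
    by (intro lc_eq_mult lc_eq_refl) (auto simp: displacement_carrier)
  then show ?thesis using G fa by (simp add: inv_mult_cancel displacement_carrier)
qed

lemma displacement_commut_mod: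
  assumes f: "f \<in> andreadakis G k" and "k \<ge> 1" "g \<in> lower_central G i" "h \<in> lower_central G j" "i \<ge> 1" "j \<ge> 1"
  shows "lc_eq G (Suc (i + j + k)) (displacement G f (commut G g h))
    (commut G (displacement G f g) h \<otimes> commut G g (displacement G f h))"
proof -
  let ?n = "Suc (i + j + k)"
  have fa: "f \<in> auto G" using f by (rule andreadakis_auto)
  interpret f: group_hom G G f using fa by (rule auto_group_hom)
  have G: "g \<in> carrier G" "h \<in> carrier G" using assms lower_central_carrier by blast+
  define g' h' where "g' = displacement G f g" and "h' = displacement G f h"
  have mem': "g' \<in> lower_central G (i + k)" "h' \<in> lower_central G (j + k)"
    using displacement_mem[OF f] assms by (auto simp: g'_def h'_def)
  have mem: "g' \<in> lower_central G i" "h' \<in> lower_central G j"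
    using mem' lc_antimono[of i "i + k"] lc_antimono[of j "j + k"] by auto
  have G': "g' \<in> carrier G" "h' \<in> carrier G" using mem lower_central_carrier by blast+
  have fg: "f g = g' \<otimes> g" "f h = h' \<otimes> h" using auto_displacement fa G by (simp_all add: g'_def h'_def)
  let ?c = "commut G g h"
  have cm: "?c \<in> lower_central G (i + j)" using commut_lower_central assms by blast
  have m1: "commut G g' h \<in> lower_central G (i + j + k)"
    using commut_lower_central[OF mem'(1) assms(4)] assms by (simp add: add_ac)
  have m2: "commut G g h' \<in> lower_central G (i + j + k)"
    using commut_lower_central[OF assms(3) mem'(2)] assms by (simp add: add_ac)
  have gm: "g' \<otimes> g \<in> lower_central G i" "h' \<otimes> h \<in> lower_central G j"
    using mem assms lc_mult by auto
  \<comment> \<open>\<open>f\<close> maps the commutator to \<open>[g' g, h' h]\<close>; expanding both slots leaves \<open>[g', h]\<close>, \<open>[g, h']\<close> and \<open>[g, h]\<close>,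
    because \<open>[g', h']\<close> and all conjugation errors lie at least one term deeper.\<close>
  have 1: "lc_eq G ?n (commut G (g' \<otimes> g) (h' \<otimes> h)) (commut G g' (h' \<otimes> h) \<otimes> commut G g (h' \<otimes> h))"
  proof -
    have eq: "commut G (g' \<otimes> g) (h' \<otimes> h) =
        g' \<otimes> commut G g (h' \<otimes> h) \<otimes> inv g' \<otimes> commut G g' (h' \<otimes> h)"
      using G G' by (intro commut_mult_left) auto
    have c1: "commut G g (h' \<otimes> h) \<in> lower_central G (i + j)" using commut_lower_central gm assms by blast
    have c2: "commut G g' (h' \<otimes> h) \<in> lower_central G (i + k + j)"
      using commut_lower_central[OF mem'(1) gm(2)] assms by simp
    have "lc_eq G ?n (g' \<otimes> commut G g (h' \<otimes> h) \<otimes> inv g' \<otimes> commut G g' (h' \<otimes> h))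
       (commut G g (h' \<otimes> h) \<otimes> commut G g' (h' \<otimes> h))"
      using assms G G' by (intro lc_eq_mult lc_eq_refl lc_eq_conj[OF mem'(1) c1]) auto
    also have "lc_eq G ?n \<dots> (commut G g' (h' \<otimes> h) \<otimes> commut G g (h' \<otimes> h))"
      using assms by (intro lc_eq_swap[OF c1 c2]) auto
    finally show ?thesis unfolding eq .
  qed
  have 2: "lc_eq G ?n (commut G g' (h' \<otimes> h)) (commut G g' h)"
  proof -
    have "lc_eq G (j + k) (h' \<otimes> h) h"
      using lc_eq_absorb(2)[OF mem'(2) G(2)] .
    then have "lc_eq G (i + k + (j + k)) (commut G g' (h' \<otimes> h)) (commut G g' h)"
      using assms by (intro lc_eq_commut_right[OF _ mem'(1)]) auto
    then show ?thesis using assms by (elim lc_eq_mono) auto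
  qed
  have 3: "lc_eq G ?n (commut G g (h' \<otimes> h)) (commut G g h' \<otimes> commut G g h)"
  proof -
    have eq: "commut G g (h' \<otimes> h) = commut G g h' \<otimes> (h' \<otimes> commut G g h \<otimes> inv h')"
      using G G' by (simp add: commut_def group_word)
    show ?thesis unfolding eq
      using assms G G' by (intro lc_eq_mult lc_eq_refl lc_eq_conj[OF mem'(2) cm]) auto
  qed
  have "displacement G f ?c = commut G (g' \<otimes> g) (h' \<otimes> h) \<otimes> inv ?c"
    using G fg by (simp add: displacement_def commut_def)
  also have "lc_eq G ?n \<dots> ((commut G g' h \<otimes> (commut G g h' \<otimes> ?c)) \<otimes> inv ?c)"
    using lc_eq_trans[OF 1 lc_eq_mult[OF 2 3]] G by (intro lc_eq_mult lc_eq_refl) auto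
  also have "(commut G g' h \<otimes> (commut G g h' \<otimes> ?c)) \<otimes> inv ?c = commut G g' h \<otimes> commut G g h'"
    using G G' by (simp add: m_assoc)
  finally show ?thesis by (simp add: g'_def h'_def)
qed

lemma displacement_AutoGroup_mult:
  assumes f: "f \<in> andreadakis G k" and g: "g \<in> andreadakis G k" and "k \<ge> 1" and x: "x \<in> carrier G"
  shows "lc_eq G (Suc (Suc k)) (displacement G (f \<otimes>\<^bsub>AutoGroup G\<^esub> g) x) (displacement G f x \<otimes> displacement G g x)"
proof -
  have fa: "f \<in> auto G" and ga: "g \<in> auto G" using f g by (auto dest: andreadakis_auto)
  interpret f: group_hom G G f using fa by (rule auto_group_hom)
  define y where "y = displacement G g x"
  have y: "y \<in> lower_central G (Suc k)" and fx: "displacement G f x \<in> lower_central G (Suc k)"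
    using displacement_mem[OF g, of 1 x] displacement_mem[OF f, of 1 x] x by (simp_all add: y_def)
  have yG: "y \<in> carrier G" using ga x by (simp add: y_def displacement_carrier)
  have fy: "displacement G f y \<in> lower_central G (Suc (Suc k))"
    using displacement_mem[OF f _ y] lc_antimono[of "Suc (Suc k)" "Suc k + k"] assms by auto
  have eq: "displacement G (f \<otimes>\<^bsub>AutoGroup G\<^esub> g) x = displacement G f y \<otimes> (y \<otimes> displacement G f x)"
  proof -
    have "(f \<otimes>\<^bsub>AutoGroup G\<^esub> g) x = f (y \<otimes> x)"
      using AutoGroup_mult[OF fa ga x] auto_displacement[OF ga x] by (simp add: y_def)
    also have "\<dots> = displacement G f y \<otimes> y \<otimes> (displacement G f x \<otimes> x)"
      using auto_displacement[OF fa x] auto_displacement[OF fa yG] x yG by simp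
    finally show ?thesis
      using fa x yG by (simp add: displacement_def[of G "f \<otimes>\<^bsub>AutoGroup G\<^esub> g"] displacement_carrier m_assoc)
  qed
  have "lc_eq G (Suc (Suc k)) (displacement G f y \<otimes> (y \<otimes> displacement G f x)) (y \<otimes> displacement G f x)"
    using fy fa x yG by (intro lc_eq_absorb) (auto simp: displacement_carrier)
  also have "lc_eq G (Suc (Suc k)) \<dots> (displacement G f x \<otimes> y)"
    by (intro lc_eq_swap[OF y fx]) auto
  finally show ?thesis unfolding eq y_def .
qed

text \<open>
  Compare \<open>f g\<close> and \<open>g f\<close> on \<open>x\<close>: both displace \<open>x\<close> by the displacements of \<open>f\<close> and of \<open>g\<close>, in
  different orders, and by one further factor each, namely the displacement under \<open>f\<close> of the
  displacement under \<open>g\<close>, and vice versa. Hence the group commutator acts by the commutator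
  of the two derivations.
\<close>

lemma andreadakis_commut_displacement:
  assumes f: "f \<in> andreadakis G k" and g: "g \<in> andreadakis G l" and kl: "k \<ge> 1" "l \<ge> 1"
  shows "commut (AutoGroup G) f g \<in> andreadakis G (k + l)"
    and "x \<in> carrier G \<Longrightarrow> lc_eq G (Suc (Suc (k + l))) (displacement G (commut (AutoGroup G) f g) x)
      (displacement G f (displacement G g x) \<otimes> inv (displacement G g (displacement G f x)))"
proof -
  let ?A = "AutoGroup G"
  interpret A: group ?A by (rule AutoGroup)
  have fa: "f \<in> auto G" and ga: "g \<in> auto G" using f g by (auto dest: andreadakis_auto)
  have fc: "f \<in> carrier ?A" "g \<in> carrier ?A" using fa ga by (simp_all add: carrier_AutoGroup)
  interpret f: group_hom G G f using fa by (rule auto_group_hom)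
  interpret g: group_hom G G g using ga by (rule auto_group_hom)
  let ?h = "commut ?A f g" and ?n = "Suc (Suc (k + l))"
  have ha: "?h \<in> auto G" using A.commut_closed fc by (simp add: carrier_AutoGroup)
  have h: "?h (g (f x)) = f (g x)" if x: "x \<in> carrier G" for x
  proof -
    have "?h \<otimes>\<^bsub>?A\<^esub> (g \<otimes>\<^bsub>?A\<^esub> f) = f \<otimes>\<^bsub>?A\<^esub> g"
      using fc by (simp add: commut_def A.group_word)
    then show ?thesis
      using AutoGroup_mult[OF fa ga x] AutoGroup_mult[OF ga fa x]
        AutoGroup_mult[OF ha, of "g \<otimes>\<^bsub>?A\<^esub> f" x] x A.m_closed[OF fc(2,1)]
      by (simp add: carrier_AutoGroup)
  qed
  have key: "lc_eq G ?n (displacement G ?h (g (f x))) (displacement G f (displacement G g x) \<otimes> inv (displacement G g (displacement G f x)))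
      \<and> displacement G f (displacement G g x) \<otimes> inv (displacement G g (displacement G f x)) \<in> lower_central G (Suc (k + l))
      \<and> (\<exists>z\<in>lower_central G 2. g (f x) = z \<otimes> x)"
    if x: "x \<in> carrier G" for x
  proof -
    define y z where "y = displacement G g x" and "z = displacement G f x"
    define p q where "p = displacement G f y" and "q = displacement G g z"
    have ym: "y \<in> lower_central G (Suc l)" and zm: "z \<in> lower_central G (Suc k)"
      using displacement_mem[OF g, of 1 x] displacement_mem[OF f, of 1 x] x by (simp_all add: y_def z_def)
    have pm: "p \<in> lower_central G (Suc (k + l))" and qm: "q \<in> lower_central G (Suc (k + l))"
      using displacement_mem[OF f _ ym] displacement_mem[OF g _ zm] by (simp_all add: p_def q_def add.commute)
    have G: "y \<in> carrier G" "z \<in> carrier G" "p \<in> carrier G" "q \<in> carrier G"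
      using ym zm pm qm lower_central_carrier by blast+
    have fg: "f (g x) = p \<otimes> (y \<otimes> z) \<otimes> x"
    proof -
      have "f (g x) = f y \<otimes> f x" using auto_displacement[OF ga x] x G by (simp add: y_def)
      also have "\<dots> = p \<otimes> y \<otimes> (z \<otimes> x)"
        using auto_displacement[OF fa G(1)] auto_displacement[OF fa x] by (simp add: p_def z_def)
      finally show ?thesis using G x by (simp add: m_assoc)
    qed
    have gf: "g (f x) = q \<otimes> (z \<otimes> y) \<otimes> x"
    proof -
      have "g (f x) = g z \<otimes> g x" using auto_displacement[OF fa x] x G by (simp add: z_def)
      also have "\<dots> = q \<otimes> z \<otimes> (y \<otimes> x)"
        using auto_displacement[OF ga G(2)] auto_displacement[OF ga x] by (simp add: q_def y_def)
      finally show ?thesis using G x by (simp add: m_assoc)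
    qed
    have "displacement G ?h (g (f x)) = p \<otimes> (commut G y z) \<otimes> inv q"
      unfolding displacement_def h[OF x] unfolding fg gf using x G by (simp add: commut_def group_word)
    also have "lc_eq G ?n \<dots> (p \<otimes> \<one> \<otimes> inv q)"
    proof (intro lc_eq_mult lc_eq_refl)
      have "commut G y z \<in> lower_central G (Suc l + Suc k)"
        using ym zm by (intro commut_lower_central) auto
      then show "lc_eq G ?n (commut G y z) \<one>" by (simp add: lc_eq_one add.commute)
    qed (use G in auto)
    finally have 1: "lc_eq G ?n (displacement G ?h (g (f x))) (p \<otimes> inv q)" using G by simp
    have "q \<otimes> (z \<otimes> y) \<in> lower_central G 2"
      using qm ym zm kl lc_antimono[of 2 "Suc (k + l)"] lc_antimono[of 2 "Suc k"] lc_antimono[of 2 "Suc l"]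
      by (intro lc_mult) auto
    then show ?thesis
      using 1 pm qm gf by (auto simp: p_def q_def y_def z_def intro: lc_mult lc_inv)
  qed
  show hA: "?h \<in> andreadakis G (k + l)"
    unfolding andreadakis_lc_eq
  proof (intro conjI ballI)
    fix w assume w: "w \<in> carrier G"
    define x where "x = (inv\<^bsub>?A\<^esub> f) ((inv\<^bsub>?A\<^esub> g) w)"
    have x: "x \<in> carrier G" using auto_closed AutoGroup_inv(1) fa ga w by (simp add: x_def)
    have gfx: "g (f x) = w"
      using AutoGroup_inv[OF fa] AutoGroup_inv[OF ga] w auto_closed by (simp add: x_def)
    have "displacement G ?h w \<in> lower_central G (Suc (k + l))"
      using key[OF x] lc_eq_mono[of ?n _ _ "Suc (k + l)"] lc_eq_mem unfolding gfx by (metis le_SucI order_refl)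
    then show "lc_eq G (Suc (k + l)) (?h w) w" using w ha auto_closed by (simp add: lc_eq_def displacement_def)
  qed (rule ha)
  assume x: "x \<in> carrier G"
  obtain z where z: "z \<in> lower_central G 2" "g (f x) = z \<otimes> x" using key[OF x] by blast
  have zG: "z \<in> carrier G" using z lower_central_carrier by blast
  have z1: "z \<in> lower_central G 1" using zG by simp
  have "lc_eq G ?n (displacement G ?h (z \<otimes> x)) (displacement G ?h z \<otimes> displacement G ?h x)"
    using displacement_mult_mod[OF hA _ _ z1, of x] kl x by simp
  also have "lc_eq G ?n \<dots> (displacement G ?h x)"
    using displacement_mem[OF hA _ z(1)] x ha by (intro lc_eq_absorb) (auto simp: displacement_carrier)
  finally show "lc_eq G ?n (displacement G ?h x) (displacement G f (displacement G g x) \<otimes> inv (displacement G g (displacement G f x)))"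
    using key[OF x] z(2) lc_eq_sym lc_eq_trans by metis
qed

lemma lie_rep_cong:
  assumes "lie_rep G J x m g e" "lc_eq G (Suc m) g' g"
  shows "lie_rep G J x m g' e"
proof -
  have G: "g \<in> carrier G" "g' \<in> carrier G" using assms(2) by (auto simp: lc_eq_def)
  have "inv (g \<otimes> inv g') \<in> lower_central G (Suc m)"
    using lc_eq_sym[OF assms(2)] lc_inv by (simp add: lc_eq_def)
  from lc_conj[OF this, of "inv g"] have "inv g \<otimes> g' \<in> lower_central G (Suc m)"
    using G by (simp add: group_word)
  from lie_rep.absorb[OF assms(1) this] show ?thesis using G by (simp add: group_word)
qed

lemma acts_by_rep:
  assumes f: "acts_by G J x k f d" and x: "x ` J \<subseteq> carrier G" and k: "k \<ge> 1"
    and "lie_rep G J x m y e"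
  shows "lie_rep G J x (m + k) (displacement G f y) (lie_deriv d e)"
  using assms(4)
proof induction
  case (zero m)
  then have "lie_rep G J x (m + k) \<one> Zero" by (intro lie_rep.zero) simp
  then show ?case using f by (auto simp: acts_by_def dest: andreadakis_auto)
next
  case (gen j)
  then show ?case using f by (simp add: acts_by_def)
next
  case (add m g s h t)
  have "lie_rep G J x (m + k) (displacement G f g \<otimes> displacement G f h) (lie_deriv d (Add s t))"
    using add.IH lie_rep.add by fastforce
  then show ?case
    using add.hyps lie_rep_mem[OF _ x] f k by (elim lie_rep_cong) (auto simp: acts_by_def intro: displacement_mult_mod)
next
  case (neg m g s)
  have "lie_rep G J x (m + k) (inv (displacement G f g)) (lie_deriv d (Neg s))"
    using neg.IH lie_rep.neg by fastforce
  then show ?case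
    using neg.hyps lie_rep_mem[OF _ x] f k by (elim lie_rep_cong) (auto simp: acts_by_def intro: displacement_inv_mod)
next
  case (br i g s j h t)
  have "lie_rep G J x (i + k + j) (commut G (displacement G f g) h) (Br (lie_deriv d s) t)"
    "lie_rep G J x (i + (j + k)) (commut G g (displacement G f h)) (Br s (lie_deriv d t))"
    using br lie_rep.br by fast+
  then have "lie_rep G J x (i + j + k) (commut G (displacement G f g) h \<otimes> commut G g (displacement G f h)) (lie_deriv d (Br s t))"
    using lie_rep.add by (fastforce simp: add_ac)
  then show ?case
    using br.hyps lie_rep_mem[OF _ x] f k by (elim lie_rep_cong) (auto simp: acts_by_def intro: displacement_commut_mod)
next
  case (absorb m g s h)
  have fA: "f \<in> andreadakis G k" using f by (simp add: acts_by_def)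
  have mem: "m \<ge> 1" "g \<in> lower_central G m" using absorb.hyps lie_rep_mem[OF _ x] by blast+
  have "h \<in> lower_central G m" using absorb.hyps lc_antimono_Suc by blast
  then have "lc_eq G (Suc (m + k)) (displacement G f (g \<otimes> h)) (displacement G f g \<otimes> displacement G f h)"
    using mem k by (intro displacement_mult_mod[OF fA])
  also have "lc_eq G (Suc (m + k)) \<dots> (displacement G f g)"
    using displacement_mem[OF fA _ absorb.hyps(2)] mem lower_central_carrier andreadakis_auto[OF fA]
    by (intro lc_eq_absorb) (auto simp: displacement_carrier)
  finally show ?case using absorb.IH lie_rep_cong by blast
qed

lemma acts_by_mult:
  assumes f: "acts_by G J x k f d" and g: "acts_by G J x k g d'" and x: "x ` J \<subseteq> carrier G" and k: "k \<ge> 1"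
  shows "acts_by G J x k (f \<otimes>\<^bsub>AutoGroup G\<^esub> g) (\<lambda>j. Add (d j) (d' j))"
  unfolding acts_by_def
proof (intro conjI ballI)
  have A: "f \<in> andreadakis G k" "g \<in> andreadakis G k" using f g by (auto simp: acts_by_def)
  then show "f \<otimes>\<^bsub>AutoGroup G\<^esub> g \<in> andreadakis G k"
    using subgroup.m_closed[OF subgroup_andreadakis] by blast
  fix j assume j: "j \<in> J"
  then have "lie_rep G J x (Suc k) (displacement G f (x j) \<otimes> displacement G g (x j)) (Add (d j) (d' j))"
    using f g by (intro lie_rep.add) (auto simp: acts_by_def)
  then show "lie_rep G J x (Suc k) (displacement G (f \<otimes>\<^bsub>AutoGroup G\<^esub> g) (x j)) (Add (d j) (d' j))"
    using displacement_AutoGroup_mult[OF A k, of "x j"] x j by (elim lie_rep_cong) auto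
qed

lemma acts_by_inv:
  assumes f: "acts_by G J x k f d" and x: "x ` J \<subseteq> carrier G" and k: "k \<ge> 1"
  shows "acts_by G J x k (inv\<^bsub>AutoGroup G\<^esub> f) (\<lambda>j. Neg (d j))"
  unfolding acts_by_def
proof (intro conjI ballI)
  interpret A: group "AutoGroup G" by (rule AutoGroup)
  have A: "f \<in> andreadakis G k" using f by (auto simp: acts_by_def)
  then have fa: "f \<in> auto G" by (rule andreadakis_auto)
  show Ai: "inv\<^bsub>AutoGroup G\<^esub> f \<in> andreadakis G k"
    using A subgroup.m_inv_closed[OF subgroup_andreadakis] by blast
  fix j assume j: "j \<in> J"
  have xj: "x j \<in> carrier G" using x j by blast
  let ?f = "inv\<^bsub>AutoGroup G\<^esub> f"
  have "displacement G (f \<otimes>\<^bsub>AutoGroup G\<^esub> ?f) (x j) = \<one>"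
    using fa xj A.r_inv[of f] by (simp add: carrier_AutoGroup displacement_def AutoGroup_one)
  then have "lc_eq G (Suc (Suc k)) (displacement G f (x j) \<otimes> displacement G ?f (x j)) \<one>"
    using lc_eq_sym[OF displacement_AutoGroup_mult[OF A Ai k xj]] by simp
  then have "lc_eq G (Suc (Suc k)) (inv (displacement G f (x j)) \<otimes> (displacement G f (x j) \<otimes> displacement G ?f (x j)))
      (inv (displacement G f (x j)) \<otimes> \<one>)"
    using fa xj by (intro lc_eq_mult lc_eq_refl) (auto simp: displacement_carrier)
  then have "lc_eq G (Suc (Suc k)) (displacement G ?f (x j)) (inv (displacement G f (x j)))"
    using fa AutoGroup_inv(1)[OF fa] xj by (simp add: inv_mult_cancel displacement_carrier)
  moreover have "lie_rep G J x (Suc k) (inv (displacement G f (x j))) (Neg (d j))"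
    using f j by (intro lie_rep.neg) (auto simp: acts_by_def)
  ultimately show "lie_rep G J x (Suc k) (displacement G ?f (x j)) (Neg (d j))"
    using lie_rep_cong by blast
qed

lemma acts_by_commut:
  assumes f: "acts_by G J x k f d" and g: "acts_by G J x l g d'" and x: "x ` J \<subseteq> carrier G"
    and kl: "k \<ge> 1" "l \<ge> 1"
  shows "acts_by G J x (k + l) (commut (AutoGroup G) f g)
    (\<lambda>j. Add (lie_deriv d (d' j)) (Neg (lie_deriv d' (d j))))"
  unfolding acts_by_def
proof (intro conjI ballI)
  have A: "f \<in> andreadakis G k" "g \<in> andreadakis G l" using f g by (auto simp: acts_by_def)
  then show "commut (AutoGroup G) f g \<in> andreadakis G (k + l)"
    using andreadakis_commut_displacement(1) kl by blast
  fix j assume j: "j \<in> J"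
  have xj: "x j \<in> carrier G" using x j by blast
  have "lie_rep G J x (Suc l + k) (displacement G f (displacement G g (x j))) (lie_deriv d (d' j))"
    "lie_rep G J x (Suc k + l) (displacement G g (displacement G f (x j))) (lie_deriv d' (d j))"
    using f g j by (intro acts_by_rep[OF f x kl(1)] acts_by_rep[OF g x kl(2)]; simp add: acts_by_def)+
  then have "lie_rep G J x (Suc (k + l)) (displacement G f (displacement G g (x j)) \<otimes> inv (displacement G g (displacement G f (x j))))
      (Add (lie_deriv d (d' j)) (Neg (lie_deriv d' (d j))))"
    by (intro lie_rep.add lie_rep.neg) (simp_all add: add.commute)
  then show "lie_rep G J x (Suc (k + l)) (displacement G (commut (AutoGroup G) f g) (x j))
      (Add (lie_deriv d (d' j)) (Neg (lie_deriv d' (d j))))"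
    using andreadakis_commut_displacement(2)[OF A kl xj] lie_rep_cong by blast
qed

lemma acts_by_bracket:
  assumes "acts_by G J x k f d" "acts_by G J x l g d'" "x ` J \<subseteq> carrier G" "k \<ge> 1" "l \<ge> 1" "k + l = m"
  shows "acts_by G J x m (commut (AutoGroup G) f g) (deriv_bracket d d')"
  using acts_by_commut[OF assms(1-5)] assms(6) by (simp add: deriv_bracket_def)

lemma displacement_AutoGroup_pow:
  assumes f: "f \<in> andreadakis G k" and k: "k \<ge> 1" and x: "x \<in> carrier G"
  shows "lc_eq G (Suc (Suc k)) (displacement G (f [^]\<^bsub>AutoGroup G\<^esub> (n::nat)) x) (displacement G f x [^] n)"
proof (induction n)
  case 0
  then show ?case using x by (simp add: displacement_def AutoGroup_one lc_eq_refl)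
next
  case (Suc n)
  interpret A: group "AutoGroup G" by (rule AutoGroup)
  have fa: "f \<in> auto G" using f by (rule andreadakis_auto)
  have "f [^]\<^bsub>AutoGroup G\<^esub> n \<in> andreadakis G k"
    by (induction n) (use f subgroup_andreadakis subgroup.m_closed subgroup.one_closed in fastforce)+
  then have "lc_eq G (Suc (Suc k)) (displacement G (f [^]\<^bsub>AutoGroup G\<^esub> Suc n) x) (displacement G (f [^]\<^bsub>AutoGroup G\<^esub> n) x \<otimes> displacement G f x)"
    using displacement_AutoGroup_mult[OF _ f k x] by simp
  also have "lc_eq G (Suc (Suc k)) \<dots> (displacement G f x [^] n \<otimes> displacement G f x)"
    using Suc fa x by (intro lc_eq_mult lc_eq_refl) (auto simp: displacement_carrier)
  finally show ?case by simp
qed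

text \<open>
  The exponent is \<open>k + 1\<close> and not \<open>k\<close> because an automorphism of degree \<open>k\<close> displaces a generator by an element of
  degree \<open>k + 1\<close>.
\<close>

theorem acts_by_zero_pow:
  assumes f: "acts_by G (set js) x k f d" and js: "distinct js" and x: "x ` set js \<subseteq> carrier G" and k: "k \<ge> 1"
    and j: "j \<in> set js" and "lie_eval (nc_var :: 'i \<Rightarrow> 'i ncps) (d j) = 0"
  shows "lc_eq G (Suc (Suc k)) ((f [^]\<^bsub>AutoGroup G\<^esub> Suc k) (x j)) (x j)"
proof -
  have fA: "f \<in> andreadakis G k" using f by (simp add: acts_by_def)
  have xj: "x j \<in> carrier G" using x j by blast
  interpret A: group "AutoGroup G" by (rule AutoGroup)
  have fp: "f [^]\<^bsub>AutoGroup G\<^esub> Suc k \<in> auto G"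
    using A.nat_pow_closed[of f] andreadakis_auto[OF fA] by (metis carrier_AutoGroup)
  have "displacement G f (x j) [^] Suc k \<in> lower_central G (Suc (Suc k))"
    using lie_rep_pow_zero[OF js, of x "Suc k" _ "d j"] assms by (auto simp: acts_by_def)
  then have "displacement G (f [^]\<^bsub>AutoGroup G\<^esub> Suc k) (x j) \<in> lower_central G (Suc (Suc k))"
    using displacement_AutoGroup_pow[OF fA k xj] lc_eq_mem by blast
  then show ?thesis using auto_closed[OF fp] xj by (simp add: lc_eq_def displacement_def)
qed

end

section \<open>The Magnus group\<close>

definition ncps_order :: "nat \<Rightarrow> 'a ncps \<Rightarrow> bool"
  where "ncps_order k f \<longleftrightarrow> (\<forall>w. length w < k \<longrightarrow> coeff f w = 0)"

lemma ncps_orderD: "ncps_order k f \<Longrightarrow> length w < k \<Longrightarrow> coeff f w = 0"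
  by (simp add: ncps_order_def)

lemma ncps_order_0 [simp]: "ncps_order 0 f"
  by (simp add: ncps_order_def)

lemma ncps_order_zero [simp]: "ncps_order k 0"
  by (simp add: ncps_order_def)

lemma ncps_order_add: "ncps_order k f \<Longrightarrow> ncps_order k g \<Longrightarrow> ncps_order k (f + g)"
  by (simp add: ncps_order_def)

lemma ncps_order_diff: "ncps_order k f \<Longrightarrow> ncps_order k g \<Longrightarrow> ncps_order k (f - g)"
  by (simp add: ncps_order_def)

lemma ncps_order_minus: "ncps_order k f \<Longrightarrow> ncps_order k (- f)"
  by (simp add: ncps_order_def)

lemma ncps_order_mono: "ncps_order l f \<Longrightarrow> k \<le> l \<Longrightarrow> ncps_order k f"
  by (simp add: ncps_order_def)

lemma ncps_order_mult:
  assumes "ncps_order k f" "ncps_order l g"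
  shows "ncps_order (k + l) (f * g)"
proof -
  have "nc_mult c (coeff g) w = 0"
    if "\<And>u. length u < k \<Longrightarrow> c u = 0" "length w < k + l" for c w
    using that
  proof (induction w arbitrary: c k)
    case Nil
    then show ?case using assms(2) by (cases "k = 0") (auto simp: ncps_order_def)
  next
    case (Cons a w)
    have "nc_mult (\<lambda>u. c (a # u)) (coeff g) w = 0"
      using Cons.prems by (intro Cons.IH[of "k - 1"]) auto
    then show ?case using Cons.prems assms(2) by (cases "k = 0") (auto simp: ncps_order_def)
  qed
  then show ?thesis using assms(1) by (simp add: ncps_order_def coeff_mult)
qed

lemma ncps_order_mult_right: "ncps_order k f \<Longrightarrow> ncps_order k (f * g)"
  using ncps_order_mult[of k f 0 g] by simp

definition magnus_group :: "'a ncps monoid"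
  where "magnus_group =
    \<lparr>carrier = {f. coeff f [] = 1 \<and> (\<exists>g. f * g = 1 \<and> g * f = 1)}, monoid.mult = (*), one = 1\<rparr>"

lemma magnus_simps [simp]:
  "f \<in> carrier magnus_group \<longleftrightarrow> coeff f [] = 1 \<and> (\<exists>g. f * g = 1 \<and> g * f = 1)"
  "f \<otimes>\<^bsub>magnus_group\<^esub> g = f * g" "\<one>\<^bsub>magnus_group\<^esub> = 1"
  by (simp_all add: magnus_group_def)

lemma coeff_mult_Nil [simp]: "coeff (f * g) [] = coeff f [] * coeff g []"
  by (simp add: coeff_mult)

lemma group_magnus: "group (magnus_group :: 'a ncps monoid)"
proof (rule groupI)
  fix f g :: "'a ncps"
  assume "f \<in> carrier magnus_group" "g \<in> carrier magnus_group"
  then obtain f' g' where "coeff f [] = 1" "coeff g [] = 1" "f * f' = 1" "f' * f = 1" "g * g' = 1" "g' * g = 1"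
    by auto
  moreover have "f * g * (g' * f') = f * (g * g') * f'" "g' * f' * (f * g) = g' * (f' * f) * g"
    by (simp_all add: mult.assoc)
  ultimately show "f \<otimes>\<^bsub>magnus_group\<^esub> g \<in> carrier magnus_group"
    by (auto intro!: exI[of _ "g' * f'"])
next
  fix f :: "'a ncps"
  assume "f \<in> carrier magnus_group"
  then obtain g where g: "coeff f [] = 1" "f * g = 1" "g * f = 1" by auto
  then have "coeff g [] = 1" by (metis coeff_mult_Nil coeff_simps(2) mult_1)
  with g show "\<exists>g\<in>carrier magnus_group. g \<otimes>\<^bsub>magnus_group\<^esub> f = \<one>\<^bsub>magnus_group\<^esub>"
    by (intro bexI[of _ g]) auto
qed (auto simp: mult.assoc intro: exI[of _ 1])

interpretation M: group magnus_group by (rule group_magnus)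

lemma magnus_inv:
  assumes "f \<in> carrier magnus_group"
  shows "f * inv\<^bsub>magnus_group\<^esub> f = 1" "inv\<^bsub>magnus_group\<^esub> f * f = 1"
  using M.r_inv[OF assms] M.l_inv[OF assms] by simp_all

lemma magnus_inv_order:
  assumes f: "f \<in> carrier magnus_group" and "ncps_order k (f - 1)"
  shows "ncps_order k (inv\<^bsub>magnus_group\<^esub> f - 1)"
proof -
  have "inv\<^bsub>magnus_group\<^esub> f - 1 = - ((f - 1) * inv\<^bsub>magnus_group\<^esub> f)"
    using magnus_inv[OF f] by (simp add: algebra_simps)
  then show ?thesis using ncps_order_minus ncps_order_mult_right assms(2) by metis
qed

lemma magnus_order_1: "f \<in> carrier magnus_group \<Longrightarrow> ncps_order 1 (f - 1)"
  by (simp add: ncps_order_def)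

lemma magnus_commut:
  assumes f: "f \<in> carrier magnus_group" and g: "g \<in> carrier magnus_group"
  shows "commut magnus_group f g - 1 =
    ((f - 1) * (g - 1) - (g - 1) * (f - 1)) * (inv\<^bsub>magnus_group\<^esub> f * inv\<^bsub>magnus_group\<^esub> g)"
proof -
  let ?f = "inv\<^bsub>magnus_group\<^esub> f" and ?g = "inv\<^bsub>magnus_group\<^esub> g"
  have "(f - 1) * (g - 1) - (g - 1) * (f - 1) = f * g - g * f" by (simp add: algebra_simps)
  moreover have "g * f * (?f * ?g) = g * (f * ?f) * ?g" by (simp add: mult.assoc)
  ultimately show ?thesis
    using magnus_inv[OF f] magnus_inv[OF g]
    by (simp add: commut_def left_diff_distrib mult.assoc)
qed

definition magnus_filtration :: "nat \<Rightarrow> 'a ncps set"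
  where "magnus_filtration k = {f \<in> carrier magnus_group. ncps_order k (f - 1)}"

lemma subgroup_magnus_filtration: "subgroup (magnus_filtration k) magnus_group"
proof (rule M.subgroupI)
  show "magnus_filtration k \<noteq> {}"
    by (auto simp: magnus_filtration_def intro!: exI[of _ 1])
next
  fix f g :: "'a ncps" assume "f \<in> magnus_filtration k" "g \<in> magnus_filtration k"
  moreover have "f * g - 1 = (f - 1) * g + (g - 1)" by (simp add: algebra_simps)
  ultimately show "f \<otimes>\<^bsub>magnus_group\<^esub> g \<in> magnus_filtration k"
    using ncps_order_add ncps_order_mult_right M.m_closed unfolding magnus_filtration_def
    by (metis (mono_tags, lifting) magnus_simps(2) mem_Collect_eq)
qed (auto simp: magnus_filtration_def magnus_inv_order simp del: magnus_simps)

lemma lower_central_magnus: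
  "k \<ge> 1 \<Longrightarrow> lower_central magnus_group k \<subseteq> (magnus_filtration k :: 'a ncps set)"
proof (induction k rule: dec_induct)
  case base
  then show ?case by (auto simp: magnus_filtration_def ncps_order_def)
next
  case (step k)
  show ?case
  proof (rule M.lc_Suc_induct[OF step.hyps(1) subgroup_magnus_filtration])
    fix f g :: "'a ncps" assume f: "f \<in> carrier magnus_group" and "g \<in> lower_central magnus_group k"
    then have g: "g \<in> carrier magnus_group" "ncps_order k (g - 1)"
      using subsetD[OF step.IH] by (simp_all add: magnus_filtration_def del: magnus_simps)
    have "ncps_order (Suc k) ((f - 1) * (g - 1) - (g - 1) * (f - 1))"
      using ncps_order_mult[OF magnus_order_1[OF f] g(2)] ncps_order_mult[OF g(2) magnus_order_1[OF f]]
      by (intro ncps_order_diff) (simp_all add: add.commute)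
    then show "commut magnus_group f g \<in> magnus_filtration (Suc k)"
      unfolding magnus_filtration_def mem_Collect_eq magnus_commut[OF f g(1)]
      using M.commut_closed[OF f g(1)] ncps_order_mult_right by blast
  qed
qed

text \<open>
  An iterated commutator of elements \<open>1 + X\<^sub>j + \<dots>\<close> has as leading term the associative expansion of
  the iterated bracket.
\<close>

lemma magnus_lie_rep:
  fixes x :: "'b \<Rightarrow> 'a ncps"
  assumes "lie_rep magnus_group J x m g e"
    and x: "\<And>j. j \<in> J \<Longrightarrow> x j \<in> carrier magnus_group" "\<And>j. j \<in> J \<Longrightarrow> ncps_order 2 (x j - 1 - X j)"
  shows "ncps_order (Suc m) (g - 1 - lie_eval X e)"
proof -
  have lie_rep_order: "m \<ge> 1 \<and> g \<in> carrier magnus_group \<and> ncps_order m (g - 1)"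
    if "lie_rep magnus_group J x m g e" for m g e
  proof -
    have *: "m \<ge> 1" "g \<in> lower_central magnus_group m"
      using M.lie_rep_mem[OF that] x by (auto simp del: magnus_simps)
    then show ?thesis
      using subsetD[OF lower_central_magnus[OF *(1)] *(2)]
      by (simp add: magnus_filtration_def del: magnus_simps)
  qed
  from assms(1) show ?thesis
  proof induction
    case (gen j)
    then show ?case using assms(3) by (simp add: numeral_2_eq_2)
  next
    case (add m g s h t)
    have mem: "m \<ge> 1" "ncps_order m (g - 1)" "ncps_order m (h - 1)"
      using add.hyps lie_rep_order by blast+
    then have "ncps_order (Suc m) ((g - 1) * (h - 1))"
      using ncps_order_mult ncps_order_mono[of "m + m" _ "Suc m"] by (metis Suc_eq_plus1 add_le_cancel_left)
    moreover have "g * h - 1 - (lie_eval X s + lie_eval X t) =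
        (g - 1 - lie_eval X s) + (h - 1 - lie_eval X t) + (g - 1) * (h - 1)" by (simp add: algebra_simps)
    ultimately show ?case using ncps_order_add[OF ncps_order_add[OF add.IH]] by (simp only: lie_eval.simps magnus_simps)
  next
    case (neg m g s)
    let ?i = "inv\<^bsub>magnus_group\<^esub> g"
    have g: "m \<ge> 1" "ncps_order m (g - 1)" "g \<in> carrier magnus_group"
      using neg.hyps lie_rep_order by blast+
    then have "ncps_order (Suc m) ((g - 1) * (?i - 1))"
      using ncps_order_mult[of m "g - 1" 1 "?i - 1"] magnus_order_1[OF M.inv_closed[OF g(3)]] by simp
    moreover have "?i - 1 + lie_eval X s = - (g - 1 - lie_eval X s) - (g - 1) * (?i - 1)"
      using magnus_inv[OF g(3)] by (simp add: algebra_simps)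
    ultimately show ?case using ncps_order_diff[OF ncps_order_minus[OF neg.IH]] by (simp only: lie_eval.simps diff_minus_eq_add)
  next
    case (br k g s l h t)
    let ?s = "lie_eval X s" and ?t = "lie_eval X t"
    define A B where "A = g - 1" and "B = h - 1"
    have g: "g \<in> carrier magnus_group" "ncps_order k A"
      using br.hyps lie_rep_order by (auto simp: A_def simp del: magnus_simps)
    have h: "h \<in> carrier magnus_group" "ncps_order l B"
      using br.hyps lie_rep_order by (auto simp: B_def simp del: magnus_simps)
    have IH: "ncps_order (Suc k) (A - ?s)" "ncps_order (Suc l) (B - ?t)" using br.IH by (simp_all add: A_def B_def)
    have st: "ncps_order k ?s" "ncps_order l ?t"
      using ncps_order_diff[OF g(2) ncps_order_mono[OF IH(1)]] ncps_order_diff[OF h(2) ncps_order_mono[OF IH(2)]]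
      by simp_all
    define u where "u = inv\<^bsub>magnus_group\<^esub> g * inv\<^bsub>magnus_group\<^esub> h"
    have u: "ncps_order 1 (u - 1)"
      using magnus_order_1[OF M.m_closed[OF M.inv_closed[OF g(1)] M.inv_closed[OF h(1)]]] by (simp add: u_def)
    have eq: "commut magnus_group g h - 1 = (A * B - B * A) * u"
      using magnus_commut[OF g(1) h(1)] by (simp add: A_def B_def u_def)
    have "(A * B - B * A) * u - (?s * ?t - ?t * ?s) =
        (A * B - B * A) * (u - 1) + ((A - ?s) * B + ?s * (B - ?t)) - ((B - ?t) * A + ?t * (A - ?s))"
      by (simp add: algebra_simps)
    moreover have "ncps_order (Suc (k + l)) ((A * B - B * A) * (u - 1))"
      using ncps_order_mult[of "k + l" "A * B - B * A" 1] u ncps_order_mult[OF g(2) h(2)] ncps_order_mult[OF h(2) g(2)]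
      by (simp add: ncps_order_diff add.commute)
    moreover have "ncps_order (Suc (k + l)) ((A - ?s) * B + ?s * (B - ?t))"
      using ncps_order_mult[OF IH(1) h(2)] ncps_order_mult[OF st(1) IH(2)] by (simp add: ncps_order_add)
    moreover have "ncps_order (Suc (k + l)) ((B - ?t) * A + ?t * (A - ?s))"
      using ncps_order_mult[OF IH(2) g(2)] ncps_order_mult[OF st(2) IH(1)] by (simp add: ncps_order_add add.commute)
    ultimately show ?case unfolding eq by (simp add: ncps_order_add ncps_order_diff)
  next
    case (absorb m g s h)
    have h: "ncps_order (Suc m) (h - 1)"
      using subsetD[OF lower_central_magnus absorb.hyps(2)] by (simp add: magnus_filtration_def)
    have "ncps_order (Suc m) (g * (h - 1))" using ncps_order_mult[of 0 g, OF _ h] by simp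
    moreover have "g * h - 1 - lie_eval X s = (g - 1 - lie_eval X s) + g * (h - 1)" by (simp add: algebra_simps)
    ultimately show ?case using ncps_order_add[OF absorb.IH] by (simp only: magnus_simps)
  qed simp
qed

lemma magnus_coeff_hom:
  assumes "length u = k" "k \<ge> 1"
  shows "(\<lambda>f. coeff f u) \<in> hom (magnus_group\<lparr>carrier := magnus_filtration k\<rparr>) integer_group"
proof (rule homI)
  fix f g :: "'a ncps" assume "f \<in> carrier (magnus_group\<lparr>carrier := magnus_filtration k\<rparr>)"
    "g \<in> carrier (magnus_group\<lparr>carrier := magnus_filtration k\<rparr>)"
  then have "ncps_order (k + k) ((f - 1) * (g - 1))"
    by (intro ncps_order_mult) (auto simp: magnus_filtration_def)
  then have "coeff ((f - 1) * (g - 1)) u = 0" using assms by (simp add: ncps_order_def)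
  moreover have "f * g = (f - 1) * (g - 1) + (f - 1) + (g - 1) + 1" by (simp add: algebra_simps)
  ultimately have "coeff (f * g) u = coeff (f - 1) u + coeff (g - 1) u + coeff 1 u"
    by (metis add_0 coeff_simps(3))
  then show "coeff (f \<otimes>\<^bsub>magnus_group\<lparr>carrier := magnus_filtration k\<rparr>\<^esub> g) u
      = coeff f u \<otimes>\<^bsub>integer_group\<^esub> coeff g u"
    using assms by auto
qed simp

lemma magnus_gen_closed: "1 + nc_var a \<in> carrier magnus_group"
proof -
  define g :: "'a ncps" where "g = NCPS (\<lambda>w. if set w \<subseteq> {a} then (- 1) ^ length w else 0)"
  have 1: "(1 + nc_var a) * g = 1"
    by (intro ncps_eqI) (auto simp: distrib_right coeff_var_mult g_def split: list.split)
  have "coeff (g * nc_var a + g) w = coeff 1 w" for w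
    by (cases w rule: rev_cases) (auto simp: coeff_mult_var g_def)
  then have 2: "g * (1 + nc_var a) = 1"
    by (intro ncps_eqI) (simp add: distrib_left add.commute)
  show ?thesis using 1 2 by auto
qed

section \<open>Reduced words\<close>

definition word_inv :: "'a word \<Rightarrow> 'a word"
  where "word_inv w = rev (map letter_inv w)"

lemma word_inv_simps [simp]:
  "word_inv [] = []" "word_inv (u @ v) = word_inv v @ word_inv u" "word_inv [a] = [letter_inv a]"
  "word_inv w = [] \<longleftrightarrow> w = []" "length (word_inv w) = length w" "word_inv (word_inv w) = w"
  by (simp_all add: word_inv_def rev_map comp_def)

lemma word_inv_replicate [simp]: "word_inv (replicate n a) = replicate n (letter_inv a)"
  by (simp add: word_inv_def)

lemma hd_word_inv: "w \<noteq> [] \<Longrightarrow> hd (word_inv w) = letter_inv (last w)"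
  by (simp add: word_inv_def hd_rev last_map)

lemma last_word_inv: "w \<noteq> [] \<Longrightarrow> last (word_inv w) = letter_inv (hd w)"
  by (simp add: word_inv_def last_rev hd_map)

lemma set_word_inv: "fst ` set (word_inv w) = fst ` set w"
  by (force simp: word_inv_def image_image)

lemma letter_inv_eq_iff: "letter_inv a = letter_inv b \<longleftrightarrow> a = b"
  by (metis letter_inv_inv)

lemma reduced_append:
  "reduced (u @ v) \<longleftrightarrow> reduced u \<and> reduced v \<and> (u = [] \<or> v = [] \<or> hd v \<noteq> letter_inv (last u))"
  by (auto simp: reduced_def successively_append_iff)

lemma reduced_word_inv: "reduced (word_inv w) \<longleftrightarrow> reduced w"
proof -
  have "reduced (word_inv w)" if "reduced w" for w :: "'a word"
    using that
  proof (induction w)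
    case (Cons a w)
    then have "reduced (word_inv w @ [letter_inv a])"
      using reduced_append[of "[a]" w] by (auto simp: reduced_append last_word_inv letter_inv_eq_iff)
    then show ?case by (simp add: word_inv_def)
  qed simp
  then show ?thesis by (metis word_inv_simps(6))
qed

lemma reduced_replicate: "reduced (replicate n a)"
proof (induction n)
  case (Suc n)
  have "a \<noteq> letter_inv a" by (cases a) (simp add: letter_inv_def)
  then show ?case using Suc by (cases n) auto
qed simp

definition avoids_hd :: "'a \<Rightarrow> 'a word \<Rightarrow> bool"
  where "avoids_hd i w \<longleftrightarrow> (w = [] \<or> fst (hd w) \<noteq> i)"

definition avoids_last :: "'a \<Rightarrow> 'a word \<Rightarrow> bool"
  where "avoids_last i w \<longleftrightarrow> (w = [] \<or> fst (last w) \<noteq> i)"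

lemma avoids_word_inv [simp]:
  "avoids_hd i (word_inv w) \<longleftrightarrow> avoids_last i w" "avoids_last i (word_inv w) \<longleftrightarrow> avoids_hd i w"
  by (auto simp: avoids_hd_def avoids_last_def hd_word_inv last_word_inv)

lemma avoids_Nil [simp]: "avoids_hd i []" "avoids_last i []"
  by (simp_all add: avoids_hd_def avoids_last_def)

lemma avoids_last_append:
  "avoids_last i (u @ v) \<longleftrightarrow> (if v = [] then avoids_last i u else avoids_last i v)"
  by (simp add: avoids_last_def)

lemma avoids_hd_append:
  "avoids_hd i (u @ v) \<longleftrightarrow> (if u = [] then avoids_hd i v else avoids_hd i u)"
  by (simp add: avoids_hd_def)

lemma avoids_replicate:
  "avoids_last i (replicate n (q, e)) \<longleftrightarrow> n = 0 \<or> q \<noteq> i"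
  "avoids_hd i (replicate n (q, e)) \<longleftrightarrow> n = 0 \<or> q \<noteq> i"
  by (auto simp: avoids_last_def avoids_hd_def)

lemma reduced_conj_word:
  assumes "reduced w" "avoids_last i w"
  shows "reduced (w @ (i, e) # word_inv w)"
proof -
  have "reduced (w @ [(i, e)] @ word_inv w)"
    unfolding reduced_append[of w] reduced_append[of "[(i, e)]"]
    using assms
    by (auto simp: reduced_word_inv hd_word_inv avoids_last_def letter_inv_def prod_eq_iff)
  then show ?thesis by simp
qed

text \<open>
  By comparing lengths; a conjugate of a basis element thus determines its shortest
  conjugating word.
\<close>

lemma conj_word_inj:
  assumes "w @ a # word_inv w = v @ b # word_inv v"
  shows "w = v"
proof -
  have "length (w @ a # word_inv w) = length (v @ b # word_inv v)" using assms by simp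
  then have "length w = length v" by simp
  then show ?thesis using assms by simp
qed

lemma strip_last:
  fixes w :: "'a word"
  assumes "reduced w"
  obtains v n e where "w = v @ replicate n (i, e)" "reduced v" "avoids_last i v"
proof -
  have "\<exists>v n e. w = v @ replicate n (i, e) \<and> avoids_last i v"
    using assms
  proof (induction w rule: rev_induct)
    case Nil
    then show ?case by (intro exI[of _ "[]"] exI[of _ 0]) simp
  next
    case (snoc a w)
    show ?case
    proof (cases "fst a = i")
      case True
      then obtain e where a: "a = (i, e)" by (cases a) auto
      obtain v n e' where IH: "w = v @ replicate n (i, e')" "avoids_last i v"
        using snoc reduced_append by blast
      have "n = 0 \<or> e' = e"
      proof (cases "n = 0")
        case False
        then have "w \<noteq> []" "last w = (i, e')" using IH(1) by auto
        then show ?thesis using snoc.prems a by (auto simp: reduced_append[of w] letter_inv_def)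
      qed simp
      then have "w @ [a] = v @ replicate (Suc n) (i, e)"
        using IH(1) a by (auto simp: replicate_append_same)
      then show ?thesis using IH(2) by blast
    next
      case False
      then show ?thesis by (intro exI[of _ "w @ [a]"] exI[of _ 0]) (simp add: avoids_last_def)
    qed
  qed
  then show thesis using that assms by (auto simp: reduced_append)
qed

section \<open>Free groups\<close>

lemma (in group) commute_inv:
  assumes "x \<in> carrier G" "y \<in> carrier G" "y \<otimes> x = x \<otimes> y"
  shows "y \<otimes> inv x = inv x \<otimes> y"
proof -
  have "inv x \<otimes> (y \<otimes> x) \<otimes> inv x = inv x \<otimes> (x \<otimes> y) \<otimes> inv x" by (simp only: assms(3))
  then show ?thesis using assms(1,2) by (simp add: group_word)
qed

context
  fixes S :: "'a set"
begin

interpretation F: group "free_group S" by (rule group_free_group)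

lemma free_mult_append: "reduced (u @ v) \<Longrightarrow> u \<otimes>\<^bsub>free_group S\<^esub> v = u @ v"
proof (induction u)
  case (Cons a u)
  then have "reduced (u @ v)" by (metis append_Cons reduced_tl)
  with Cons show ?case by (simp add: mult_free_group letter_mult_reduced)
qed (simp add: mult_free_group)

lemma free_inv: "w \<in> carrier (free_group S) \<Longrightarrow> inv\<^bsub>free_group S\<^esub> w = word_inv w"
proof (rule F.inv_equality)
  assume w: "w \<in> carrier (free_group S)"
  then show "word_inv w \<otimes>\<^bsub>free_group S\<^esub> w = \<one>\<^bsub>free_group S\<^esub>"
    by (simp add: mult_free_group one_free_group word_inv_def foldr_inverse carrier_free_group)
  show "word_inv w \<in> carrier (free_group S)"
    using w by (simp add: carrier_free_group reduced_word_inv set_word_inv)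
qed

lemma free_carrier_append:
  "u @ v \<in> carrier (free_group S) \<longleftrightarrow>
    u \<in> carrier (free_group S) \<and> v \<in> carrier (free_group S) \<and> (u = [] \<or> v = [] \<or> hd v \<noteq> letter_inv (last u))"
  by (auto simp: carrier_free_group reduced_append)

lemma free_word_inv_closed: "w \<in> carrier (free_group S) \<Longrightarrow> word_inv w \<in> carrier (free_group S)"
  by (simp add: carrier_free_group reduced_word_inv set_word_inv)

lemma free_letter_closed: "i \<in> S \<Longrightarrow> [(i, e)] \<in> carrier (free_group S)"
  by (simp add: carrier_free_group)

lemma free_replicate_closed: "i \<in> S \<Longrightarrow> replicate n (i, e) \<in> carrier (free_group S)"
  by (auto simp: carrier_free_group reduced_replicate)

lemma free_group_generated:
  assumes H: "subgroup H (free_group S)" and gen: "\<And>i. i \<in> S \<Longrightarrow> free_gen i \<in> H"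
  shows "carrier (free_group S) \<subseteq> H"
proof
  fix w assume "w \<in> carrier (free_group S)"
  then show "w \<in> H"
  proof (induction w)
    case Nil
    then show ?case using subgroup.one_closed[OF H] by (simp add: one_free_group)
  next
    case (Cons a w)
    then have aw: "w \<in> carrier (free_group S)" "fst a \<in> S" "reduced (a # w)"
      by (auto simp: carrier_free_group dest: reduced_tl)
    have "[a] \<in> H"
      using gen[OF aw(2)] subgroup.m_inv_closed[OF H gen[OF aw(2)]] inv_free_gen[OF aw(2)]
      by (cases a; cases "snd a") (auto simp: free_gen_def)
    then have "[a] \<otimes>\<^bsub>free_group S\<^esub> w \<in> H"
      using Cons.IH[OF aw(1)] subgroup.m_closed[OF H] by blast
    then show ?case using aw by (simp add: mult_free_group letter_mult_reduced)
  qed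
qed

lemma free_hom_eqI:
  assumes "group G" "f \<in> hom (free_group S) G" "g \<in> hom (free_group S) G"
    and "\<And>i. i \<in> S \<Longrightarrow> f (free_gen i) = g (free_gen i)" and "w \<in> carrier (free_group S)"
  shows "f w = g w"
proof -
  interpret G: group G by (rule assms(1))
  interpret f: group_hom "free_group S" G f using assms(2) by unfold_locales
  interpret g: group_hom "free_group S" G g using assms(3) by unfold_locales
  have "subgroup {w \<in> carrier (free_group S). f w = g w} (free_group S)"
    by (rule F.subgroupI) (auto intro!: exI[of _ "\<one>\<^bsub>free_group S\<^esub>"])
  then have "carrier (free_group S) \<subseteq> {w \<in> carrier (free_group S). f w = g w}"
    by (rule free_group_generated) (simp add: assms(4) free_gen_closed)
  then show ?thesis using assms(5) by blast
qed

definition free_conj :: "'a word \<Rightarrow> 'a \<Rightarrow> 'a word"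
  where "free_conj w i = w \<otimes>\<^bsub>free_group S\<^esub> free_gen i \<otimes>\<^bsub>free_group S\<^esub> inv\<^bsub>free_group S\<^esub> w"

lemma free_conj_letter_word:
  assumes "w \<in> carrier (free_group S)" "avoids_last i w"
  shows "w \<otimes>\<^bsub>free_group S\<^esub> [(i, e)] \<otimes>\<^bsub>free_group S\<^esub> inv\<^bsub>free_group S\<^esub> w = w @ (i, e) # word_inv w"
proof -
  have r: "reduced (w @ (i, e) # word_inv w)"
    using assms by (intro reduced_conj_word) (auto simp: carrier_free_group)
  then have r': "reduced ((w @ [(i, e)]) @ word_inv w)" by simp
  then have "reduced (w @ [(i, e)])" by (simp only: reduced_append[of "w @ [(i, e)]"])
  then show ?thesis
    by (simp only: free_inv[OF assms(1)] free_mult_append[of w] free_mult_append[OF r'] append_assoc append_Cons append_Nil)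
qed

lemma free_conj_word:
  assumes "w \<in> carrier (free_group S)" "avoids_last i w"
  shows "free_conj w i = w @ (i, True) # word_inv w"
  using free_conj_letter_word[OF assms] by (simp add: free_conj_def free_gen_def)

lemma free_conj_replicate:
  assumes "i \<in> S" "w \<in> carrier (free_group S)"
  shows "free_conj (w \<otimes>\<^bsub>free_group S\<^esub> replicate n (i, e)) i = free_conj w i"
proof -
  let ?r = "replicate n (i, e)"
  have r: "?r \<in> carrier (free_group S)" using assms by (simp add: free_replicate_closed)
  have "?r \<otimes>\<^bsub>free_group S\<^esub> [(i, e)] = [(i, e)] \<otimes>\<^bsub>free_group S\<^esub> ?r"
    using reduced_replicate[of "Suc n" "(i, e)"] free_mult_append[of ?r "[(i, e)]"] free_mult_append[of "[(i, e)]" ?r]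
    by (simp add: replicate_append_same)
  note this F.commute_inv[OF free_letter_closed[OF assms(1), of e] r this]
  moreover have "free_gen i = (if e then [(i, e)] else inv\<^bsub>free_group S\<^esub> [(i, e)])"
    using free_letter_closed[OF assms(1)] by (auto simp: free_gen_def free_inv letter_inv_def)
  ultimately have c: "?r \<otimes>\<^bsub>free_group S\<^esub> free_gen i = free_gen i \<otimes>\<^bsub>free_group S\<^esub> ?r"
    by (simp split: if_splits)
  have "free_conj (w \<otimes>\<^bsub>free_group S\<^esub> ?r) i =
     w \<otimes>\<^bsub>free_group S\<^esub> (?r \<otimes>\<^bsub>free_group S\<^esub> free_gen i) \<otimes>\<^bsub>free_group S\<^esub> inv\<^bsub>free_group S\<^esub> ?r \<otimes>\<^bsub>free_group S\<^esub> inv\<^bsub>free_group S\<^esub> w"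
    using r assms free_gen_closed[OF assms(1)] by (simp add: free_conj_def F.group_word)
  then show ?thesis
    unfolding c using r assms free_gen_closed[OF assms(1)] by (simp add: free_conj_def F.group_word)
qed

lemma free_conj_strip:
  assumes "w \<in> carrier (free_group S)" "i \<in> S"
  obtains v where "v \<in> carrier (free_group S)" "avoids_last i v" "length v \<le> length w"
    "free_conj w i = free_conj v i"
proof -
  have "reduced w" using assms(1) by (simp add: carrier_free_group)
  then obtain v n e where v: "w = v @ replicate n (i, e)" "reduced v" "avoids_last i v"
    using strip_last[of w i] by blast
  have "v \<in> carrier (free_group S)" using assms(1) v by (simp add: free_carrier_append)
  moreover have "w = v \<otimes>\<^bsub>free_group S\<^esub> replicate n (i, e)"
    using v(1) assms(1) free_mult_append by (metis carrier_free_group)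
  moreover have "length v \<le> length w" using v(1) by simp
  ultimately show thesis using that[of v] v(3) free_conj_replicate[OF assms(2), of v n e] by simp
qed

lemma free_length_mult: "length (u \<otimes>\<^bsub>free_group S\<^esub> v) \<le> length u + length v"
proof (induction u)
  case (Cons a u)
  have "length (letter_mult a w) \<le> Suc (length w)" for w
    by (auto simp: letter_mult_def split: list.split)
  from this[of "u \<otimes>\<^bsub>free_group S\<^esub> v"] show ?case
    using Cons by (simp add: mult_free_group)
qed (simp add: mult_free_group)

end

definition free_lift :: "'a set \<Rightarrow> ('b, 'c) monoid_scheme \<Rightarrow> ('a \<Rightarrow> 'b) \<Rightarrow> 'a word \<Rightarrow> 'b"
  where "free_lift S G g = (THE h. h \<in> extensional (carrier (free_group S)) \<and> h \<in> hom (free_group S) G \<and>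
           (\<forall>i\<in>S. h (free_gen i) = g i))"

lemma (in group) free_lift:
  assumes "g \<in> S \<rightarrow> carrier G"
  shows "free_lift S G g \<in> extensional (carrier (free_group S))"
    and "free_lift S G g \<in> hom (free_group S) G"
    and "i \<in> S \<Longrightarrow> free_lift S G g (free_gen i) = g i"
  using theI'[OF free_group_universal[OF assms]] by (simp_all add: free_lift_def)

section \<open>Partial conjugations\<close>

definition partial_conj :: "'a set \<Rightarrow> 'a \<Rightarrow> 'a \<Rightarrow> bool \<Rightarrow> 'a word \<Rightarrow> 'a word"
  where "partial_conj S i j e =
    free_lift S (free_group S) (\<lambda>k. if k = i
      then [(j, e)] \<otimes>\<^bsub>free_group S\<^esub> free_gen i \<otimes>\<^bsub>free_group S\<^esub> inv\<^bsub>free_group S\<^esub> [(j, e)] else free_gen k)"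

lemma common_prefix:
  obtains c p q where "u = c @ p" "v = c @ q" "p = [] \<or> q = [] \<or> hd p \<noteq> hd q"
proof -
  have "\<exists>c p q. u = c @ p \<and> v = c @ q \<and> (p = [] \<or> q = [] \<or> hd p \<noteq> hd q)"
  proof (induction u arbitrary: v)
    case (Cons a u)
    show ?case
    proof (cases "v \<noteq> [] \<and> hd v = a")
      case True
      then obtain v' where v: "v = a # v'" by (cases v) auto
      obtain c p q where "u = c @ p" "v' = c @ q" "p = [] \<or> q = [] \<or> hd p \<noteq> hd q"
        using Cons by blast
      then show ?thesis using v by (intro exI[of _ "a # c"] exI[of _ p] exI[of _ q]) auto
    next
      case False
      then show ?thesis by (intro exI[of _ "[]"] exI[of _ "a # u"] exI[of _ v]) auto
    qed
  qed simp
  then show thesis using that by blast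
qed

definition inner_aut :: "('a, 'b) monoid_scheme \<Rightarrow> 'a \<Rightarrow> 'a \<Rightarrow> 'a"
  where "inner_aut G g = (\<lambda>w\<in>carrier G. g \<otimes>\<^bsub>G\<^esub> w \<otimes>\<^bsub>G\<^esub> inv\<^bsub>G\<^esub> g)"

lemma (in group) autoI:
  assumes f: "f \<in> hom G G" "f \<in> extensional (carrier G)" and g: "g \<in> hom G G"
    and fg: "\<And>w. w \<in> carrier G \<Longrightarrow> f (g w) = w" and gf: "\<And>w. w \<in> carrier G \<Longrightarrow> g (f w) = w"
  shows "f \<in> auto G"
proof -
  have "bij_betw f (carrier G) (carrier G)"
    using assms by (intro bij_betw_byWitness[of _ g]) (auto simp: hom_def)
  then show ?thesis using f by (simp add: auto_def Bij_def)
qed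

lemma (in group) inner_aut_auto:
  assumes "g \<in> carrier G"
  shows "inner_aut G g \<in> auto G"
proof (rule autoI)
  have hom: "inner_aut G h \<in> hom G G" if "h \<in> carrier G" for h
    using that by (intro homI) (simp_all add: inner_aut_def group_word)
  show "inner_aut G g \<in> hom G G" "inner_aut G (inv g) \<in> hom G G"
    using assms by (auto intro: hom)
qed (use assms in \<open>simp_all add: inner_aut_def group_word\<close>)

context
  fixes S :: "'a set"
begin

interpretation F: group "free_group S" by (rule group_free_group)

abbreviation (input) "FG \<equiv> free_group S"

lemma free_conj_mult:
  "g \<in> carrier FG \<Longrightarrow> w \<in> carrier FG \<Longrightarrow> i \<in> S \<Longrightarrow>
    g \<otimes>\<^bsub>FG\<^esub> free_conj S w i \<otimes>\<^bsub>FG\<^esub> inv\<^bsub>FG\<^esub> g = free_conj S (g \<otimes>\<^bsub>FG\<^esub> w) i"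
  by (simp add: free_conj_def free_gen_closed F.group_word)

lemma free_conj_Nil: "i \<in> S \<Longrightarrow> free_conj S [] i = free_gen i"
  using free_gen_closed[of i S] F.r_one[of "free_gen i"] F.l_one[of "free_gen i"]
  by (simp add: free_conj_def one_free_group[symmetric, of S])

lemma free_inv_letter: "i \<in> S \<Longrightarrow> inv\<^bsub>FG\<^esub> [(i, e)] = [(i, \<not> e)]"
  by (simp add: free_inv free_letter_closed letter_inv_def)

lemma inner_aut_free_gen: "i \<in> S \<Longrightarrow> inner_aut FG g (free_gen i) = free_conj S g i"
  by (simp add: inner_aut_def free_conj_def free_gen_closed)

lemma partial_conj_hom:
  assumes "i \<in> S" "j \<in> S"
  shows "partial_conj S i j e \<in> extensional (carrier FG)" "partial_conj S i j e \<in> hom FG FG"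
    "k \<in> S \<Longrightarrow> partial_conj S i j e (free_gen k) =
      (if k = i then [(j, e)] \<otimes>\<^bsub>FG\<^esub> free_gen i \<otimes>\<^bsub>FG\<^esub> inv\<^bsub>FG\<^esub> [(j, e)] else free_gen k)"
proof -
  have *: "(\<lambda>k. if k = i then [(j, e)] \<otimes>\<^bsub>FG\<^esub> free_gen i \<otimes>\<^bsub>FG\<^esub> inv\<^bsub>FG\<^esub> [(j, e)] else free_gen k) \<in> S \<rightarrow> carrier FG"
    using assms by (auto simp: free_gen_closed free_letter_closed)
  show "partial_conj S i j e \<in> extensional (carrier FG)" "partial_conj S i j e \<in> hom FG FG"
    "k \<in> S \<Longrightarrow> partial_conj S i j e (free_gen k) =
      (if k = i then [(j, e)] \<otimes>\<^bsub>FG\<^esub> free_gen i \<otimes>\<^bsub>FG\<^esub> inv\<^bsub>FG\<^esub> [(j, e)] else free_gen k)"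
    using F.free_lift[OF *] by (simp_all add: partial_conj_def)
qed

lemma partial_conj_letter:
  assumes "i \<in> S" "j \<in> S" "i \<noteq> j"
  shows "partial_conj S i j e [(j, b)] = [(j, b)]"
proof -
  interpret f: group_hom FG FG "partial_conj S i j e"
    using partial_conj_hom(2)[OF assms(1,2)] by unfold_locales
  have 1: "partial_conj S i j e (free_gen j) = free_gen j"
    using partial_conj_hom(3)[OF assms(1,2,2)] assms by simp
  then have "partial_conj S i j e (inv\<^bsub>FG\<^esub> (free_gen j)) = inv\<^bsub>FG\<^esub> (free_gen j)"
    using free_gen_closed[OF assms(2)] by simp
  with 1 show ?thesis using inv_free_gen[OF assms(2)] by (cases b) (simp_all add: free_gen_def)
qed

lemma partial_conj_inverse:
  assumes "i \<in> S" "j \<in> S" "i \<noteq> j" "w \<in> carrier FG"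
  shows "partial_conj S i j (\<not> e) (partial_conj S i j e w) = w"
proof -
  interpret f: group_hom FG FG "partial_conj S i j e"
    using partial_conj_hom(2)[OF assms(1,2)] by unfold_locales
  interpret g: group_hom FG FG "partial_conj S i j (\<not> e)"
    using partial_conj_hom(2)[OF assms(1,2)] by unfold_locales
  let ?f = "\<lambda>w. partial_conj S i j (\<not> e) (partial_conj S i j e w)"
  have "?f w = (\<lambda>w. w) w"
  proof (rule free_hom_eqI[of FG ?f S "\<lambda>w. w"])
    show "?f \<in> hom FG FG" by (intro homI) auto
    show "(\<lambda>w. w) \<in> hom FG FG" by (intro homI) auto
    fix k assume k: "k \<in> S"
    note [simp] = partial_conj_hom(3)[OF assms(1,2)] partial_conj_letter[OF assms(1-3)]
      free_letter_closed[OF assms(2)] free_gen_closed[OF k] k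
    show "?f (free_gen k) = free_gen k"
    proof (cases "k = i")
      case True
      have "?f (free_gen i) = [(j, e)] \<otimes>\<^bsub>FG\<^esub> ([(j, \<not> e)] \<otimes>\<^bsub>FG\<^esub> free_gen i \<otimes>\<^bsub>FG\<^esub> inv\<^bsub>FG\<^esub> [(j, \<not> e)]) \<otimes>\<^bsub>FG\<^esub> inv\<^bsub>FG\<^esub> [(j, e)]"
        using assms(1) free_gen_closed[OF assms(1)] by simp
      also have "[(j, \<not> e)] = inv\<^bsub>FG\<^esub> [(j, e)]" using free_inv_letter[OF assms(2)] by simp
      finally show ?thesis using True free_gen_closed[OF assms(1)] by (simp add: F.group_word)
    qed simp
  qed (use assms F.is_group in auto)
  then show ?thesis by simp
qed

lemma partial_conj_auto:
  assumes "i \<in> S" "j \<in> S" "i \<noteq> j"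
  shows "partial_conj S i j e \<in> auto FG"
  using partial_conj_hom[OF assms(1,2)] partial_conj_inverse[OF assms, of _ e]
    partial_conj_inverse[OF assms, of _ "\<not> e"]
  by (intro F.autoI[of _ "partial_conj S i j (\<not> e)"]) auto

lemma partial_conj_inv:
  assumes "i \<in> S" "j \<in> S" "i \<noteq> j"
  shows "inv\<^bsub>AutoGroup FG\<^esub> (partial_conj S i j e) = partial_conj S i j (\<not> e)"
proof -
  interpret A: group "AutoGroup FG" by (rule F.AutoGroup)
  note pc = partial_conj_auto[OF assms]
  have "partial_conj S i j (\<not> e) \<otimes>\<^bsub>AutoGroup FG\<^esub> partial_conj S i j e = \<one>\<^bsub>AutoGroup FG\<^esub>"
  proof (rule F.auto_eqI)
    show "partial_conj S i j (\<not> e) \<otimes>\<^bsub>AutoGroup FG\<^esub> partial_conj S i j e \<in> auto FG"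
      using A.m_closed pc by (simp add: F.carrier_AutoGroup)
    show "\<one>\<^bsub>AutoGroup FG\<^esub> \<in> auto FG" using A.one_closed by (simp add: F.carrier_AutoGroup)
  qed (simp add: F.AutoGroup_mult pc F.AutoGroup_one partial_conj_inverse[OF assms])
  then show ?thesis using pc by (intro A.inv_equality) (simp_all add: F.carrier_AutoGroup)
qed

lemma auto_free_eqI:
  assumes "f \<in> auto FG" "g \<in> auto FG" "\<And>i. i \<in> S \<Longrightarrow> f (free_gen i) = g (free_gen i)"
  shows "f = g"
proof (rule F.auto_eqI[OF assms(1,2)])
  fix w assume "w \<in> carrier FG"
  then show "f w = g w"
    using assms by (intro free_hom_eqI[of FG f S g w]) (simp_all add: auto_def F.is_group)
qed

lemma mccool_auto: "f \<in> mccool S \<Longrightarrow> f \<in> auto FG"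
  by (simp add: mccool_def F.carrier_AutoGroup)

lemma mccoolI:
  assumes "f \<in> auto FG" "\<And>i. i \<in> S \<Longrightarrow> \<exists>w\<in>carrier FG. f (free_gen i) = free_conj S w i"
  shows "f \<in> mccool S"
  using assms by (simp add: mccool_def F.carrier_AutoGroup free_conj_def)

lemma mccoolD: "f \<in> mccool S \<Longrightarrow> i \<in> S \<Longrightarrow> \<exists>w\<in>carrier FG. f (free_gen i) = free_conj S w i"
  by (simp add: mccool_def free_conj_def)

lemma partial_conj_mccool:
  assumes "i \<in> S" "j \<in> S" "i \<noteq> j"
  shows "partial_conj S i j e \<in> mccool S"
proof (rule mccoolI[OF partial_conj_auto[OF assms]])
  fix k assume k: "k \<in> S"
  show "\<exists>w\<in>carrier FG. partial_conj S i j e (free_gen k) = free_conj S w k"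
  proof (cases "k = i")
    case True
    then show ?thesis using partial_conj_hom(3)[OF assms(1,2,1), of e] free_letter_closed[OF assms(2)]
      by (intro bexI[of _ "[(j, e)]"]) (simp_all add: free_conj_def)
  next
    case False
    then show ?thesis using partial_conj_hom(3)[OF assms(1,2) k, of e] k
      by (intro bexI[of _ "[]"]) (simp_all add: free_conj_Nil carrier_free_group)
  qed
qed

lemma hom_letter:
  assumes "f \<in> hom FG FG" "w \<in> carrier FG" "i \<in> S" "f (free_gen i) = free_conj S w i"
  shows "f [(i, e)] = w \<otimes>\<^bsub>FG\<^esub> [(i, e)] \<otimes>\<^bsub>FG\<^esub> inv\<^bsub>FG\<^esub> w"
proof (cases e)
  case True
  then show ?thesis using assms by (simp add: free_conj_def free_gen_def)
next
  case False
  interpret f: group_hom FG FG f using assms(1) by unfold_locales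
  have "f (inv\<^bsub>FG\<^esub> (free_gen i)) = inv\<^bsub>FG\<^esub> (free_conj S w i)"
    using assms(3,4) by (simp add: free_gen_closed)
  then show ?thesis
    using False assms(2,3) free_gen_closed[OF assms(3)] inv_free_gen[OF assms(3)]
    by (simp add: free_conj_def F.group_word)
qed

lemma mult_partial_conj:
  assumes ij: "i \<in> S" "j \<in> S" "i \<noteq> j" and f: "f \<in> auto FG" and "h \<in> carrier FG" "w \<in> carrier FG"
    and "f (free_gen j) = free_conj S h j" "f (free_gen i) = free_conj S w i"
  shows "(f \<otimes>\<^bsub>AutoGroup FG\<^esub> partial_conj S i j e) (free_gen i) =
      free_conj S (h \<otimes>\<^bsub>FG\<^esub> [(j, e)] \<otimes>\<^bsub>FG\<^esub> inv\<^bsub>FG\<^esub> h \<otimes>\<^bsub>FG\<^esub> w) i"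
    and "k \<in> S \<Longrightarrow> k \<noteq> i \<Longrightarrow> (f \<otimes>\<^bsub>AutoGroup FG\<^esub> partial_conj S i j e) (free_gen k) = f (free_gen k)"
proof -
  interpret f: group_hom FG FG f using F.auto_group_hom[OF f] .
  note m = F.AutoGroup_mult[OF f partial_conj_auto[OF ij] free_gen_closed] partial_conj_hom(3)[OF ij(1,2)]
  note c = free_letter_closed[OF ij(2)] free_gen_closed[OF ij(1)]
  have "(f \<otimes>\<^bsub>AutoGroup FG\<^esub> partial_conj S i j e) (free_gen i) =
      f [(j, e)] \<otimes>\<^bsub>FG\<^esub> free_conj S w i \<otimes>\<^bsub>FG\<^esub> inv\<^bsub>FG\<^esub> (f [(j, e)])"
    using assms c by (simp add: m)
  also have "\<dots> = free_conj S (f [(j, e)] \<otimes>\<^bsub>FG\<^esub> w) i"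
    using assms c by (intro free_conj_mult) auto
  finally show "(f \<otimes>\<^bsub>AutoGroup FG\<^esub> partial_conj S i j e) (free_gen i) =
      free_conj S (h \<otimes>\<^bsub>FG\<^esub> [(j, e)] \<otimes>\<^bsub>FG\<^esub> inv\<^bsub>FG\<^esub> h \<otimes>\<^bsub>FG\<^esub> w) i"
    using hom_letter[OF f.homh assms(5) ij(2) assms(7)] by simp
  show "k \<in> S \<Longrightarrow> k \<noteq> i \<Longrightarrow> (f \<otimes>\<^bsub>AutoGroup FG\<^esub> partial_conj S i j e) (free_gen k) = f (free_gen k)"
    by (simp add: m)
qed

section \<open>Generation of the McCool group\<close>

text \<open>
  No \<open>w\<^sub>i\<close> begins with \<open>w\<^sub>j x\<^sub>j\<close> or \<open>w\<^sub>j x\<^sub>j\<^sup>-\<^sup>1\<close>, so when images \<open>w\<^sub>j x\<^sub>j\<^sup>e w\<^sub>j\<^sup>-\<^sup>1\<close> are multiplied the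
  cancellation between neighbours never reaches the middle letters.
\<close>

lemma no_absorption_image:
  assumes f: "f \<in> hom FG FG"
    and w: "\<And>i. i \<in> S \<Longrightarrow> w i \<in> carrier FG" "\<And>i. i \<in> S \<Longrightarrow> avoids_last i (w i)"
      "\<And>i. i \<in> S \<Longrightarrow> f (free_gen i) = free_conj S (w i) i"
    and no: "\<And>i j e s. i \<in> S \<Longrightarrow> j \<in> S \<Longrightarrow> i \<noteq> j \<Longrightarrow> w i \<noteq> w j @ (j, e) # s"
    and "z @ [(l, b)] \<in> carrier FG"
  shows "\<exists>R. f (z @ [(l, b)]) = R @ (l, b) # word_inv (w l)"
  using assms(6)
proof (induction z arbitrary: l b rule: rev_induct)
  case Nil
  then have l: "l \<in> S" by (simp add: carrier_free_group)
  then show ?case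
    using hom_letter[OF f w(1)[OF l] l w(3)[OF l], of b] free_conj_letter_word[OF w(1,2)[OF l], of b]
    by (intro exI[of _ "w l"]) simp
next
  case (snoc a z)
  interpret f: group_hom FG FG f using f by unfold_locales
  obtain j e where a: "a = (j, e)" by (cases a)
  have z: "z @ [(j, e)] \<in> carrier FG" and lb: "[(l, b)] \<in> carrier FG" and jl: "(l, b) \<noteq> letter_inv (j, e)"
    using snoc.prems a unfolding free_carrier_append[of "z @ [a]"] by auto
  have j: "j \<in> S" and l: "l \<in> S" using z lb by (auto simp: carrier_free_group)
  from snoc.IH[OF z] obtain R where R: "f (z @ [(j, e)]) = R @ (j, e) # word_inv (w j)" ..
  obtain c p q where cpq: "w j = c @ p" "w l = c @ q" "p = [] \<or> q = [] \<or> hd p \<noteq> hd q" "j = l \<Longrightarrow> p = [] \<and> q = []"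
  proof (cases "j = l")
    case True
    then show ?thesis by (intro that[of "w j" "[]" "[]"]) auto
  next
    case False
    obtain c p q where "w j = c @ p" "w l = c @ q" "p = [] \<or> q = [] \<or> hd p \<noteq> hd q"
      by (rule common_prefix[of "w j" "w l"])
    with False show ?thesis by (intro that[of c p q]) auto
  qed
  have carr: "c \<in> carrier FG" "p \<in> carrier FG" "q \<in> carrier FG"
    using w(1)[OF j] w(1)[OF l] by (auto simp: cpq free_carrier_append)
  let ?A = "R @ [(j, e)]"
  have fz: "?A @ word_inv p @ word_inv c \<in> carrier FG"
    using f.hom_closed[OF z] R cpq(1) by simp
  then have A: "?A \<in> carrier FG" and Ap: "?A @ word_inv p \<in> carrier FG"
    using free_carrier_append[of ?A "word_inv p @ word_inv c"]
      free_carrier_append[of "?A @ word_inv p" "word_inv c"] by auto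
  have red: "reduced (?A @ word_inv p @ word_inv c)" using fz by (simp only: carrier_free_group)
  have wl: "c @ q @ (l, b) # word_inv (w l) \<in> carrier FG"
    using F.m_closed[OF F.m_closed[OF w(1)[OF l] lb] F.inv_closed[OF w(1)[OF l]]]
      free_conj_letter_word[OF w(1,2)[OF l], of b] cpq(2) by simp
  then have ql: "q @ (l, b) # word_inv (w l) \<in> carrier FG" by (simp only: free_carrier_append)
  have "last (?A @ word_inv p) = (if p = [] then (j, e) else letter_inv (hd p))"
    by (simp add: last_word_inv)
  moreover have "hd (q @ (l, b) # word_inv (w l)) = (if q = [] then (l, b) else hd q)" by simp
  moreover have "hd q \<noteq> letter_inv (j, e)" if "p = []" "q \<noteq> []"
  proof
    assume "hd q = letter_inv (j, e)"
    then have "w l = w j @ (j, \<not> e) # tl q"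
      using that cpq by (cases q) (auto simp: letter_inv_def)
    then show False using no[OF l j] that cpq(4) by blast
  qed
  moreover have "hd p \<noteq> (l, b)" if "q = []" "p \<noteq> []"
  proof
    assume "hd p = (l, b)"
    then have "w j = w l @ (l, b) # tl p"
      using that cpq by (cases p) auto
    then show False using no[OF j l] that cpq(4) by blast
  qed
  ultimately have "hd (q @ (l, b) # word_inv (w l)) \<noteq> letter_inv (last (?A @ word_inv p))"
    using cpq(3) jl by (auto split: if_splits)
  then have *: "(?A @ word_inv p) @ (q @ (l, b) # word_inv (w l)) \<in> carrier FG"
    using Ap ql unfolding free_carrier_append[of "?A @ word_inv p"] by blast
  have "f (z @ [(j, e)]) = ?A \<otimes>\<^bsub>FG\<^esub> inv\<^bsub>FG\<^esub> p \<otimes>\<^bsub>FG\<^esub> inv\<^bsub>FG\<^esub> c"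
    using R cpq(1) red free_mult_append[of ?A "word_inv p" S] free_mult_append[of "?A @ word_inv p" "word_inv c" S]
      reduced_append[of "?A @ word_inv p" "word_inv c"] free_inv[OF carr(1)] free_inv[OF carr(2)] by simp
  moreover have "f [(l, b)] = c \<otimes>\<^bsub>FG\<^esub> q \<otimes>\<^bsub>FG\<^esub> [(l, b)] \<otimes>\<^bsub>FG\<^esub> inv\<^bsub>FG\<^esub> (w l)"
    using hom_letter[OF f w(1)[OF l] l w(3)[OF l], of b] cpq(2) w(1)[OF l] free_mult_append[of c q S]
    by (simp add: carrier_free_group)
  moreover have "f (z @ [(j, e)] @ [(l, b)]) = f (z @ [(j, e)]) \<otimes>\<^bsub>FG\<^esub> f [(l, b)]"
    using snoc.prems a f.hom_mult[OF z lb] free_mult_append[of "z @ [(j, e)]" "[(l, b)]" S]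
    by (simp add: carrier_free_group)
  ultimately have "f (z @ [(j, e)] @ [(l, b)]) =
      ?A \<otimes>\<^bsub>FG\<^esub> inv\<^bsub>FG\<^esub> p \<otimes>\<^bsub>FG\<^esub> (q \<otimes>\<^bsub>FG\<^esub> [(l, b)] \<otimes>\<^bsub>FG\<^esub> inv\<^bsub>FG\<^esub> (w l))"
    using A carr lb w(1)[OF l] by (simp add: F.group_word)
  also have "q \<otimes>\<^bsub>FG\<^esub> [(l, b)] \<otimes>\<^bsub>FG\<^esub> inv\<^bsub>FG\<^esub> (w l) = q @ (l, b) # word_inv (w l)"
  proof -
    have r: "reduced ((q @ [(l, b)]) @ word_inv (w l))" using ql by (simp add: carrier_free_group)
    then have "reduced (q @ [(l, b)])" by (simp only: reduced_append[of "q @ [(l, b)]"])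
    then show ?thesis
      using free_mult_append[OF r, of S] free_mult_append[of q "[(l, b)]" S] free_inv[OF w(1)[OF l]] by simp
  qed
  also have "?A \<otimes>\<^bsub>FG\<^esub> inv\<^bsub>FG\<^esub> p = ?A @ word_inv p"
    using free_mult_append[of ?A "word_inv p" S] Ap free_inv[OF carr(2)] by (simp only: carrier_free_group)
  also have "(?A @ word_inv p) \<otimes>\<^bsub>FG\<^esub> (q @ (l, b) # word_inv (w l)) = (?A @ word_inv p) @ (q @ (l, b) # word_inv (w l))"
    using * by (intro free_mult_append) (simp only: carrier_free_group)
  finally show ?case using a by (intro exI[of _ "?A @ word_inv p @ q"]) simp
qed

text \<open>
  Apply \<open>no_absorption_image\<close> to a preimage of \<open>x\<^sub>i\<close>: a word of length one ends with \<open>x\<^sub>l w\<^sub>l\<^sup>-\<^sup>1\<close> only if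
  \<open>l = i\<close> and \<open>w\<^sub>i\<close> is empty.
\<close>

lemma no_absorption_trivial:
  assumes f: "f \<in> auto FG"
    and w: "\<And>i. i \<in> S \<Longrightarrow> w i \<in> carrier FG" "\<And>i. i \<in> S \<Longrightarrow> avoids_last i (w i)"
      "\<And>i. i \<in> S \<Longrightarrow> f (free_gen i) = free_conj S (w i) i"
    and no: "\<And>i j e s. i \<in> S \<Longrightarrow> j \<in> S \<Longrightarrow> i \<noteq> j \<Longrightarrow> w i \<noteq> w j @ (j, e) # s"
    and i: "i \<in> S"
  shows "w i = []"
proof -
  interpret f: group_hom FG FG f using F.auto_group_hom[OF f] .
  define z where "z = (inv\<^bsub>AutoGroup FG\<^esub> f) (free_gen i)"
  have z: "z \<in> carrier FG" "f z = free_gen i"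
    using F.AutoGroup_inv[OF f] F.auto_closed free_gen_closed[OF i] by (auto simp: z_def)
  have "z \<noteq> []" using z(2) f.hom_one by (auto simp: one_free_group free_gen_def)
  then obtain y l b where y: "z = y @ [(l, b)]" by (metis rev_exhaust surj_pair)
  obtain R where "f (y @ [(l, b)]) = R @ (l, b) # word_inv (w l)"
    using no_absorption_image[OF f.homh w no, of y l b] z y by blast
  then have "[(i, True)] = R @ (l, b) # word_inv (w l)" using z y by (simp add: free_gen_def)
  then have "word_inv (w l) = []" "l = i" by (cases R; simp)+
  then show ?thesis by simp
qed

text \<open>
  If some \<open>w\<^sub>i\<close> begins with \<open>w\<^sub>j x\<^sub>j\<^sup>e\<close>, composition with a partial conjugation deletes the letter
  \<open>x\<^sub>j\<^sup>e\<close> and shortens the total length of the conjugating words. If there is no such pair, the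
  automorphism is the identity.
\<close>

theorem mccool_generated:
  assumes "finite S" and H: "subgroup H (AutoGroup FG)"
    and gen: "\<And>i j. i \<in> S \<Longrightarrow> j \<in> S \<Longrightarrow> i \<noteq> j \<Longrightarrow> partial_conj S i j True \<in> H"
  shows "mccool S \<subseteq> H"
proof
  interpret A: group "AutoGroup FG" by (rule F.AutoGroup)
  have gen': "partial_conj S i j e \<in> H" if "i \<in> S" "j \<in> S" "i \<noteq> j" for i j e
    using gen[OF that] subgroup.m_inv_closed[OF H gen[OF that]] partial_conj_inv[OF that, of True]
    by (cases e) simp_all
  have "f \<in> H" if "f \<in> mccool S" "\<And>i. i \<in> S \<Longrightarrow> w i \<in> carrier FG" "\<And>i. i \<in> S \<Longrightarrow> avoids_last i (w i)"
      "\<And>i. i \<in> S \<Longrightarrow> f (free_gen i) = free_conj S (w i) i" for f w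
    using that
  proof (induction "\<Sum>i\<in>S. length (w i)" arbitrary: f w rule: less_induct)
    case less
    have f: "f \<in> auto FG" using less.prems(1) by (rule mccool_auto)
    show ?case
    proof (cases "\<exists>i\<in>S. \<exists>j\<in>S. \<exists>e s. i \<noteq> j \<and> w i = w j @ (j, e) # s")
      case False
      then have "w i = []" if "i \<in> S" for i
        using no_absorption_trivial[OF f less.prems(2-4)] that by blast
      then have fi: "f (free_gen i) = \<one>\<^bsub>AutoGroup FG\<^esub> (free_gen i)" if "i \<in> S" for i
        using less.prems(4) that by (simp add: free_conj_Nil F.AutoGroup_one free_gen_closed)
      have "f = \<one>\<^bsub>AutoGroup FG\<^esub>"
        using A.one_closed by (intro auto_free_eqI[OF f _ fi]) (simp_all add: F.carrier_AutoGroup)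
      then show ?thesis using subgroup.one_closed[OF H] by simp
    next
      case True
      then obtain i j e s where ij: "i \<in> S" "j \<in> S" "i \<noteq> j" and wi: "w i = w j @ (j, e) # s" by blast
      note pc = partial_conj_mccool[OF ij, of "\<not> e"]
      let ?g = "f \<otimes>\<^bsub>AutoGroup FG\<^esub> partial_conj S i j (\<not> e)"
      have g: "?g \<in> mccool S" using subgroup.m_closed[OF subgroup_mccool less.prems(1) pc] .
      have s: "[(j, e)] @ s \<in> carrier FG" "s \<in> carrier FG"
        using less.prems(2)[OF ij(1)] free_carrier_append[of "w j" "(j, e) # s"]
          free_carrier_append[of "[(j, e)]" s] by (auto simp: wi)
      have "w i = w j \<otimes>\<^bsub>FG\<^esub> ([(j, e)] \<otimes>\<^bsub>FG\<^esub> s)"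
        using less.prems(2)[OF ij(1)] s free_mult_append[of "w j" "(j, e) # s" S] free_mult_append[of "[(j, e)]" s S]
        by (simp add: carrier_free_group wi)
      then have "w j \<otimes>\<^bsub>FG\<^esub> [(j, \<not> e)] \<otimes>\<^bsub>FG\<^esub> inv\<^bsub>FG\<^esub> (w j) \<otimes>\<^bsub>FG\<^esub> w i = w j \<otimes>\<^bsub>FG\<^esub> s"
        using less.prems(2)[OF ij(2)] s(2) free_letter_closed[OF ij(2)] free_inv_letter[OF ij(2), of e, symmetric]
        by (simp add: F.group_word)
      then have gi: "?g (free_gen i) = free_conj S (w j \<otimes>\<^bsub>FG\<^esub> s) i"
        using mult_partial_conj(1)[OF ij f less.prems(2)[OF ij(2)] less.prems(2)[OF ij(1)] less.prems(4)[OF ij(2)] less.prems(4)[OF ij(1)], of "\<not> e"]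
        by simp
      have gk: "?g (free_gen k) = free_conj S (w k) k" if "k \<in> S" "k \<noteq> i" for k
        using mult_partial_conj(2)[OF ij f less.prems(2)[OF ij(2)] less.prems(2)[OF ij(1)] less.prems(4)[OF ij(2)] less.prems(4)[OF ij(1)] that]
          less.prems(4)[OF that(1)] by simp
      obtain v where v: "v \<in> carrier FG" "avoids_last i v" "length v \<le> length (w j \<otimes>\<^bsub>FG\<^esub> s)"
          "free_conj S (w j \<otimes>\<^bsub>FG\<^esub> s) i = free_conj S v i"
        using free_conj_strip[of "w j \<otimes>\<^bsub>FG\<^esub> s" S i] less.prems(2)[OF ij(2)] s ij by blast
      have "length v < length (w i)" using v(3) free_length_mult[of S "w j" s] by (simp add: wi)
      then have "(\<Sum>k\<in>S. length ((w(i := v)) k)) < (\<Sum>k\<in>S. length (w k))"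
        using assms(1) ij(1) by (intro sum_strict_mono_ex1) auto
      then have gH: "?g \<in> H"
        by (rule less.hyps[OF _ g]) (use less.prems(2,3) v gi gk in auto)
      have "f = ?g \<otimes>\<^bsub>AutoGroup FG\<^esub> inv\<^bsub>AutoGroup FG\<^esub> (partial_conj S i j (\<not> e))"
        using f partial_conj_auto[OF ij, of "\<not> e"] by (simp add: A.m_assoc F.carrier_AutoGroup[symmetric])
      then show ?thesis
        using subgroup.m_closed[OF H gH] gen'[OF ij] partial_conj_inv[OF ij] by metis
    qed
  qed
  note main = this
  fix f assume f: "f \<in> mccool S"
  have "\<exists>w. w \<in> carrier FG \<and> avoids_last i w \<and> f (free_gen i) = free_conj S w i" if "i \<in> S" for i
    using mccoolD[OF f that] free_conj_strip[of _ S i] that by metis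
  then obtain w where "\<And>i. i \<in> S \<Longrightarrow> w i \<in> carrier FG \<and> avoids_last i (w i) \<and> f (free_gen i) = free_conj S (w i) i"
    by metis
  then show "f \<in> H" using main[OF f, of w] by blast
qed

section \<open>Ping-pong\<close>

lemma free_mult_carrier: "u @ v \<in> carrier FG \<Longrightarrow> u \<otimes>\<^bsub>FG\<^esub> v = u @ v"
  by (simp add: free_mult_append carrier_free_group)

text \<open>
  The conjugate \<open>w x\<^sub>i w\<^sup>-\<^sup>1\<close> translates the Cayley tree along the axis through the vertices \<open>w x\<^sub>i\<^sup>n\<close>. The
  predicate says that the axis of the image of \<open>x\<^sub>q\<close> lies between the other two: after a translation by \<open>h\<close> it is the
  axis of \<open>x\<^sub>q\<close>, and the axes belonging to \<open>r\<close> and \<open>p\<close> are reached from it along the paths \<open>t\<close> and \<open>s\<close>, which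
  start at the vertices \<open>1\<close> and \<open>replicate (Suc m) (q, e)\<close>. The positive offset \<open>Suc m\<close> says that the
  two vertices differ; its sign \<open>e\<close> is that of the last letter.
\<close>

definition pingpong :: "'a \<Rightarrow> 'a \<Rightarrow> 'a \<Rightarrow> bool \<Rightarrow> ('a word \<Rightarrow> 'a word) \<Rightarrow> bool"
  where "pingpong p q r e f \<longleftrightarrow> (\<exists>h s t m. h \<in> carrier FG \<and> s \<in> carrier FG \<and> t \<in> carrier FG
    \<and> avoids_hd q s \<and> avoids_last p s \<and> avoids_hd q t \<and> avoids_last r t
    \<and> f (free_gen p) = free_conj S (h \<otimes>\<^bsub>FG\<^esub> (replicate (Suc m) (q, e) @ s)) p
    \<and> f (free_gen q) = free_conj S h q
    \<and> f (free_gen r) = free_conj S (h \<otimes>\<^bsub>FG\<^esub> t) r)"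

context
  fixes p q r :: 'a
  assumes pqr: "p \<in> S" "q \<in> S" "r \<in> S" "p \<noteq> q" "q \<noteq> r" "r \<noteq> p"
begin

lemma syllable_append_closed:
  assumes "s \<in> carrier FG" "avoids_hd q s"
  shows "replicate (Suc m) (q, e) @ s \<in> carrier FG"
  unfolding free_carrier_append
  using assms free_replicate_closed[OF pqr(2), of "Suc m" e]
  by (auto simp: avoids_hd_def letter_inv_def prod_eq_iff)

lemma pingpong_start:
  assumes f: "f \<in> auto FG" and fx: "\<And>i. i \<in> S \<Longrightarrow> f (free_gen i) = free_gen i"
  shows "pingpong p q r e (f \<otimes>\<^bsub>AutoGroup FG\<^esub> partial_conj S p q e)"
proof -
  have one: "[] \<in> carrier FG" by (simp add: carrier_free_group)
  have fx': "f (free_gen i) = free_conj S [] i" if "i \<in> S" for i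
    using fx[OF that] that by (simp add: free_conj_Nil)
  note pc = mult_partial_conj[OF pqr(1,2,4) f one one fx'[OF pqr(2)] fx'[OF pqr(1)], where e = e]
  have [simp]: "[] \<otimes>\<^bsub>FG\<^esub> x = x" for x by (simp add: mult_free_group)
  have [simp]: "x \<otimes>\<^bsub>FG\<^esub> [] = x" if "x \<in> carrier FG" for x
    using F.r_one[OF that] by (simp add: one_free_group)
  show ?thesis
    unfolding pingpong_def
    using pc pqr one fx' free_letter_closed[OF pqr(2), of e]
    by (intro exI[of _ "[]"] exI[of _ 0]) (auto simp: free_inv)
qed

text \<open>
  Conjugating by \<open>x\<^sub>q\<close> once more in the same direction slides the axis of \<open>p\<close> one step further along
  the middle axis.
\<close>

lemma pingpong_same:
  assumes f: "f \<in> auto FG" and "pingpong p q r e f"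
  shows "pingpong p q r e (f \<otimes>\<^bsub>AutoGroup FG\<^esub> partial_conj S p q e)"
proof -
  obtain h s t m where st: "h \<in> carrier FG" "s \<in> carrier FG" "t \<in> carrier FG"
    "avoids_hd q s" "avoids_last p s" "avoids_hd q t" "avoids_last r t"
    and fp: "f (free_gen p) = free_conj S (h \<otimes>\<^bsub>FG\<^esub> (replicate (Suc m) (q, e) @ s)) p"
    and fq: "f (free_gen q) = free_conj S h q"
    and fr: "f (free_gen r) = free_conj S (h \<otimes>\<^bsub>FG\<^esub> t) r"
    using assms(2) unfolding pingpong_def by blast
  let ?w = "replicate (Suc m) (q, e) @ s"
  have w: "?w \<in> carrier FG" by (rule syllable_append_closed[OF st(2,4)])
  have qw: "[(q, e)] @ ?w \<in> carrier FG" using syllable_append_closed[OF st(2,4), of "Suc m" e] by simp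
  note c = st(1) w free_letter_closed[OF pqr(2), of e]
  have "h \<otimes>\<^bsub>FG\<^esub> [(q, e)] \<otimes>\<^bsub>FG\<^esub> inv\<^bsub>FG\<^esub> h \<otimes>\<^bsub>FG\<^esub> (h \<otimes>\<^bsub>FG\<^esub> ?w) = h \<otimes>\<^bsub>FG\<^esub> ([(q, e)] \<otimes>\<^bsub>FG\<^esub> ?w)"
    using c by (simp add: F.group_word del: replicate.simps)
  also have "[(q, e)] \<otimes>\<^bsub>FG\<^esub> ?w = replicate (Suc (Suc m)) (q, e) @ s"
    using free_mult_carrier[OF qw] by simp
  finally have eq: "h \<otimes>\<^bsub>FG\<^esub> [(q, e)] \<otimes>\<^bsub>FG\<^esub> inv\<^bsub>FG\<^esub> h \<otimes>\<^bsub>FG\<^esub> (h \<otimes>\<^bsub>FG\<^esub> ?w) = h \<otimes>\<^bsub>FG\<^esub> (replicate (Suc (Suc m)) (q, e) @ s)" .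
  note pc = mult_partial_conj[OF pqr(1,2,4) f st(1) F.m_closed[OF st(1) w] fq fp, where e = e]
  show ?thesis
    unfolding pingpong_def
    using st pc(1)[unfolded eq] pc(2)[OF pqr(2)] pc(2)[OF pqr(3)] pqr fq fr
    by (intro exI[of _ h] exI[of _ s] exI[of _ t] exI[of _ "Suc m"]) simp
qed

text \<open>
  Since the axis of \<open>q\<close> lies between the other two, the axes of \<open>p\<close> and \<open>q\<close> leave the axis of \<open>r\<close> at
  the same vertex. Sliding the axis of \<open>q\<close> by one step along the axis of \<open>r\<close> separates these
  vertices, so that the axis of \<open>r\<close> is the new middle one.
\<close>

lemma pingpong_next:
  assumes f: "f \<in> auto FG" and "pingpong p q r e f"
  shows "pingpong q r p b (f \<otimes>\<^bsub>AutoGroup FG\<^esub> partial_conj S q r b)"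
proof -
  obtain h s t m where st: "h \<in> carrier FG" "s \<in> carrier FG" "t \<in> carrier FG"
    "avoids_hd q s" "avoids_last p s" "avoids_hd q t" "avoids_last r t"
    and fp: "f (free_gen p) = free_conj S (h \<otimes>\<^bsub>FG\<^esub> (replicate (Suc m) (q, e) @ s)) p"
    and fq: "f (free_gen q) = free_conj S h q"
    and fr: "f (free_gen r) = free_conj S (h \<otimes>\<^bsub>FG\<^esub> t) r"
    using assms(2) unfolding pingpong_def by blast
  let ?w = "replicate (Suc m) (q, e) @ s" and ?h = "h \<otimes>\<^bsub>FG\<^esub> t"
  have w: "?w \<in> carrier FG" by (rule syllable_append_closed[OF st(2,4)])
  have ti: "word_inv t \<in> carrier FG" using st(3) by (rule free_word_inv_closed)
  have tw: "word_inv t @ ?w \<in> carrier FG"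
    unfolding free_carrier_append[of "word_inv t"]
    using ti w st(6) by (auto simp: last_word_inv avoids_hd_def letter_inv_def)
  have rt: "[(r, b)] @ word_inv t \<in> carrier FG"
    unfolding free_carrier_append[of "[(r, b)]"]
    using ti st(7) free_letter_closed[OF pqr(3)] by (auto simp: hd_word_inv avoids_last_def letter_inv_def prod_eq_iff)
  have h: "?h \<in> carrier FG" using st by simp
  have inv_t: "inv\<^bsub>FG\<^esub> t = word_inv t" using st(3) by (rule free_inv)
  have eq1: "?h \<otimes>\<^bsub>FG\<^esub> [(r, b)] \<otimes>\<^bsub>FG\<^esub> inv\<^bsub>FG\<^esub> ?h \<otimes>\<^bsub>FG\<^esub> h = ?h \<otimes>\<^bsub>FG\<^esub> (replicate (Suc 0) (r, b) @ word_inv t)"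
  proof -
    have "?h \<otimes>\<^bsub>FG\<^esub> [(r, b)] \<otimes>\<^bsub>FG\<^esub> inv\<^bsub>FG\<^esub> ?h \<otimes>\<^bsub>FG\<^esub> h = ?h \<otimes>\<^bsub>FG\<^esub> ([(r, b)] \<otimes>\<^bsub>FG\<^esub> inv\<^bsub>FG\<^esub> t)"
      using st free_letter_closed[OF pqr(3), of b] by (simp add: F.group_word)
    then show ?thesis using free_mult_carrier[OF rt] by (simp add: inv_t)
  qed
  have eq2: "h \<otimes>\<^bsub>FG\<^esub> ?w = ?h \<otimes>\<^bsub>FG\<^esub> (word_inv t @ ?w)"
  proof -
    have "?h \<otimes>\<^bsub>FG\<^esub> (inv\<^bsub>FG\<^esub> t \<otimes>\<^bsub>FG\<^esub> ?w) = h \<otimes>\<^bsub>FG\<^esub> ?w"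
      using st w by (simp add: F.group_word del: replicate.simps)
    then show ?thesis using free_mult_carrier[OF tw] by (simp only: inv_t)
  qed
  have av: "avoids_hd r (word_inv t @ ?w)" "avoids_last p (word_inv t @ ?w)"
    using st pqr by (auto simp: avoids_hd_append avoids_last_append avoids_replicate simp del: replicate.simps)
  note pc = mult_partial_conj[OF pqr(2,3,5) f h st(1) fr fq, where e = b]
  show ?thesis
    unfolding pingpong_def
    using st h ti tw av pc(1)[unfolded eq1] pc(2)[OF pqr(3)] pc(2)[OF pqr(1)] pqr fp[unfolded eq2] fr
    by (intro exI[of _ ?h] exI[of _ "word_inv t"] exI[of _ "word_inv t @ ?w"] exI[of _ 0]) (simp del: append.simps replicate.simps)
qed

text \<open>
  The same with the axis of \<open>p\<close> in the role of the fixed axis and the axis of \<open>r\<close> being moved. The axis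
  of \<open>q\<close> leaves that of \<open>p\<close> at the vertex where the path \<open>s\<close> arrives; the powers of \<open>x\<^sub>q\<close>
  at the end of its conjugating word are absorbed by \<open>free_conj_replicate\<close>.
\<close>

lemma pingpong_prev:
  assumes f: "f \<in> auto FG" and "pingpong p q r e f"
  shows "pingpong r p q b (f \<otimes>\<^bsub>AutoGroup FG\<^esub> partial_conj S r p b)"
proof -
  obtain h s t m where st: "h \<in> carrier FG" "s \<in> carrier FG" "t \<in> carrier FG"
    "avoids_hd q s" "avoids_last p s" "avoids_hd q t" "avoids_last r t"
    and fp: "f (free_gen p) = free_conj S (h \<otimes>\<^bsub>FG\<^esub> (replicate (Suc m) (q, e) @ s)) p"
    and fq: "f (free_gen q) = free_conj S h q"
    and fr: "f (free_gen r) = free_conj S (h \<otimes>\<^bsub>FG\<^esub> t) r"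
    using assms(2) unfolding pingpong_def by blast
  let ?w = "replicate (Suc m) (q, e) @ s"
  let ?h = "h \<otimes>\<^bsub>FG\<^esub> ?w"
  have w: "?w \<in> carrier FG" by (rule syllable_append_closed[OF st(2,4)])
  have h: "?h \<in> carrier FG" using st w by blast
  have wi: "word_inv ?w \<in> carrier FG" and si: "word_inv s \<in> carrier FG"
    using w st(2) by (auto intro: free_word_inv_closed simp del: word_inv_simps replicate.simps)
  have wi_eq: "word_inv ?w = word_inv s @ replicate (Suc m) (q, \<not> e)"
    by (simp only: word_inv_simps word_inv_replicate) (simp add: letter_inv_def)
  have wt: "word_inv ?w @ t \<in> carrier FG"
    unfolding free_carrier_append[of "word_inv ?w"]
    using wi st(3,6) by (auto simp: wi_eq avoids_hd_def letter_inv_def prod_eq_iff simp del: replicate.simps)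
  have av: "avoids_hd p (word_inv ?w @ t)" "avoids_last r (word_inv ?w @ t)"
    using st pqr by (auto simp: wi_eq avoids_hd_append avoids_last_append avoids_replicate simp del: replicate.simps word_inv_simps(2))
  have pw: "[(p, b)] @ (word_inv ?w @ t) \<in> carrier FG"
    unfolding free_carrier_append[of "[(p, b)]"]
    using wt av(1) free_letter_closed[OF pqr(1)] by (auto simp: avoids_hd_def letter_inv_def prod_eq_iff)
  have inv_w: "inv\<^bsub>FG\<^esub> ?w = word_inv ?w" using w by (rule free_inv)
  have eq1: "?h \<otimes>\<^bsub>FG\<^esub> [(p, b)] \<otimes>\<^bsub>FG\<^esub> inv\<^bsub>FG\<^esub> ?h \<otimes>\<^bsub>FG\<^esub> (h \<otimes>\<^bsub>FG\<^esub> t) = ?h \<otimes>\<^bsub>FG\<^esub> (replicate (Suc 0) (p, b) @ (word_inv ?w @ t))"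
  proof -
    have "?h \<otimes>\<^bsub>FG\<^esub> [(p, b)] \<otimes>\<^bsub>FG\<^esub> inv\<^bsub>FG\<^esub> ?h \<otimes>\<^bsub>FG\<^esub> (h \<otimes>\<^bsub>FG\<^esub> t) = ?h \<otimes>\<^bsub>FG\<^esub> ([(p, b)] \<otimes>\<^bsub>FG\<^esub> (inv\<^bsub>FG\<^esub> ?w \<otimes>\<^bsub>FG\<^esub> t))"
      using st w free_letter_closed[OF pqr(1), of b] by (simp add: F.group_word del: replicate.simps)
    also have "inv\<^bsub>FG\<^esub> ?w \<otimes>\<^bsub>FG\<^esub> t = word_inv ?w @ t" using free_mult_carrier[OF wt] by (simp only: inv_w)
    also have "[(p, b)] \<otimes>\<^bsub>FG\<^esub> (word_inv ?w @ t) = replicate (Suc 0) (p, b) @ (word_inv ?w @ t)"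
      using free_mult_carrier[OF pw] by simp
    finally show ?thesis .
  qed
  have eq2: "free_conj S h q = free_conj S (?h \<otimes>\<^bsub>FG\<^esub> word_inv s) q"
  proof -
    have r: "replicate (Suc m) (q, e) \<in> carrier FG" using free_replicate_closed[OF pqr(2)] .
    have "?w = replicate (Suc m) (q, e) \<otimes>\<^bsub>FG\<^esub> s" using free_mult_carrier[OF w] by simp
    then have "?h \<otimes>\<^bsub>FG\<^esub> inv\<^bsub>FG\<^esub> s = h \<otimes>\<^bsub>FG\<^esub> replicate (Suc m) (q, e)"
      using r st by (simp add: F.group_word del: replicate.simps append.simps)
    then show ?thesis using free_conj_replicate[OF pqr(2) st(1), of "Suc m" e] free_inv[OF st(2)] by simp
  qed
  have ht: "h \<otimes>\<^bsub>FG\<^esub> t \<in> carrier FG" using st by simp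
  note pc = mult_partial_conj[OF pqr(3,1,6) f h ht fp fr, where e = b]
  show ?thesis
    unfolding pingpong_def
    using st h si wt av pc(1)[unfolded eq1] pc(2)[OF pqr(1)] pc(2)[OF pqr(2)] pqr fp fq[unfolded eq2]
    by (intro exI[of _ ?h] exI[of _ "word_inv ?w @ t"] exI[of _ "word_inv s"] exI[of _ 0])
      (simp del: append.simps replicate.simps word_inv_simps add: avoids_word_inv)
qed

text \<open>
  For an inner automorphism the three axes are a common translate of the axes of the generators, which
  meet in one vertex.
\<close>

lemma pingpong_not_inner:
  assumes "pingpong p q r e f" and g: "g \<in> carrier FG"
    and "\<And>i. i \<in> {p, q, r} \<Longrightarrow> f (free_gen i) = free_conj S g i"
  shows False
proof -
  obtain h s t m where st: "h \<in> carrier FG" "s \<in> carrier FG" "t \<in> carrier FG"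
    "avoids_hd q s" "avoids_last p s" "avoids_hd q t" "avoids_last r t"
    and fp: "f (free_gen p) = free_conj S (h \<otimes>\<^bsub>FG\<^esub> (replicate (Suc m) (q, e) @ s)) p"
    and fq: "f (free_gen q) = free_conj S h q"
    and fr: "f (free_gen r) = free_conj S (h \<otimes>\<^bsub>FG\<^esub> t) r"
    using assms(1) unfolding pingpong_def by blast
  let ?w = "replicate (Suc m) (q, e) @ s"
  have w: "?w \<in> carrier FG" by (rule syllable_append_closed[OF st(2,4)])
  have one: "[] \<in> carrier FG" by (simp add: carrier_free_group)
  define y where "y = inv\<^bsub>FG\<^esub> h \<otimes>\<^bsub>FG\<^esub> g"
  have y: "y \<in> carrier FG" using st(1) g by (simp add: y_def)
  have cancel: "free_conj S y i = free_conj S v i"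
    if "i \<in> S" "v \<in> carrier FG" "free_conj S g i = free_conj S (h \<otimes>\<^bsub>FG\<^esub> v) i" for i v
  proof -
    have "free_conj S y i = inv\<^bsub>FG\<^esub> h \<otimes>\<^bsub>FG\<^esub> free_conj S (h \<otimes>\<^bsub>FG\<^esub> v) i \<otimes>\<^bsub>FG\<^esub> inv\<^bsub>FG\<^esub> (inv\<^bsub>FG\<^esub> h)"
      using free_conj_mult[of "inv\<^bsub>FG\<^esub> h" g i] that st(1) g by (simp add: y_def)
    also have "\<dots> = free_conj S (inv\<^bsub>FG\<^esub> h \<otimes>\<^bsub>FG\<^esub> (h \<otimes>\<^bsub>FG\<^esub> v)) i"
      using that st(1) by (intro free_conj_mult) auto
    finally show ?thesis using that(2) st(1) by (simp add: F.group_word)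
  qed
  have "h = h \<otimes>\<^bsub>FG\<^esub> []" using F.r_one[OF st(1)] by (simp add: one_free_group)
  then have yq: "free_conj S y q = free_conj S [] q"
    using cancel[OF pqr(2) one] fq assms(3)[of q] by simp
  have yp: "free_conj S y p = free_conj S ?w p" using cancel[OF pqr(1) w] fp assms(3)[of p] by simp
  have yr: "free_conj S y r = free_conj S t r" using cancel[OF pqr(3) st(3)] fr assms(3)[of r] by simp
  have "reduced y" using y by (simp add: carrier_free_group)
  then obtain v n b where v: "y = v @ replicate n (q, b)" "avoids_last q v"
    using strip_last[of y q] by metis
  have vc: "v \<in> carrier FG" using y v(1) by (simp add: free_carrier_append)
  have "free_conj S v q = free_conj S y q"
    using free_conj_replicate[OF pqr(2) vc, of n b] free_mult_carrier[of v "replicate n (q, b)"] y v(1) by simp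
  then have "v @ (q, True) # word_inv v = [] @ (q, True) # word_inv []"
    using yq free_conj_word[OF vc v(2)] free_conj_word[OF one, of q] by simp
  then have "v = []" by (rule conj_word_inj)
  then have y_rep: "y = replicate n (q, b)" using v by simp
  then have "avoids_last r y" "avoids_last p y" using pqr by (auto simp: avoids_last_def)
  then have "y @ (r, True) # word_inv y = t @ (r, True) # word_inv t"
    using yr free_conj_word[OF y] free_conj_word[OF st(3,7)] by simp
  then have "y = t" by (rule conj_word_inj)
  then have "y = []" using st(6) y_rep by (cases n) (auto simp: avoids_hd_def)
  have "avoids_last p ?w" using st(5) pqr by (auto simp: avoids_last_append avoids_replicate simp del: replicate.simps)
  then have "y @ (p, True) # word_inv y = ?w @ (p, True) # word_inv ?w"
    using yp free_conj_word[OF y \<open>avoids_last p y\<close>] free_conj_word[OF w] by (simp only:)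
  then have "y = ?w" by (rule conj_word_inj)
  then show False using \<open>y = []\<close> by simp
qed

end

end

section \<open>The outer McCool group on three generators is free\<close>

locale three_generators =
  fixes i j k :: 'a
  assumes ijk: "i \<noteq> j" "j \<noteq> k" "k \<noteq> i"
begin

abbreviation "S \<equiv> {i, j, k}"
abbreviation "F3 \<equiv> free_group S"
abbreviation "AG \<equiv> AutoGroup F3"

definition succ :: "'a \<Rightarrow> 'a"
  where "succ p = (if p = i then j else if p = j then k else i)"

lemma succ_cyc:
  assumes "p \<in> S"
  shows "p \<in> S" "succ p \<in> S" "succ (succ p) \<in> S" "p \<noteq> succ p" "succ p \<noteq> succ (succ p)" "succ (succ p) \<noteq> p"
    "succ (succ (succ p)) = p"
  using assms ijk by (auto simp: succ_def)

lemma succ_cases: "p \<in> S \<Longrightarrow> q \<in> S \<Longrightarrow> q = p \<or> q = succ p \<or> q = succ (succ p)"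
  using ijk by (auto simp: succ_def)

sublocale F: group F3 by (rule group_free_group)
sublocale A: group AG by (rule F.AutoGroup)

text \<open>
  The free group on \<open>i, j, k\<close> does double duty: besides being acted upon, it is the abstract free group
  whose generator \<open>p\<close> stands for the partial conjugation of \<open>x\<^sub>p\<close> by its cyclic successor.
\<close>

definition cyc_aut :: "'a word \<Rightarrow> 'a word \<Rightarrow> 'a word"
  where "cyc_aut = free_lift S AG (\<lambda>p. partial_conj S p (succ p) True)"

lemma cyc_aut_hom: "cyc_aut \<in> hom F3 AG"
  and cyc_aut_gen: "p \<in> S \<Longrightarrow> cyc_aut (free_gen p) = partial_conj S p (succ p) True"
proof -
  have *: "(\<lambda>p. partial_conj S p (succ p) True) \<in> S \<rightarrow> carrier AG"
    using partial_conj_auto[OF succ_cyc(1,2,4)] by (auto simp: F.carrier_AutoGroup)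
  show "cyc_aut \<in> hom F3 AG" "p \<in> S \<Longrightarrow> cyc_aut (free_gen p) = partial_conj S p (succ p) True"
    using A.free_lift[OF *] by (simp_all add: cyc_aut_def)
qed

sublocale W: group_hom F3 AG cyc_aut
  using cyc_aut_hom by unfold_locales

lemma cyc_aut_auto: "u \<in> carrier F3 \<Longrightarrow> cyc_aut u \<in> auto F3"
  using W.hom_closed by (simp add: F.carrier_AutoGroup)

lemma cyc_aut_letter: "p \<in> S \<Longrightarrow> cyc_aut [(p, e)] = partial_conj S p (succ p) e"
proof (cases e)
  case False
  assume p: "p \<in> S"
  have "cyc_aut (inv\<^bsub>F3\<^esub> (free_gen p)) = inv\<^bsub>AG\<^esub> (cyc_aut (free_gen p))"
    using free_gen_closed[OF p] by simp
  then show ?thesis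
    using False inv_free_gen[OF p] partial_conj_inv[OF succ_cyc(1,2,4)[OF p], of True] cyc_aut_gen[OF p] by simp
qed (use cyc_aut_gen in \<open>simp add: free_gen_def\<close>)

text \<open>
  Induction on the word: each letter either repeats the last one or is conjugation by one of the two
  outer axes, and reducedness excludes undoing the last letter.
\<close>

lemma pingpong_word:
  "u @ [(p, e)] \<in> carrier F3 \<Longrightarrow> pingpong S p (succ p) (succ (succ p)) e (cyc_aut (u @ [(p, e)]))"
proof (induction u arbitrary: p e rule: rev_induct)
  case Nil
  then have p: "p \<in> S" by (simp add: carrier_free_group)
  have "cyc_aut [(p, e)] = \<one>\<^bsub>AG\<^esub> \<otimes>\<^bsub>AG\<^esub> partial_conj S p (succ p) e"
    using p A.l_one partial_conj_auto[OF succ_cyc(1,2,4)[OF p], of e]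
    by (simp add: cyc_aut_letter F.carrier_AutoGroup)
  moreover have "\<one>\<^bsub>AG\<^esub> \<in> auto F3" using A.one_closed by (simp add: F.carrier_AutoGroup)
  ultimately show ?case
    using pingpong_start[OF succ_cyc(1-6)[OF p]] by (simp add: F.AutoGroup_one free_gen_closed)
next
  case (snoc a u)
  obtain q b where a: "a = (q, b)" by (cases a)
  have u: "u @ [(q, b)] \<in> carrier F3" and pe: "[(p, e)] \<in> carrier F3" and ne: "(p, e) \<noteq> letter_inv (q, b)"
    using snoc.prems a unfolding free_carrier_append[of "u @ [a]"] by auto
  have p: "p \<in> S" and q: "q \<in> S" using u pe by (auto simp: carrier_free_group)
  define f where "f = cyc_aut (u @ [(q, b)])"
  have f: "f \<in> auto F3" using cyc_aut_auto[OF u] by (simp add: f_def)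
  have IH: "pingpong S q (succ q) (succ (succ q)) b f" using snoc.IH[OF u] by (simp add: f_def)
  have "cyc_aut ((u @ [a]) @ [(p, e)]) = f \<otimes>\<^bsub>AG\<^esub> partial_conj S p (succ p) e"
    using W.hom_mult[OF u pe] free_mult_carrier[of "u @ [(q, b)]" "[(p, e)]" S] snoc.prems
    by (simp add: a f_def cyc_aut_letter[OF p])
  moreover have "pingpong S p (succ p) (succ (succ p)) e (f \<otimes>\<^bsub>AG\<^esub> partial_conj S p (succ p) e)"
    using succ_cases[OF q p]
  proof (elim disjE)
    assume "p = q"
    moreover from this have "e = b" using ne by (auto simp: letter_inv_def)
    ultimately show ?thesis using pingpong_same[OF succ_cyc(1-6)[OF q] f IH] by simp
  next
    assume "p = succ q"
    then show ?thesis using pingpong_next[OF succ_cyc(1-6)[OF q] f IH, of e] succ_cyc(7)[OF q] by simp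
  next
    assume "p = succ (succ q)"
    then show ?thesis using pingpong_prev[OF succ_cyc(1-6)[OF q] f IH, of e] succ_cyc(7)[OF q] by simp
  qed
  ultimately show ?case by simp
qed

lemma cyc_aut_inner_imp_one:
  assumes u: "u \<in> carrier F3" and g: "g \<in> carrier F3" and "cyc_aut u = inner_aut F3 g"
  shows "u = []"
proof (rule ccontr)
  assume "u \<noteq> []"
  then obtain v p e where v: "u = v @ [(p, e)]" by (metis rev_exhaust surj_pair)
  then have p: "p \<in> S" using u by (simp add: carrier_free_group)
  have "cyc_aut u (free_gen q) = free_conj S g q" if "q \<in> {p, succ p, succ (succ p)}" for q
  proof -
    have "{p, succ p, succ (succ p)} \<subseteq> S"
      using succ_cyc(1-3)[OF p] by (simp only: insert_subset empty_subsetI simp_thms)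
    from subsetD[OF this that] show ?thesis by (simp only: assms(3) inner_aut_free_gen)
  qed
  then show False
    using pingpong_not_inner[OF succ_cyc(1-6)[OF p] pingpong_word g] u v by blast
qed

lemma inner_aut_mult:
  "g \<in> carrier F3 \<Longrightarrow> h \<in> carrier F3 \<Longrightarrow> inner_aut F3 g \<otimes>\<^bsub>AG\<^esub> inner_aut F3 h = inner_aut F3 (g \<otimes>\<^bsub>F3\<^esub> h)"
proof (rule F.auto_eqI)
  assume g: "g \<in> carrier F3" and h: "h \<in> carrier F3"
  note i = F.inner_aut_auto[OF g] F.inner_aut_auto[OF h]
  show "inner_aut F3 g \<otimes>\<^bsub>AG\<^esub> inner_aut F3 h \<in> auto F3"
    using A.m_closed i by (simp add: F.carrier_AutoGroup)
  show "inner_aut F3 (g \<otimes>\<^bsub>F3\<^esub> h) \<in> auto F3" using g h by (intro F.inner_aut_auto) simp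
  fix w assume "w \<in> carrier F3"
  then show "(inner_aut F3 g \<otimes>\<^bsub>AG\<^esub> inner_aut F3 h) w = inner_aut F3 (g \<otimes>\<^bsub>F3\<^esub> h) w"
    using g h by (simp add: F.AutoGroup_mult i) (simp add: inner_aut_def F.group_word)
qed

lemma aut_inner_aut:
  assumes f: "f \<in> auto F3" and g: "g \<in> carrier F3"
  shows "f \<otimes>\<^bsub>AG\<^esub> inner_aut F3 g = inner_aut F3 (f g) \<otimes>\<^bsub>AG\<^esub> f"
proof (rule F.auto_eqI)
  interpret f: group_hom F3 F3 f using F.auto_group_hom[OF f] .
  have i: "inner_aut F3 g \<in> auto F3" "inner_aut F3 (f g) \<in> auto F3"
    using g by (auto intro: F.inner_aut_auto)
  show "f \<otimes>\<^bsub>AG\<^esub> inner_aut F3 g \<in> auto F3" "inner_aut F3 (f g) \<otimes>\<^bsub>AG\<^esub> f \<in> auto F3"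
    using A.m_closed f i by (auto simp: F.carrier_AutoGroup)
  fix w assume "w \<in> carrier F3"
  then show "(f \<otimes>\<^bsub>AG\<^esub> inner_aut F3 g) w = (inner_aut F3 (f g) \<otimes>\<^bsub>AG\<^esub> f) w"
    using f i g by (simp add: F.AutoGroup_mult inner_aut_def)
qed

lemma inner_aut_inv: "g \<in> carrier F3 \<Longrightarrow> inv\<^bsub>AG\<^esub> (inner_aut F3 g) = inner_aut F3 (inv\<^bsub>F3\<^esub> g)"
proof (rule A.inv_equality)
  assume g: "g \<in> carrier F3"
  show "inner_aut F3 (inv\<^bsub>F3\<^esub> g) \<otimes>\<^bsub>AG\<^esub> inner_aut F3 g = \<one>\<^bsub>AG\<^esub>"
    using g by (simp add: inner_aut_mult) (simp add: inner_aut_def AutoGroup_def BijGroup_def restrict_def fun_eq_iff)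
qed (auto simp: F.carrier_AutoGroup F.inner_aut_auto)

definition outer_class :: "('a word \<Rightarrow> 'a word) \<Rightarrow> 'a word \<Rightarrow> bool"
  where "outer_class f u \<longleftrightarrow> u \<in> carrier F3 \<and> (\<exists>g\<in>carrier F3. f = inner_aut F3 g \<otimes>\<^bsub>AG\<^esub> cyc_aut u)"

lemma outer_class_mult:
  assumes "outer_class f u" "outer_class f' u'"
  shows "outer_class (f \<otimes>\<^bsub>AG\<^esub> f') (u \<otimes>\<^bsub>F3\<^esub> u')"
proof -
  obtain g g' where g: "g \<in> carrier F3" "f = inner_aut F3 g \<otimes>\<^bsub>AG\<^esub> cyc_aut u"
    and g': "g' \<in> carrier F3" "f' = inner_aut F3 g' \<otimes>\<^bsub>AG\<^esub> cyc_aut u'" and u: "u \<in> carrier F3" "u' \<in> carrier F3"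
    using assms unfolding outer_class_def by blast
  let ?h = "cyc_aut u g'"
  have h: "?h \<in> carrier F3" using F.auto_closed[OF cyc_aut_auto[OF u(1)] g'(1)] .
  have c: "inner_aut F3 g \<in> carrier AG" "inner_aut F3 g' \<in> carrier AG" "inner_aut F3 ?h \<in> carrier AG"
    using g g' h by (simp_all add: F.carrier_AutoGroup F.inner_aut_auto)
  have "f \<otimes>\<^bsub>AG\<^esub> f' = inner_aut F3 g \<otimes>\<^bsub>AG\<^esub> (cyc_aut u \<otimes>\<^bsub>AG\<^esub> inner_aut F3 g') \<otimes>\<^bsub>AG\<^esub> cyc_aut u'"
    using g g' u c by (simp add: A.m_assoc)
  also have "cyc_aut u \<otimes>\<^bsub>AG\<^esub> inner_aut F3 g' = inner_aut F3 ?h \<otimes>\<^bsub>AG\<^esub> cyc_aut u"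
    by (rule aut_inner_aut[OF cyc_aut_auto[OF u(1)] g'(1)])
  also have "inner_aut F3 g \<otimes>\<^bsub>AG\<^esub> (inner_aut F3 ?h \<otimes>\<^bsub>AG\<^esub> cyc_aut u) \<otimes>\<^bsub>AG\<^esub> cyc_aut u' =
      inner_aut F3 (g \<otimes>\<^bsub>F3\<^esub> ?h) \<otimes>\<^bsub>AG\<^esub> cyc_aut (u \<otimes>\<^bsub>F3\<^esub> u')"
    using u c g h by (simp add: A.m_assoc inner_aut_mult[symmetric])
  finally show ?thesis using u g h unfolding outer_class_def by blast
qed

lemma outer_class_inv:
  assumes "outer_class f u"
  shows "outer_class (inv\<^bsub>AG\<^esub> f) (inv\<^bsub>F3\<^esub> u)"
proof -
  obtain g where g: "g \<in> carrier F3" "f = inner_aut F3 g \<otimes>\<^bsub>AG\<^esub> cyc_aut u" and u: "u \<in> carrier F3"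
    using assms unfolding outer_class_def by blast
  let ?h = "cyc_aut (inv\<^bsub>F3\<^esub> u) (inv\<^bsub>F3\<^esub> g)"
  have h: "?h \<in> carrier F3" using F.auto_closed[OF cyc_aut_auto[OF F.inv_closed[OF u]] F.inv_closed[OF g(1)]] .
  have "inv\<^bsub>AG\<^esub> f = cyc_aut (inv\<^bsub>F3\<^esub> u) \<otimes>\<^bsub>AG\<^esub> inner_aut F3 (inv\<^bsub>F3\<^esub> g)"
    using u g F.inner_aut_auto[OF g(1)] by (simp add: A.inv_mult_group inner_aut_inv F.carrier_AutoGroup[symmetric])
  also have "\<dots> = inner_aut F3 ?h \<otimes>\<^bsub>AG\<^esub> cyc_aut (inv\<^bsub>F3\<^esub> u)"
    by (rule aut_inner_aut[OF cyc_aut_auto[OF F.inv_closed[OF u]] F.inv_closed[OF g(1)]])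
  finally show ?thesis using u h unfolding outer_class_def by blast
qed

lemma outer_class_unique:
  assumes "outer_class f u" "outer_class f v"
  shows "u = v"
proof -
  have u: "u \<in> carrier F3" and v: "v \<in> carrier F3" using assms by (auto simp: outer_class_def)
  have f: "f \<in> carrier AG" using assms(1) F.inner_aut_auto by (auto simp: outer_class_def F.carrier_AutoGroup[symmetric])
  have "outer_class (f \<otimes>\<^bsub>AG\<^esub> inv\<^bsub>AG\<^esub> f) (u \<otimes>\<^bsub>F3\<^esub> inv\<^bsub>F3\<^esub> v)"
    by (intro outer_class_mult outer_class_inv assms)
  then obtain g where g: "g \<in> carrier F3" "\<one>\<^bsub>AG\<^esub> = inner_aut F3 g \<otimes>\<^bsub>AG\<^esub> cyc_aut (u \<otimes>\<^bsub>F3\<^esub> inv\<^bsub>F3\<^esub> v)"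
    using f by (auto simp: outer_class_def)
  let ?i = "inner_aut F3 g" and ?w = "u \<otimes>\<^bsub>F3\<^esub> inv\<^bsub>F3\<^esub> v"
  have i: "?i \<in> carrier AG" using F.inner_aut_auto[OF g(1)] by (simp add: F.carrier_AutoGroup)
  have w: "?w \<in> carrier F3" using u v by simp
  have "cyc_aut ?w = inv\<^bsub>AG\<^esub> ?i \<otimes>\<^bsub>AG\<^esub> (?i \<otimes>\<^bsub>AG\<^esub> cyc_aut ?w)"
    using A.inv_mult_cancel(1)[OF i W.hom_closed[OF w]] by simp
  also have "\<dots> = inner_aut F3 (inv\<^bsub>F3\<^esub> g)" using A.inv_closed[OF i] by (simp add: g(2)[symmetric] inner_aut_inv[OF g(1), symmetric])
  finally have "?w = []" using cyc_aut_inner_imp_one[OF w F.inv_closed[OF g(1)]] by blast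
  then have "?w = \<one>\<^bsub>F3\<^esub>" by (simp add: one_free_group)
  then show ?thesis using F.inv_equality[OF _ F.inv_closed[OF v] u] v by simp
qed

lemma outer_class_inner: "g \<in> carrier F3 \<Longrightarrow> outer_class (inner_aut F3 g) \<one>\<^bsub>F3\<^esub>"
  unfolding outer_class_def using F.inner_aut_auto[of g]
  by (auto simp: F.carrier_AutoGroup[symmetric] intro!: bexI[of _ g])

lemma outer_class_gen:
  assumes "p \<in> S"
  shows "outer_class (partial_conj S p (succ p) True) (free_gen p)"
proof -
  have "inner_aut F3 \<one>\<^bsub>F3\<^esub> \<otimes>\<^bsub>AG\<^esub> cyc_aut (free_gen p) = cyc_aut (free_gen p)"
  proof -
    have "inner_aut F3 \<one>\<^bsub>F3\<^esub> = \<one>\<^bsub>AG\<^esub>"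
      by (simp add: inner_aut_def AutoGroup_def BijGroup_def restrict_def fun_eq_iff)
    then show ?thesis using free_gen_closed[OF assms] by simp
  qed
  then show ?thesis
    using assms free_gen_closed[OF assms] cyc_aut_gen[OF assms] unfolding outer_class_def by (metis F.one_closed)
qed

text \<open>
  This identity expresses the three remaining partial conjugations through \<open>a, b, c\<close> and inner
  automorphisms.
\<close>

lemma inner_gen_eq:
  assumes "p \<in> S"
  defines "q \<equiv> succ p" and "r \<equiv> succ (succ p)"
  shows "inner_aut F3 (free_gen r) = partial_conj S p r True \<otimes>\<^bsub>AG\<^esub> partial_conj S q r True"
proof -
  note cyc = succ_cyc[OF assms(1), folded q_def r_def]
  have pr: "p \<noteq> r" using cyc by auto
  note a = partial_conj_auto[OF cyc(1,3) pr, of True] and b = partial_conj_auto[OF cyc(2,3,5), of True]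
  show ?thesis
  proof (rule auto_free_eqI)
    show "inner_aut F3 (free_gen r) \<in> auto F3" using F.inner_aut_auto[OF free_gen_closed[OF cyc(3)]] .
    show "partial_conj S p r True \<otimes>\<^bsub>AG\<^esub> partial_conj S q r True \<in> auto F3"
      using A.m_closed a b by (simp add: F.carrier_AutoGroup)
    fix x assume x: "x \<in> S"
    interpret a: group_hom F3 F3 "partial_conj S p r True" using F.auto_group_hom[OF a] .
    note [simp] = partial_conj_hom(3)[OF cyc(1,3)] partial_conj_hom(3)[OF cyc(2,3)]
      partial_conj_letter[OF cyc(1,3) pr] free_letter_closed[OF cyc(3)] free_gen_closed
    have rr: "free_conj S [(r, True)] r = free_gen r"
      using free_conj_replicate[OF cyc(3), of "[]" 1 True] free_conj_Nil[OF cyc(3)]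
      by (simp add: carrier_free_group mult_free_group)
    have "x = p \<or> x = q \<or> x = r" using succ_cases[OF assms(1) x] by (auto simp: q_def r_def)
    then show "inner_aut F3 (free_gen r) (free_gen x) = (partial_conj S p r True \<otimes>\<^bsub>AG\<^esub> partial_conj S q r True) (free_gen x)"
    proof (cases "x = r")
      case True
      have "inner_aut F3 (free_gen r) (free_gen r) = free_gen r"
        using rr cyc(3) by (simp only: inner_aut_free_gen) (simp only: free_gen_def)
      then show ?thesis using True cyc pr by (simp add: F.AutoGroup_mult[OF a b])
    next
      case False
      with \<open>x = p \<or> x = q \<or> x = r\<close> show ?thesis
        using cyc x pr
        by (elim disjE) (simp_all add: F.AutoGroup_mult[OF a b] inner_aut_free_gen free_conj_def free_gen_def[of r])
    qed
  qed
qed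

theorem outer_class_exists:
  assumes "f \<in> mccool S"
  shows "\<exists>u. outer_class f u"
proof -
  let ?H = "{f. \<exists>u. outer_class f u}"
  have "subgroup ?H AG"
  proof (rule A.subgroupI)
    show "?H \<subseteq> carrier AG"
      using F.inner_aut_auto by (auto simp: outer_class_def F.carrier_AutoGroup[symmetric])
    show "?H \<noteq> {}" using outer_class_inner[OF F.one_closed] by blast
  qed (use outer_class_inv outer_class_mult in blast)+
  moreover have "partial_conj S p q True \<in> ?H" if "p \<in> S" "q \<in> S" "p \<noteq> q" for p q
  proof (cases "q = succ p")
    case True
    then show ?thesis using outer_class_gen[OF that(1)] by blast
  next
    case False
    then have q: "q = succ (succ p)" using succ_cases[OF that(1,2)] that by blast
    note cyc = succ_cyc[OF that(1)]
    have c: "partial_conj S p q True \<in> carrier AG" "partial_conj S (succ p) q True \<in> carrier AG"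
      using partial_conj_auto[OF that] partial_conj_auto[OF cyc(2,3,5)] q by (auto simp: F.carrier_AutoGroup)
    have "outer_class (inner_aut F3 (free_gen q) \<otimes>\<^bsub>AG\<^esub> inv\<^bsub>AG\<^esub> (partial_conj S (succ p) q True)) (\<one>\<^bsub>F3\<^esub> \<otimes>\<^bsub>F3\<^esub> inv\<^bsub>F3\<^esub> (free_gen (succ p)))"
      using outer_class_gen[OF cyc(2)] q free_gen_closed[OF that(2)] by (intro outer_class_mult outer_class_inv outer_class_inner) auto
    moreover have "inner_aut F3 (free_gen q) \<otimes>\<^bsub>AG\<^esub> inv\<^bsub>AG\<^esub> (partial_conj S (succ p) q True) = partial_conj S p q True"
      using inner_gen_eq[OF that(1)] q c by (simp add: A.m_assoc)
    ultimately show ?thesis by auto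
  qed
  ultimately have "mccool S \<subseteq> ?H" by (intro mccool_generated) auto
  then show ?thesis using assms by blast
qed

definition outer_word :: "('a word \<Rightarrow> 'a word) \<Rightarrow> 'a word"
  where "outer_word f = (THE u. outer_class f u)"

lemma outer_word_eq: "outer_class f u \<Longrightarrow> outer_word f = u"
  unfolding outer_word_def using outer_class_unique by blast

theorem outer_word_hom: "outer_word \<in> hom (mccool_group S) F3"
proof (rule homI)
  fix f g assume "f \<in> carrier (mccool_group S)" "g \<in> carrier (mccool_group S)"
  then obtain u v where "outer_class f u" "outer_class g v"
    using outer_class_exists[of f] outer_class_exists[of g] by (auto simp: mccool_group_def)
  then show "outer_word (f \<otimes>\<^bsub>mccool_group S\<^esub> g) = outer_word f \<otimes>\<^bsub>F3\<^esub> outer_word g"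
    using outer_word_eq outer_class_mult by (simp add: mccool_group_def)
next
  fix f assume "f \<in> carrier (mccool_group S)"
  then show "outer_word f \<in> carrier F3"
    using outer_class_exists outer_word_eq by (fastforce simp: mccool_group_def outer_class_def)
qed

end

section \<open>Restriction to fewer generators\<close>

definition free_proj :: "'a set \<Rightarrow> 'a set \<Rightarrow> 'a word \<Rightarrow> 'a word"
  where "free_proj S T = free_lift S (free_group T) (\<lambda>i. if i \<in> T then free_gen i else \<one>\<^bsub>free_group T\<^esub>)"

definition restrict_aut :: "'a set \<Rightarrow> 'a set \<Rightarrow> ('a word \<Rightarrow> 'a word) \<Rightarrow> 'a word \<Rightarrow> 'a word"
  where "restrict_aut S T f = (\<lambda>w\<in>carrier (free_group T). free_proj S T (f w))"

context
  fixes S T :: "'a set"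
  assumes TS: "T \<subseteq> S"
begin

interpretation F: group "free_group S" by (rule group_free_group)
interpretation FT: group "free_group T" by (rule group_free_group)
interpretation A: group "AutoGroup (free_group S)" by (rule F.AutoGroup)

lemma free_group_mono: "w \<in> carrier (free_group T) \<Longrightarrow> w \<in> carrier (free_group S)"
  using TS by (auto simp: carrier_free_group)

lemma free_proj_hom: "free_proj S T \<in> hom (free_group S) (free_group T)"
  and free_proj_gen: "i \<in> S \<Longrightarrow> free_proj S T (free_gen i) = (if i \<in> T then free_gen i else \<one>\<^bsub>free_group T\<^esub>)"
proof -
  have *: "(\<lambda>i. if i \<in> T then free_gen i else \<one>\<^bsub>free_group T\<^esub>) \<in> S \<rightarrow> carrier (free_group T)"
    by (auto simp: free_gen_closed)
  show "free_proj S T \<in> hom (free_group S) (free_group T)"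
    "i \<in> S \<Longrightarrow> free_proj S T (free_gen i) = (if i \<in> T then free_gen i else \<one>\<^bsub>free_group T\<^esub>)"
    using FT.free_lift[OF *] by (simp_all add: free_proj_def)
qed

interpretation p: group_hom "free_group S" "free_group T" "free_proj S T"
  using free_proj_hom by unfold_locales

lemma free_proj_id:
  assumes "w \<in> carrier (free_group T)"
  shows "free_proj S T w = w"
proof -
  have "free_proj S T w = (\<lambda>w. w) w"
  proof (rule free_hom_eqI[OF FT.is_group, of "free_proj S T" T "\<lambda>w. w"])
    show "free_proj S T \<in> hom (free_group T) (free_group T)"
    proof (rule homI)
      fix u v assume "u \<in> carrier (free_group T)" "v \<in> carrier (free_group T)"
      then have "free_proj S T (u \<otimes>\<^bsub>free_group S\<^esub> v) = free_proj S T u \<otimes>\<^bsub>free_group T\<^esub> free_proj S T v"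
        using free_group_mono by simp
      then show "free_proj S T (u \<otimes>\<^bsub>free_group T\<^esub> v) = free_proj S T u \<otimes>\<^bsub>free_group T\<^esub> free_proj S T v"
        by (simp add: mult_free_group)
    qed (simp add: free_group_mono)
    show "(\<lambda>w. w) \<in> hom (free_group T) (free_group T)" by (intro homI) auto
    show "free_proj S T (free_gen i) = free_gen i" if "i \<in> T" for i
      using that TS by (subst free_proj_gen) auto
  qed (rule assms)
  then show ?thesis by simp
qed

lemma restrict_aut_free_hom:
  assumes f: "f \<in> auto (free_group S)"
  shows "restrict_aut S T f \<in> hom (free_group T) (free_group T)"
proof (rule homI)
  interpret f: group_hom "free_group S" "free_group S" f using F.auto_group_hom[OF f] .
  show "restrict_aut S T f u \<in> carrier (free_group T)" if "u \<in> carrier (free_group T)" for u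
    using that free_group_mono by (simp add: restrict_aut_def)
  fix u v assume uv: "u \<in> carrier (free_group T)" "v \<in> carrier (free_group T)"
  have eq: "u \<otimes>\<^bsub>free_group T\<^esub> v = u \<otimes>\<^bsub>free_group S\<^esub> v" by (simp add: mult_free_group)
  have "restrict_aut S T f (u \<otimes>\<^bsub>free_group T\<^esub> v) = free_proj S T (f (u \<otimes>\<^bsub>free_group T\<^esub> v))"
    by (simp only: restrict_aut_def restrict_apply'[OF FT.m_closed[OF uv]])
  also have "\<dots> = free_proj S T (f (u \<otimes>\<^bsub>free_group S\<^esub> v))" by (simp only: eq)
  also have "\<dots> = free_proj S T (f u) \<otimes>\<^bsub>free_group T\<^esub> free_proj S T (f v)"
    using uv free_group_mono by simp
  finally show "restrict_aut S T f (u \<otimes>\<^bsub>free_group T\<^esub> v) =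
      restrict_aut S T f u \<otimes>\<^bsub>free_group T\<^esub> restrict_aut S T f v"
    using uv by (simp add: restrict_aut_def)
qed

text \<open>
  Both sides are homomorphisms in \<open>w\<close>. They agree on a killed generator because a basis-conjugating
  automorphism preserves the normal closure of every basis element.
\<close>

lemma restrict_aut_proj:
  assumes f: "f \<in> mccool S" and w: "w \<in> carrier (free_group S)"
  shows "restrict_aut S T f (free_proj S T w) = free_proj S T (f w)"
proof -
  have fa: "f \<in> auto (free_group S)" using f by (rule mccool_auto)
  interpret f: group_hom "free_group S" "free_group S" f using F.auto_group_hom[OF fa] .
  interpret r: group_hom "free_group T" "free_group T" "restrict_aut S T f"
    using restrict_aut_free_hom[OF fa] by unfold_locales
  have "(\<lambda>w. restrict_aut S T f (free_proj S T w)) w = (\<lambda>w. free_proj S T (f w)) w"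
  proof (rule free_hom_eqI[OF FT.is_group, of "\<lambda>w. restrict_aut S T f (free_proj S T w)" S "\<lambda>w. free_proj S T (f w)"])
    show "(\<lambda>w. restrict_aut S T f (free_proj S T w)) \<in> hom (free_group S) (free_group T)"
      "(\<lambda>w. free_proj S T (f w)) \<in> hom (free_group S) (free_group T)"
      by (intro homI; simp)+
    fix i assume i: "i \<in> S"
    show "restrict_aut S T f (free_proj S T (free_gen i)) = free_proj S T (f (free_gen i))"
    proof (cases "i \<in> T")
      case True
      then show ?thesis using i free_gen_closed[OF True] by (simp add: free_proj_gen restrict_aut_def)
    next
      case False
      obtain v where v: "v \<in> carrier (free_group S)" "f (free_gen i) = free_conj S v i"
        using mccoolD[OF f i] by blast
      have "free_proj S T (free_conj S v i) = \<one>\<^bsub>free_group T\<^esub>"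
        using v(1) i False free_gen_closed[OF i] by (simp add: free_conj_def free_proj_gen)
      moreover have "restrict_aut S T f \<one>\<^bsub>free_group T\<^esub> = \<one>\<^bsub>free_group T\<^esub>"
        by (rule r.hom_one)
      ultimately show ?thesis using False i v(2) by (simp only: free_proj_gen if_False)
    qed
  qed (rule w)
  then show ?thesis by simp
qed

lemma restrict_aut_mult:
  assumes f: "f \<in> mccool S" and g: "g \<in> mccool S" and w: "w \<in> carrier (free_group T)"
  shows "restrict_aut S T (f \<otimes>\<^bsub>AutoGroup (free_group S)\<^esub> g) w = restrict_aut S T f (restrict_aut S T g w)"
proof -
  have fg: "f \<in> auto (free_group S)" "g \<in> auto (free_group S)" using f g mccool_auto by blast+
  have "restrict_aut S T g w = free_proj S T (g w)" using w by (simp add: restrict_aut_def)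
  moreover have "g w \<in> carrier (free_group S)" using F.auto_closed[OF fg(2) free_group_mono[OF w]] .
  ultimately have "restrict_aut S T f (restrict_aut S T g w) = free_proj S T (f (g w))"
    using restrict_aut_proj[OF f] by simp
  then show ?thesis using w F.AutoGroup_mult[OF fg free_group_mono[OF w]] by (simp add: restrict_aut_def)
qed

lemma restrict_aut_mccool:
  assumes f: "f \<in> mccool S"
  shows "restrict_aut S T f \<in> mccool T"
proof (rule mccoolI)
  have fa: "f \<in> auto (free_group S)" using f by (rule mccool_auto)
  let ?g = "inv\<^bsub>AutoGroup (free_group S)\<^esub> f"
  have g: "?g \<in> mccool S" using subgroup.m_inv_closed[OF subgroup_mccool f] .
  have ga: "?g \<in> auto (free_group S)" using g by (rule mccool_auto)
  have one: "restrict_aut S T \<one>\<^bsub>AutoGroup (free_group S)\<^esub> w = w" if "w \<in> carrier (free_group T)" for w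
    using that free_group_mono[OF that] free_proj_id by (simp add: restrict_aut_def F.AutoGroup_one)
  have inv: "?g \<otimes>\<^bsub>AutoGroup (free_group S)\<^esub> f = \<one>\<^bsub>AutoGroup (free_group S)\<^esub>"
    "f \<otimes>\<^bsub>AutoGroup (free_group S)\<^esub> ?g = \<one>\<^bsub>AutoGroup (free_group S)\<^esub>"
    using fa A.l_inv[of f] A.r_inv[of f] by (simp_all add: F.carrier_AutoGroup)
  show "restrict_aut S T f \<in> auto (free_group T)"
  proof (rule FT.autoI)
    show "restrict_aut S T f \<in> hom (free_group T) (free_group T)" by (rule restrict_aut_free_hom[OF fa])
    show "restrict_aut S T ?g \<in> hom (free_group T) (free_group T)" by (rule restrict_aut_free_hom[OF ga])
    show "restrict_aut S T f \<in> extensional (carrier (free_group T))" by (simp add: restrict_aut_def)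
    fix w assume w: "w \<in> carrier (free_group T)"
    show "restrict_aut S T f (restrict_aut S T ?g w) = w"
      using restrict_aut_mult[OF f g w] one[OF w] by (simp add: inv)
    show "restrict_aut S T ?g (restrict_aut S T f w) = w"
      using restrict_aut_mult[OF g f w] one[OF w] by (simp add: inv)
  qed
  fix i assume i: "i \<in> T"
  then have iS: "i \<in> S" using TS by blast
  obtain v where v: "v \<in> carrier (free_group S)" "f (free_gen i) = free_conj S v i"
    using mccoolD[OF f iS] by blast
  have "restrict_aut S T f (free_gen i) = free_conj T (free_proj S T v) i"
    using v i iS free_gen_closed[OF i] free_gen_closed[OF iS]
    by (simp add: restrict_aut_def free_conj_def free_proj_gen)
  then show "\<exists>w\<in>carrier (free_group T). restrict_aut S T f (free_gen i) = free_conj T w i"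
    using p.hom_closed[OF v(1)] by blast
qed

theorem restrict_aut_hom: "restrict_aut S T \<in> hom (mccool_group S) (mccool_group T)"
proof (rule homI)
  interpret AT: group "AutoGroup (free_group T)" by (rule FT.AutoGroup)
  fix f g assume "f \<in> carrier (mccool_group S)" "g \<in> carrier (mccool_group S)"
  then have fg: "f \<in> mccool S" "g \<in> mccool S" by (simp_all add: mccool_group_def)
  have a: "restrict_aut S T f \<in> auto (free_group T)" "restrict_aut S T g \<in> auto (free_group T)"
    using restrict_aut_mccool[OF fg(1)] restrict_aut_mccool[OF fg(2)] by (auto dest: mccool_auto)
  have m: "f \<otimes>\<^bsub>AutoGroup (free_group S)\<^esub> g \<in> mccool S" using subgroup.m_closed[OF subgroup_mccool fg] .
  have "restrict_aut S T (f \<otimes>\<^bsub>AutoGroup (free_group S)\<^esub> g) =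
      restrict_aut S T f \<otimes>\<^bsub>AutoGroup (free_group T)\<^esub> restrict_aut S T g"
  proof (rule FT.auto_eqI)
    show "restrict_aut S T (f \<otimes>\<^bsub>AutoGroup (free_group S)\<^esub> g) \<in> auto (free_group T)"
      using restrict_aut_mccool[OF m] by (rule mccool_auto)
    show "restrict_aut S T f \<otimes>\<^bsub>AutoGroup (free_group T)\<^esub> restrict_aut S T g \<in> auto (free_group T)"
      using AT.m_closed a by (simp add: FT.carrier_AutoGroup)
  qed (simp add: restrict_aut_mult[OF fg] FT.AutoGroup_mult a)
  then show "restrict_aut S T (f \<otimes>\<^bsub>mccool_group S\<^esub> g) =
      restrict_aut S T f \<otimes>\<^bsub>mccool_group T\<^esub> restrict_aut S T g"
    by (simp add: mccool_group_def)
qed (use restrict_aut_mccool in \<open>auto simp: mccool_group_def\<close>)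

lemma restrict_partial_conj:
  assumes "p \<in> S" "q \<in> S" "p \<noteq> q"
  shows "restrict_aut S T (partial_conj S p q True) =
    (if p \<in> T \<and> q \<in> T then partial_conj T p q True else \<one>\<^bsub>AutoGroup (free_group T)\<^esub>)"
proof -
  interpret AT: group "AutoGroup (free_group T)" by (rule FT.AutoGroup)
  have a: "restrict_aut S T (partial_conj S p q True) \<in> auto (free_group T)"
    using restrict_aut_mccool[OF partial_conj_mccool[OF assms]] by (rule mccool_auto)
  have q: "free_gen q = [(q, True)]" by (simp add: free_gen_def)
  have val: "restrict_aut S T (partial_conj S p q True) (free_gen i) =
      (if i = p \<and> q \<in> T then [(q, True)] \<otimes>\<^bsub>free_group T\<^esub> free_gen p \<otimes>\<^bsub>free_group T\<^esub> inv\<^bsub>free_group T\<^esub> [(q, True)] else free_gen i)"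
    if i: "i \<in> T" for i
  proof -
    have iS: "i \<in> S" using i TS by blast
    have "restrict_aut S T (partial_conj S p q True) (free_gen i) = free_proj S T (partial_conj S p q True (free_gen i))"
      using free_gen_closed[OF i] by (simp add: restrict_aut_def)
    also have "\<dots> = (if i = p then free_proj S T (free_gen q \<otimes>\<^bsub>free_group S\<^esub> free_gen p \<otimes>\<^bsub>free_group S\<^esub> inv\<^bsub>free_group S\<^esub> (free_gen q)) else free_gen i)"
      using partial_conj_hom(3)[OF assms(1,2) iS, of True] i iS by (simp add: q free_proj_gen)
    finally show ?thesis
      using i iS assms free_gen_closed[OF assms(1)] free_gen_closed[OF assms(2)] free_gen_closed[OF i]
      by (auto simp: free_proj_gen q[symmetric])
  qed
  show ?thesis
  proof (cases "p \<in> T \<and> q \<in> T")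
    case True
    then have pqT: "p \<in> T" "q \<in> T" by auto
    show ?thesis
      using partial_conj_hom(3)[OF pqT, of _ True]
      by (simp only: True if_True simp_thms)
        (intro auto_free_eqI[OF a partial_conj_auto[OF pqT assms(3)]], use val pqT in simp)
  next
    case False
    have "\<one>\<^bsub>AutoGroup (free_group T)\<^esub> \<in> auto (free_group T)"
      using AT.one_closed by (simp add: FT.carrier_AutoGroup)
    then show ?thesis
      using False val by (intro trans[OF auto_free_eqI[OF a]]) (auto simp: FT.AutoGroup_one free_gen_closed)
  qed
qed

end

section \<open>Free abelian central subgroups\<close>

text \<open>
  The cosets of the \<open>w i\<close> generate an abelian group because \<open>L\<close> is central modulo \<open>N\<close>. The characters
  \<open>\<chi> i\<close> descend to the quotient and recover the exponents up to nonzero factors, so there are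
  no relations.
\<close>

theorem (in group) central_free_Abelian_subgroup:
  fixes w :: "'i \<Rightarrow> 'a" and \<chi> :: "'i \<Rightarrow> 'a \<Rightarrow> int"
  assumes N: "N \<lhd> G" and L: "subgroup L G" and NL: "N \<subseteq> L"
    and central: "\<And>l g. l \<in> L \<Longrightarrow> g \<in> carrier G \<Longrightarrow> commut G l g \<in> N"
    and w: "\<And>i. i \<in> I \<Longrightarrow> w i \<in> L"
    and hom: "\<And>i. i \<in> I \<Longrightarrow> \<chi> i \<in> hom (G\<lparr>carrier := L\<rparr>) integer_group"
    and \<chi>N: "\<And>i x. i \<in> I \<Longrightarrow> x \<in> N \<Longrightarrow> \<chi> i x = 0"
    and diag: "\<And>i. i \<in> I \<Longrightarrow> \<chi> i (w i) \<noteq> 0"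
    and offdiag: "\<And>i j. i \<in> I \<Longrightarrow> j \<in> I \<Longrightarrow> i \<noteq> j \<Longrightarrow> \<chi> i (w j) = 0"
  shows "\<exists>C. central_subgroup C (G Mod N) \<and> (G Mod N)\<lparr>carrier := C\<rparr> \<cong> free_Abelian_group I"
proof -
  interpret N: normal N G by (rule N)
  interpret Q: group "G Mod N" by (rule N.factorgroup_is_group)
  interpret FA: comm_group "free_Abelian_group I" by (rule abelian_free_Abelian_group)
  let ?Q = "G Mod N" and ?L = "G\<lparr>carrier := L\<rparr>"
  have LG: "L \<subseteq> carrier G" using L by (rule subgroup.subset)
  interpret Lg: group ?L by (rule subgroup.subgroup_is_group[OF L is_group])
  have NLn: "N \<lhd> ?L" using normal_restrict_supergroup[OF L N NL] .
  define D where "D = (\<lambda>l. N #> l) ` L"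
  have QL: "?L Mod N = ?Q\<lparr>carrier := D\<rparr>"
    by (simp add: FactGroup_def RCOSETS_def D_def set_mult_def r_coset_def fun_eq_iff image_def) auto
  have carrQ: "carrier ?Q = (\<lambda>x. N #> x) ` carrier G" by (rule carrier_FactGroup)
  have multQ: "(N #> x) \<otimes>\<^bsub>?Q\<^esub> (N #> y) = N #> (x \<otimes> y)" if "x \<in> carrier G" "y \<in> carrier G" for x y
    using N.rcos_sum that by simp
  have comm: "(N #> l) \<otimes>\<^bsub>?Q\<^esub> (N #> g) = (N #> g) \<otimes>\<^bsub>?Q\<^esub> (N #> l)" if l: "l \<in> L" and g: "g \<in> carrier G" for l g
  proof -
    have lG: "l \<in> carrier G" using l LG by blast
    have "l \<otimes> g = commut G l g \<otimes> (g \<otimes> l)" using lG g by (simp add: commut_def group_word)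
    then have "N #> (l \<otimes> g) = N #> (g \<otimes> l)"
      using coset_join2[OF N.mem_carrier[OF central[OF l g]] N.is_subgroup central[OF l g]]
        coset_mult_assoc[OF N.subset N.mem_carrier[OF central[OF l g]], of "g \<otimes> l"] lG g by simp
    then show ?thesis using multQ lG g by simp
  qed
  have D: "subgroup D ?Q"
  proof -
    have "(\<lambda>x. N #> x) \<in> hom G ?Q" using multQ by (intro homI) (auto simp: carrQ)
    then interpret q: group_hom G ?Q "\<lambda>x. N #> x" by unfold_locales
    show ?thesis unfolding D_def by (rule q.subgroup_img_is_subgroup[OF L])
  qed
  interpret D: comm_group "?Q\<lparr>carrier := D\<rparr>"
  proof (rule group.group_comm_groupI)
    show "group (?Q\<lparr>carrier := D\<rparr>)" by (rule subgroup.subgroup_is_group[OF D Q.is_group])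
    show "x \<otimes>\<^bsub>?Q\<lparr>carrier := D\<rparr>\<^esub> y = y \<otimes>\<^bsub>?Q\<lparr>carrier := D\<rparr>\<^esub> x"
      if "x \<in> carrier (?Q\<lparr>carrier := D\<rparr>)" "y \<in> carrier (?Q\<lparr>carrier := D\<rparr>)" for x y
      using that comm LG by (auto simp: D_def)
  qed
  obtain \<theta> where \<theta>: "\<theta> \<in> hom (free_Abelian_group I) (?Q\<lparr>carrier := D\<rparr>)"
    and \<theta>w: "\<And>i. i \<in> I \<Longrightarrow> \<theta> (frag_of i) = N #> w i"
    by (rule D.free_Abelian_group_universal[of "\<lambda>i. N #> w i" I]) (use w in \<open>auto simp: D_def\<close>)
  interpret \<theta>: group_hom "free_Abelian_group I" "?Q\<lparr>carrier := D\<rparr>" \<theta>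
    using \<theta> by unfold_locales
  have coord: "\<exists>g. g \<in> hom (?Q\<lparr>carrier := D\<rparr>) integer_group \<and>
      (\<forall>x. Poly_Mapping.keys x \<subseteq> I \<longrightarrow> g (\<theta> x) = \<chi> i (w i) * poly_mapping.lookup x i)" if i: "i \<in> I" for i
  proof -
    interpret c: group_hom ?L integer_group "\<chi> i"
      using hom[OF i] by (simp add: group_hom_def group_hom_axioms_def Lg.is_group)
    have "N \<subseteq> kernel ?L integer_group (\<chi> i)" using \<chi>N[OF i] NL by (auto simp: kernel_def)
    then obtain g where g: "g \<in> hom (?L Mod N) integer_group" "\<And>x. x \<in> carrier ?L \<Longrightarrow> g (N #>\<^bsub>?L\<^esub> x) = \<chi> i x"
      using c.FactGroup_universal_kernel[OF NLn] by metis
    have gL: "g (N #> x) = \<chi> i x" if "x \<in> L" for x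
      using g(2)[of x] that by (simp add: r_coset_def)
    have gh: "g \<in> hom (?Q\<lparr>carrier := D\<rparr>) integer_group" using g(1) by (simp add: QL)
    interpret g: group_hom "?Q\<lparr>carrier := D\<rparr>" integer_group g
      using gh by (simp add: group_hom_def group_hom_axioms_def D.is_group)
    have "g (\<theta> x) = \<chi> i (w i) * poly_mapping.lookup x i" if "Poly_Mapping.keys x \<subseteq> I" for x
    proof (rule free_Abelian_group_induct[OF that])
      have "\<theta> 0 = \<one>\<^bsub>?Q\<lparr>carrier := D\<rparr>\<^esub>" using \<theta>.hom_one by simp
      then show "g (\<theta> 0) = \<chi> i (w i) * poly_mapping.lookup 0 i" using g.hom_one by simp
    next
      fix x y
      assume xy: "Poly_Mapping.keys x \<subseteq> I" "Poly_Mapping.keys y \<subseteq> I"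
        and gx: "g (\<theta> x) = \<chi> i (w i) * poly_mapping.lookup x i"
        and gy: "g (\<theta> y) = \<chi> i (w i) * poly_mapping.lookup y i"
      have y: "Poly_Mapping.keys (- y) \<subseteq> I" using xy by simp
      have "\<theta> (x - y) = \<theta> x \<otimes>\<^bsub>?Q\<lparr>carrier := D\<rparr>\<^esub> inv\<^bsub>?Q\<lparr>carrier := D\<rparr>\<^esub> (\<theta> y)"
        using \<theta>.hom_mult[of x "- y"] \<theta>.hom_inv[of y] xy y by simp
      moreover have "\<theta> x \<in> carrier (?Q\<lparr>carrier := D\<rparr>)" "\<theta> y \<in> carrier (?Q\<lparr>carrier := D\<rparr>)"
        using xy \<theta>.hom_closed[of x] \<theta>.hom_closed[of y] by simp_all
      ultimately have "g (\<theta> (x - y)) = g (\<theta> x) \<otimes>\<^bsub>integer_group\<^esub> inv\<^bsub>integer_group\<^esub> (g (\<theta> y))"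
        using g.hom_mult[OF _ D.inv_closed] g.hom_inv by (simp only:)
      then show "g (\<theta> (x - y)) = \<chi> i (w i) * poly_mapping.lookup (x - y) i"
        by (simp add: gx gy lookup_minus right_diff_distrib)
    next
      fix j assume "j \<in> I"
      then show "g (\<theta> (frag_of j)) = \<chi> i (w i) * poly_mapping.lookup (frag_of j) i"
        using \<theta>w[of j] gL[OF w[of j]] offdiag[OF i, of j]
        by (cases "i = j") (auto simp: lookup_single)
    qed
    then show ?thesis using gh by blast
  qed
  have inj: "inj_on \<theta> (carrier (free_Abelian_group I))"
  proof (rule inj_onI)
    fix x y assume xy: "x \<in> carrier (free_Abelian_group I)" "y \<in> carrier (free_Abelian_group I)" "\<theta> x = \<theta> y"
    show "x = y"
    proof (rule poly_mapping_eqI)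
      fix i
      show "poly_mapping.lookup x i = poly_mapping.lookup y i"
      proof (cases "i \<in> I")
        case True
        then have "\<chi> i (w i) * poly_mapping.lookup x i = \<chi> i (w i) * poly_mapping.lookup y i"
          using coord[OF True] xy by (metis carrier_free_Abelian_group_iff)
        then show ?thesis using diag[OF True] by simp
      next
        case False
        then have "i \<notin> Poly_Mapping.keys x" "i \<notin> Poly_Mapping.keys y" using xy by auto
        then show ?thesis by (simp add: in_keys_iff)
      qed
    qed
  qed
  define C where "C = \<theta> ` carrier (free_Abelian_group I)"
  have CD: "C \<subseteq> D" using \<theta>.hom_closed by (auto simp: C_def)
  have "subgroup C (?Q\<lparr>carrier := D\<rparr>)" unfolding C_def by (rule \<theta>.img_is_subgroup)
  then have C: "subgroup C ?Q" using Q.incl_subgroup[OF D] by blast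
  have "central_subgroup C ?Q"
    unfolding central_subgroup_def using C CD comm by (auto simp: D_def carrQ subset_iff image_iff)
  moreover have "\<theta> \<in> iso (free_Abelian_group I) (?Q\<lparr>carrier := C\<rparr>)"
    using \<theta>.homh inj unfolding iso_def bij_betw_def by (auto simp: hom_def C_def)
  then have "free_Abelian_group I \<cong> ?Q\<lparr>carrier := C\<rparr>" by (auto simp: is_iso_def)
  then have "?Q\<lparr>carrier := C\<rparr> \<cong> free_Abelian_group I" using FA.iso_sym by blast
  ultimately show ?thesis by blast
qed

section \<open>A relation between derivations in degree six\<close>

definition conj_deriv :: "'a \<Rightarrow> 'a \<Rightarrow> 'a lie_derivation"
  where "conj_deriv i j = (\<lambda>p. if p = i then Br (Gen j) (Gen i) else Zero)"

text \<open>
  A derivation is determined by its values on the generators that occur in an expression; so it is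
  inner as soon as it is inner on these.
\<close>

lemma lie_deriv_inner:
  assumes "\<And>p. p \<in> set_lie_exp e \<Longrightarrow> lie_eval X (d p) = Y * X p - X p * Y"
  shows "lie_eval X (lie_deriv d e) = Y * lie_eval X e - lie_eval X e * Y"
  using assms
proof (induction e)
  case (Br s t)
  then have "lie_eval X (lie_deriv d s) = Y * lie_eval X s - lie_eval X s * Y"
    "lie_eval X (lie_deriv d t) = Y * lie_eval X t - lie_eval X t * Y" by simp_all
  then show ?case by (simp only: lie_deriv.simps lie_eval.simps) (simp add: algebra_simps)
qed (simp_all add: algebra_simps)

lemma set_lie_deriv: "(\<And>p. p \<in> J \<Longrightarrow> set_lie_exp (d p) \<subseteq> J) \<Longrightarrow> set_lie_exp e \<subseteq> J \<Longrightarrow> set_lie_exp (lie_deriv d e) \<subseteq> J"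
  by (induction e) auto

text \<open>
  The restriction to \<open>J\<close> matters: \<open>ad_deriv\<close> is inner on the three chosen generators
  only, because it kills the others. The set is required to be closed under the derivation
  so that brackets stay inner.
\<close>

definition inner_on :: "'a set \<Rightarrow> ('a \<Rightarrow> 'r::ring_1) \<Rightarrow> 'r \<Rightarrow> 'a lie_derivation \<Rightarrow> bool"
  where "inner_on J X Y d \<longleftrightarrow> (\<forall>p\<in>J. set_lie_exp (d p) \<subseteq> J \<and> lie_eval X (d p) = Y * X p - X p * Y)"

lemma inner_on_bracket:
  assumes d: "inner_on J X Y d" and d': "inner_on J X Y' d'"
  shows "inner_on J X (Y * Y' - Y' * Y) (deriv_bracket d d')"
  unfolding inner_on_def
proof (intro ballI conjI)
  fix p assume p: "p \<in> J"
  have J: "set_lie_exp (d p) \<subseteq> J" "set_lie_exp (d' p) \<subseteq> J"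
    and ev: "lie_eval X (d p) = Y * X p - X p * Y" "lie_eval X (d' p) = Y' * X p - X p * Y'"
    using d d' p by (auto simp: inner_on_def)
  show "set_lie_exp (deriv_bracket d d' p) \<subseteq> J"
    using J d d' by (simp add: deriv_bracket_def set_lie_deriv inner_on_def)
  have "lie_eval X (lie_deriv d (d' p)) = Y * lie_eval X (d' p) - lie_eval X (d' p) * Y"
    "lie_eval X (lie_deriv d' (d p)) = Y' * lie_eval X (d p) - lie_eval X (d p) * Y'"
    using d d' J by (auto simp: inner_on_def intro!: lie_deriv_inner)
  then show "lie_eval X (deriv_bracket d d' p) = (Y * Y' - Y' * Y) * X p - X p * (Y * Y' - Y' * Y)"
    by (simp only: deriv_bracket_def lie_eval.simps ev) (simp add: algebra_simps)
qed

definition cyclic_deriv :: "'a \<Rightarrow> 'a \<Rightarrow> 'a \<Rightarrow> 'a lie_derivation"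
  where "cyclic_deriv i j k =
     deriv_bracket (conj_deriv i j) (deriv_bracket (conj_deriv k i)
       (deriv_bracket (deriv_bracket (conj_deriv i j) (conj_deriv j k))
          (deriv_bracket (conj_deriv j k) (conj_deriv k i))))"

text \<open>
  The relation itself: an identity between noncommutative polynomials of degree seven
  in three variables, verified by expanding both sides.
\<close>

lemma cyclic_deriv_sum:
  fixes X :: "'a \<Rightarrow> 'r::ring_1"
  assumes "i \<noteq> j" "j \<noteq> k" "k \<noteq> i"
  defines "A \<equiv> X j * X k - X k * X j" and "B \<equiv> X k * X i - X i * X k"
  defines "V \<equiv> (X i * A - A * X i) * (X j * B - B * X j) - (X j * B - B * X j) * (X i * A - A * X i)"
  shows "lie_eval X (cyclic_deriv i j k i) + lie_eval X (cyclic_deriv j k i i) + lie_eval X (cyclic_deriv k i j i)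
     = V * X i - X i * V"
  unfolding V_def A_def B_def
  by (simp add: assms(1-3) assms(1-3)[symmetric] cyclic_deriv_def deriv_bracket_def conj_deriv_def cong: if_cong)
    (simp only: algebra_simps)

text \<open>
  Conjugating both \<open>x\<^sub>j\<close> and \<open>x\<^sub>k\<close> by \<open>x\<^sub>i\<close> induces the inner derivation by \<open>i\<close> on the three generators.
\<close>

definition ad_deriv :: "'a \<Rightarrow> 'a \<Rightarrow> 'a \<Rightarrow> 'a lie_derivation"
  where "ad_deriv i j k = deriv_add (conj_deriv j i) (conj_deriv k i)"

definition exotic_deriv :: "'a \<Rightarrow> 'a \<Rightarrow> 'a \<Rightarrow> 'a lie_derivation"
  where "exotic_deriv i j k =
    deriv_add (deriv_add (deriv_add (cyclic_deriv i j k) (cyclic_deriv j k i)) (cyclic_deriv k i j))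
      (deriv_neg (deriv_bracket
        (deriv_bracket (ad_deriv i j k) (deriv_bracket (ad_deriv j k i) (ad_deriv k i j)))
        (deriv_bracket (ad_deriv j k i) (deriv_bracket (ad_deriv k i j) (ad_deriv i j k)))))"

text \<open>
  The value at \<open>i\<close> is \<open>cyclic_deriv_sum\<close>. The values at \<open>j\<close> and \<open>k\<close> follow by cyclic rotation, under
  which the polynomial \<open>V\<close> is invariant by the Jacobi identity.
\<close>

theorem exotic_deriv_zero:
  fixes X :: "'a \<Rightarrow> 'r::ring_1"
  assumes ijk: "i \<noteq> j" "j \<noteq> k" "k \<noteq> i" and p: "p \<in> {i, j, k}"
  shows "lie_eval X (exotic_deriv i j k p) = 0"
proof -
  define br where "br x y = x * y - y * x" for x y :: 'r
  let ?a = "ad_deriv i j k" and ?b = "ad_deriv j k i" and ?c = "ad_deriv k i j" and ?J = "{i, j, k}"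
  define V where "V i j k = br (br (X i) (br (X j) (X k))) (br (X j) (br (X k) (X i)))" for i j k
  have "inner_on ?J X (X i) ?a" "inner_on ?J X (X j) ?b" "inner_on ?J X (X k) ?c"
    using ijk by (auto simp: inner_on_def ad_deriv_def deriv_add_def conj_deriv_def)
  then have "inner_on ?J X (V i j k)
      (deriv_bracket (deriv_bracket ?a (deriv_bracket ?b ?c)) (deriv_bracket ?b (deriv_bracket ?c ?a)))"
    unfolding V_def br_def by (intro inner_on_bracket)
  then have inner: "lie_eval X (deriv_bracket (deriv_bracket ?a (deriv_bracket ?b ?c)) (deriv_bracket ?b (deriv_bracket ?c ?a)) p)
      = br (V i j k) (X p)"
    using p by (auto simp: inner_on_def br_def)
  have cyc: "lie_eval X (cyclic_deriv i j k i) + lie_eval X (cyclic_deriv j k i i) + lie_eval X (cyclic_deriv k i j i) = br (V i j k) (X i)"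
    if "i \<noteq> j" "j \<noteq> k" "k \<noteq> i" for i j k
    using cyclic_deriv_sum[OF that, of X] by (simp only: V_def br_def)
  have rot: "V j k i = V i j k" "V k i j = V i j k"
    by (simp_all add: V_def br_def algebra_simps)
  have "lie_eval X (cyclic_deriv i j k p) + lie_eval X (cyclic_deriv j k i p) + lie_eval X (cyclic_deriv k i j p) = br (V i j k) (X p)"
  proof -
    consider "p = i" | "p = j" | "p = k" using p by blast
    then show ?thesis
    proof cases
      case 1
      then show ?thesis using cyc[OF ijk] by (simp only:)
    next
      case 2
      then show ?thesis using cyc[OF ijk(2,3,1)] by (simp only: rot add_ac)
    next
      case 3
      then show ?thesis using cyc[OF ijk(3,1,2)] by (simp only: rot add_ac)
    qed
  qed
  then show ?thesis by (simp add: exotic_deriv_def deriv_add_def deriv_neg_def inner)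
qed

section \<open>A commutator word in the sixth lower central term\<close>

text \<open>
  The group version of \<open>exotic_deriv\<close>; the arguments \<open>x, y, z\<close> stand for the partially inner
  automorphisms that act as \<open>ad_deriv\<close>.
\<close>

definition exotic_word :: "('g, 'b) monoid_scheme \<Rightarrow> 'g \<Rightarrow> 'g \<Rightarrow> 'g \<Rightarrow> 'g \<Rightarrow> 'g \<Rightarrow> 'g \<Rightarrow> 'g"
  where "exotic_word G a b c x y z =
    commut G a (commut G c (commut G (commut G a b) (commut G b c)))
    \<otimes>\<^bsub>G\<^esub> commut G b (commut G a (commut G (commut G b c) (commut G c a)))
    \<otimes>\<^bsub>G\<^esub> commut G c (commut G b (commut G (commut G c a) (commut G a b)))
    \<otimes>\<^bsub>G\<^esub> inv\<^bsub>G\<^esub> (commut G (commut G x (commut G y z)) (commut G y (commut G z x)))"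

lemma (in group_hom) hom_commut: "a \<in> carrier G \<Longrightarrow> b \<in> carrier G \<Longrightarrow> h (commut G a b) = commut H (h a) (h b)"
  by (simp add: commut_def)

lemma (in group_hom) hom_exotic_word:
  assumes "a \<in> carrier G" "b \<in> carrier G" "c \<in> carrier G" "x \<in> carrier G" "y \<in> carrier G" "z \<in> carrier G"
  shows "h (exotic_word G a b c x y z) = exotic_word H (h a) (h b) (h c) (h x) (h y) (h z)"
  using assms by (simp add: exotic_word_def hom_commut)

context group
begin

lemma commut_subgroup:
  assumes "subgroup H G" "a \<in> H" "b \<in> H"
  shows "commut (G\<lparr>carrier := H\<rparr>) a b = commut G a b" "commut G a b \<in> H"
  using assms by (simp_all add: commut_def m_inv_consistent[OF assms(1)]
      subgroup.m_closed[OF assms(1)] subgroup.m_inv_closed[OF assms(1)])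

lemma exotic_word_subgroup:
  assumes H: "subgroup H G" and "a \<in> H" "b \<in> H" "c \<in> H" "x \<in> H" "y \<in> H" "z \<in> H"
  shows "exotic_word (G\<lparr>carrier := H\<rparr>) a b c x y z = exotic_word G a b c x y z"
    "exotic_word G a b c x y z \<in> H"
  using assms by (simp_all add: exotic_word_def commut_subgroup[OF H] m_inv_consistent[OF H]
      subgroup.m_closed[OF H] subgroup.m_inv_closed[OF H])

lemma exotic_word_lower_central:
  assumes "a \<in> carrier G" "b \<in> carrier G" "c \<in> carrier G" "x \<in> carrier G" "y \<in> carrier G" "z \<in> carrier G"
  shows "exotic_word G a b c x y z \<in> lower_central G 6"
proof -
  have br: "commut G u v \<in> lower_central G m"
    if "u \<in> lower_central G k" "v \<in> lower_central G l" "k \<ge> 1" "l \<ge> 1" "k + l = m" for u v k l m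
    using commut_lower_central[OF that(1-4)] that(5) by simp
  have 1: "u \<in> lower_central G 1" if "u \<in> carrier G" for u using that by simp
  have cyc: "commut G u (commut G v (commut G (commut G s t) (commut G s' t'))) \<in> lower_central G 6"
    if "u \<in> carrier G" "v \<in> carrier G" "s \<in> carrier G" "t \<in> carrier G" "s' \<in> carrier G" "t' \<in> carrier G" for u v s t s' t'
    by (rule br[OF 1[OF that(1)] br[OF 1[OF that(2)] br[OF br[OF 1[OF that(3)] 1[OF that(4)], of 2] br[OF 1[OF that(5)] 1[OF that(6)], of 2], of 4], of 5]]) auto
  have tri: "commut G u (commut G v s) \<in> lower_central G 3"
    if "u \<in> carrier G" "v \<in> carrier G" "s \<in> carrier G" for u v s
    by (rule br[OF 1[OF that(1)] br[OF 1[OF that(2)] 1[OF that(3)], of 2]]) auto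
  have "commut G (commut G x (commut G y z)) (commut G y (commut G z x)) \<in> lower_central G 6"
    using assms by (intro br[OF tri tri]) auto
  then show ?thesis using assms unfolding exotic_word_def by (intro lc_mult lc_inv cyc) auto
qed

text \<open>
  Each of the three patterns arises when one of three basis elements is killed; every commutator in
  the word then has a trivial argument.
\<close>

lemma exotic_word_degenerate:
  assumes "a \<in> carrier G" "b \<in> carrier G" "c \<in> carrier G" "x \<in> carrier G" "y \<in> carrier G" "z \<in> carrier G"
    and "(a = \<one> \<and> c = \<one> \<and> x = \<one>) \<or> (a = \<one> \<and> b = \<one> \<and> y = \<one>) \<or> (b = \<one> \<and> c = \<one> \<and> z = \<one>)"
  shows "exotic_word G a b c x y z = \<one>"
  using assms(7,1-6) by (elim disjE conjE) (simp_all add: exotic_word_def)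

end

definition exotic_exp :: "'a \<Rightarrow> 'a \<Rightarrow> 'a \<Rightarrow> 'a lie_exp"
  where "exotic_exp i j k = (let a = Gen i; b = Gen j; c = Gen k in
    Add (Add (Br a (Br c (Br (Br a b) (Br b c)))) (Br b (Br a (Br (Br b c) (Br c a)))))
      (Br c (Br b (Br (Br c a) (Br a b)))))"

text \<open>
  Only the bracket that starts with \<open>i\<close> contributes to this coefficient.
\<close>

lemma coeff_exotic_exp:
  assumes "i \<noteq> j" "j \<noteq> k" "k \<noteq> i"
  shows "coeff (lie_eval nc_var (exotic_exp i j k)) [i, i, j, j, k, k] = -1"
  unfolding exotic_exp_def Let_def lie_eval.simps
  by (simp only: algebra_simps coeff_simps coeff_var_mult assms assms[symmetric] list.case if_False if_True
      coeff_nc_var mult_zero_right diff_self minus_zero diff_0_right add_0 add_0_right list.inject simp_thms list.distinct)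

lemma exotic_word_magnus:
  assumes "i \<noteq> j" "j \<noteq> k" "k \<noteq> i"
  shows "coeff (exotic_word magnus_group (1 + nc_var i) (1 + nc_var j) (1 + nc_var k) 1 1 1) [i, i, j, j, k, k] = -1"
proof -
  let ?x = "\<lambda>p. 1 + nc_var p :: 'a ncps"
  let ?w = "exotic_word magnus_group (?x i) (?x j) (?x k) 1 1 1"
  have c: "?x p \<in> carrier magnus_group" for p by (rule magnus_gen_closed)
  have one: "(1::'a ncps) \<in> carrier magnus_group" using M.one_closed by simp
  have g: "lie_rep magnus_group UNIV ?x 1 (?x p) (Gen p)" for p by (rule lie_rep.gen) simp
  have br: "lie_rep magnus_group UNIV ?x m (commut magnus_group u v) (Br s t)"
    if "lie_rep magnus_group UNIV ?x k u s" "lie_rep magnus_group UNIV ?x l v t" "k + l = m" for k l m u v s t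
    using lie_rep.br[OF that(1,2)] that(3) by simp
  have cyc: "lie_rep magnus_group UNIV ?x 6 (commut magnus_group (?x p) (commut magnus_group (?x q)
      (commut magnus_group (commut magnus_group (?x s) (?x t)) (commut magnus_group (?x s') (?x t')))))
      (Br (Gen p) (Br (Gen q) (Br (Br (Gen s) (Gen t)) (Br (Gen s') (Gen t')))))" for p q s t s' t'
    by (rule br[OF g br[OF g br[OF br[OF g g, of 2] br[OF g g, of 2], of 4], of 5]]) simp_all
  have "commut magnus_group (1 :: 'a ncps) 1 = 1" using M.commut_one(1)[OF one] by simp
  moreover have "inv\<^bsub>magnus_group\<^esub> (1 :: 'a ncps) = 1" using M.inv_one by simp
  ultimately have "lie_rep magnus_group UNIV ?x 6 ?w (exotic_exp i j k)"
    unfolding exotic_word_def exotic_exp_def Let_def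
    using lie_rep.add[OF lie_rep.add[OF cyc cyc] cyc, of i k i j j k j i j k k i k j k i i j] by simp
  then have "ncps_order (Suc 6) (?w - 1 - lie_eval nc_var (exotic_exp i j k))"
    by (rule magnus_lie_rep) (use c in \<open>simp_all del: magnus_simps\<close>)
  then have "coeff (?w - 1 - lie_eval nc_var (exotic_exp i j k)) [i, i, j, j, k, k] = 0"
    by (rule ncps_orderD) simp
  then show ?thesis using coeff_exotic_exp[OF assms] by simp
qed

section \<open>Exotic elements of the Andreadakis filtration\<close>

context
  fixes S :: "'a set"
begin

interpretation F: group "free_group S" by (rule group_free_group)
interpretation A: group "AutoGroup (free_group S)" by (rule F.AutoGroup)

lemma group_mccool: "group (mccool_group S)"
  unfolding mccool_group_def by (rule subgroup.subgroup_is_group[OF subgroup_mccool A.is_group])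

interpretation P: group "mccool_group S" by (rule group_mccool)

lemma carrier_mccool_group [simp]: "carrier (mccool_group S) = mccool S"
  by (simp add: mccool_group_def)

lemma mccool_group_mult [simp]: "f \<otimes>\<^bsub>mccool_group S\<^esub> g = f \<otimes>\<^bsub>AutoGroup (free_group S)\<^esub> g"
  by (simp add: mccool_group_def)

lemma commut_mccool:
  "f \<in> mccool S \<Longrightarrow> g \<in> mccool S \<Longrightarrow> commut (mccool_group S) f g = commut (AutoGroup (free_group S)) f g"
  unfolding mccool_group_def by (rule A.commut_subgroup(1)[OF subgroup_mccool])

lemma andreadakis_genI:
  assumes f: "f \<in> auto (free_group S)"
    and gen: "\<And>i. i \<in> S \<Longrightarrow> lc_eq (free_group S) (Suc k) (f (free_gen i)) (free_gen i)"
  shows "f \<in> andreadakis (free_group S) k"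
proof -
  interpret f: group_hom "free_group S" "free_group S" f using F.auto_group_hom[OF f] .
  let ?H = "{w \<in> carrier (free_group S). lc_eq (free_group S) (Suc k) (f w) w}"
  have "subgroup ?H (free_group S)"
    by (rule F.subgroupI) (auto intro!: F.lc_eq_mult F.lc_eq_inv F.lc_eq_refl exI[of _ "\<one>\<^bsub>free_group S\<^esub>"])
  then have "carrier (free_group S) \<subseteq> ?H"
    by (rule free_group_generated) (simp add: gen free_gen_closed)
  then show ?thesis using f by (auto simp: F.andreadakis_lc_eq)
qed

lemma mccool_andreadakis_1: "mccool S \<subseteq> andreadakis (free_group S) 1"
proof
  fix f assume f: "f \<in> mccool S"
  show "f \<in> andreadakis (free_group S) 1"
  proof (rule andreadakis_genI[OF mccool_auto[OF f]])
    fix i assume i: "i \<in> S"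
    obtain w where w: "w \<in> carrier (free_group S)" "f (free_gen i) = free_conj S w i"
      using mccoolD[OF f i] by blast
    show "lc_eq (free_group S) (Suc 1) (f (free_gen i)) (free_gen i)"
      unfolding w(2) free_conj_def using w(1) free_gen_closed[OF i]
      by (intro F.lc_eq_conj[of w 1 _ 1]) simp_all
  qed
qed

text \<open>
  This inclusion is also what makes the quotient in the main theorem a group.
\<close>

theorem lower_central_mccool:
  "k \<ge> 1 \<Longrightarrow> lower_central (mccool_group S) k \<subseteq> andreadakis (free_group S) k"
proof (induction k rule: dec_induct)
  case base
  show ?case using mccool_andreadakis_1 by simp
next
  case (step k)
  let ?H = "andreadakis (free_group S) (Suc k) \<inter> mccool S"
  have "lower_central (mccool_group S) (Suc k) \<subseteq> ?H"
  proof (rule P.lc_Suc_induct[OF step.hyps(1)])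
    show "subgroup ?H (mccool_group S)"
      unfolding mccool_group_def
      using A.subgroups_Inter_pair[OF F.subgroup_andreadakis subgroup_mccool]
      by (intro A.subgroup_incl[OF _ subgroup_mccool]) auto
    fix g h assume "g \<in> carrier (mccool_group S)" "h \<in> lower_central (mccool_group S) k"
    then have g: "g \<in> mccool S" and h: "h \<in> mccool S" "h \<in> andreadakis (free_group S) k"
      using P.lower_central_carrier step.IH by auto
    have "commut (AutoGroup (free_group S)) g h \<in> andreadakis (free_group S) (1 + k)"
      using mccool_andreadakis_1 g h step.hyps by (intro F.andreadakis_commut_displacement(1)) auto
    then show "commut (mccool_group S) g h \<in> ?H"
      using P.commut_closed[of g h] g h by (simp add: commut_mccool)
  qed
  then show ?case by blast
qed

definition exotic_aut :: "'a \<Rightarrow> 'a \<Rightarrow> 'a \<Rightarrow> 'a word \<Rightarrow> 'a word"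
  where "exotic_aut i j k = (let \<chi> = \<lambda>p q. partial_conj S p q True in
    exotic_word (mccool_group S) (\<chi> i j) (\<chi> j k) (\<chi> k i)
      (\<chi> j i \<otimes>\<^bsub>mccool_group S\<^esub> \<chi> k i) (\<chi> k j \<otimes>\<^bsub>mccool_group S\<^esub> \<chi> i j) (\<chi> i k \<otimes>\<^bsub>mccool_group S\<^esub> \<chi> j k))"

context
  fixes i j k :: 'a
  assumes ijk: "i \<in> S" "j \<in> S" "k \<in> S" "i \<noteq> j" "j \<noteq> k" "k \<noteq> i"
begin

lemma chi_closed:
  "p \<in> {i, j, k} \<Longrightarrow> q \<in> {i, j, k} \<Longrightarrow> p \<noteq> q \<Longrightarrow> partial_conj S p q True \<in> mccool S"
  using ijk by (intro partial_conj_mccool) auto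

lemma acts_by_partial_conj:
  assumes p: "p \<in> {i, j, k}" and q: "q \<in> {i, j, k}" and pq: "p \<noteq> q"
  shows "acts_by (free_group S) {i, j, k} free_gen 1 (partial_conj S p q True) (conj_deriv p q)"
  unfolding acts_by_def
proof (intro conjI ballI)
  have pS: "p \<in> S" and qS: "q \<in> S" using p q ijk by auto
  show "partial_conj S p q True \<in> andreadakis (free_group S) 1"
    using chi_closed[OF assms] mccool_andreadakis_1 by blast
  fix r assume r: "r \<in> {i, j, k}"
  then have rS: "r \<in> S" using ijk by auto
  note g = free_gen_closed[OF rS] partial_conj_hom(3)[OF pS qS rS, of True]
  show "lie_rep (free_group S) {i, j, k} free_gen (Suc 1) (displacement (free_group S) (partial_conj S p q True) (free_gen r)) (conj_deriv p q r)"
  proof (cases "r = p")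
    case True
    have "displacement (free_group S) (partial_conj S p q True) (free_gen r) = commut (free_group S) (free_gen q) (free_gen p)"
      using g True by (simp add: displacement_def commut_def free_gen_def[of q])
    moreover have "lie_rep (free_group S) {i, j, k} free_gen (1 + 1) (commut (free_group S) (free_gen q) (free_gen p)) (Br (Gen q) (Gen p))"
      using p q by (intro lie_rep.br lie_rep.gen)
    ultimately show ?thesis using True by (simp add: conj_deriv_def)
  next
    case False
    then have "displacement (free_group S) (partial_conj S p q True) (free_gen r) = \<one>\<^bsub>free_group S\<^esub>"
      using g by (simp add: displacement_def)
    moreover have "lie_rep (free_group S) {i, j, k} free_gen (Suc 1) \<one>\<^bsub>free_group S\<^esub> Zero"
      by (rule lie_rep.zero) simp
    ultimately show ?thesis using False by (simp add: conj_deriv_def)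
  qed
qed

lemma exotic_aut_AutoGroup:
  "exotic_aut i j k = (let \<chi> = \<lambda>p q. partial_conj S p q True in
    exotic_word (AutoGroup (free_group S)) (\<chi> i j) (\<chi> j k) (\<chi> k i)
      (\<chi> j i \<otimes>\<^bsub>AutoGroup (free_group S)\<^esub> \<chi> k i) (\<chi> k j \<otimes>\<^bsub>AutoGroup (free_group S)\<^esub> \<chi> i j) (\<chi> i k \<otimes>\<^bsub>AutoGroup (free_group S)\<^esub> \<chi> j k))"
  unfolding exotic_aut_def Let_def mccool_group_mult
  unfolding mccool_group_def
  using ijk by (intro A.exotic_word_subgroup(1)[OF subgroup_mccool] subgroup.m_closed[OF subgroup_mccool] chi_closed) auto

lemma exotic_aut_lower_central: "exotic_aut i j k \<in> lower_central (mccool_group S) 6"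
  unfolding exotic_aut_def Let_def
  using ijk by (intro P.exotic_word_lower_central P.m_closed) (auto intro: chi_closed)

text \<open>
  The rules for \<open>acts_by\<close> follow the structure of the word; the numerals are the degrees of its
  subwords.
\<close>

lemma acts_by_exotic:
  "acts_by (free_group S) {i, j, k} free_gen 6 (exotic_aut i j k) (exotic_deriv i j k)"
proof -
  have x: "free_gen ` {i, j, k} \<subseteq> carrier (free_group S)" using ijk by (auto intro: free_gen_closed)
  let ?act = "acts_by (free_group S) {i, j, k} free_gen" and ?A = "AutoGroup (free_group S)"
  let ?\<chi> = "\<lambda>p q. partial_conj S p q True"
  have br: "?act m (commut ?A f g) (deriv_bracket d d')"
    if "?act k' f d" "?act l g d'" "k' \<ge> 1" "l \<ge> 1" "k' + l = m" for k' l m f g d d'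
    using that by (intro F.acts_by_bracket[OF _ _ x])
  have add: "?act m (f \<otimes>\<^bsub>?A\<^esub> g) (deriv_add d d')" if "?act m f d" "?act m g d'" "m \<ge> 1" for m f g d d'
    unfolding deriv_add_def using that by (intro F.acts_by_mult[OF _ _ x])
  have neg: "?act m (inv\<^bsub>?A\<^esub> f) (deriv_neg d)" if "?act m f d" "m \<ge> 1" for m f d
    unfolding deriv_neg_def using that by (intro F.acts_by_inv[OF _ x])
  note c = acts_by_partial_conj
  have cyc: "?act 6 (commut ?A (?\<chi> p q) (commut ?A (?\<chi> r p) (commut ?A (commut ?A (?\<chi> p q) (?\<chi> q r)) (commut ?A (?\<chi> q r) (?\<chi> r p)))))
      (cyclic_deriv p q r)" if "{p, q, r} \<subseteq> {i, j, k}" "p \<noteq> q" "q \<noteq> r" "r \<noteq> p" for p q r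
    unfolding cyclic_deriv_def
    by (rule br[OF c br[OF c br[OF br[OF c c, where m = 2] br[OF c c, where m = 2], where m = 4], where m = 5]]) (use that in auto)
  have ad: "?act 1 (?\<chi> q p \<otimes>\<^bsub>?A\<^esub> ?\<chi> r p) (ad_deriv p q r)"
    if "{p, q, r} \<subseteq> {i, j, k}" "p \<noteq> q" "q \<noteq> r" "r \<noteq> p" for p q r
    unfolding ad_deriv_def by (rule add[OF c c]) (use that in auto)
  have a: "?act 1 (?\<chi> j i \<otimes>\<^bsub>?A\<^esub> ?\<chi> k i) (ad_deriv i j k)" "?act 1 (?\<chi> k j \<otimes>\<^bsub>?A\<^esub> ?\<chi> i j) (ad_deriv j k i)"
    "?act 1 (?\<chi> i k \<otimes>\<^bsub>?A\<^esub> ?\<chi> j k) (ad_deriv k i j)"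
    by (rule ad; use ijk in auto)+
  have tri: "?act 3 (commut ?A f (commut ?A g h)) (deriv_bracket d (deriv_bracket d' d''))"
    if "?act 1 f d" "?act 1 g d'" "?act 1 h d''" for f g h d d' d''
    by (rule br[OF that(1) br[OF that(2,3), where m = 2]]) auto
  have cycs: "?act 6 (commut ?A (?\<chi> i j) (commut ?A (?\<chi> k i) (commut ?A (commut ?A (?\<chi> i j) (?\<chi> j k)) (commut ?A (?\<chi> j k) (?\<chi> k i))))) (cyclic_deriv i j k)"
    "?act 6 (commut ?A (?\<chi> j k) (commut ?A (?\<chi> i j) (commut ?A (commut ?A (?\<chi> j k) (?\<chi> k i)) (commut ?A (?\<chi> k i) (?\<chi> i j))))) (cyclic_deriv j k i)"
    "?act 6 (commut ?A (?\<chi> k i) (commut ?A (?\<chi> j k) (commut ?A (commut ?A (?\<chi> k i) (?\<chi> i j)) (commut ?A (?\<chi> i j) (?\<chi> j k))))) (cyclic_deriv k i j)"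
    by (rule cyc; use ijk in auto)+
  show ?thesis
    unfolding exotic_aut_AutoGroup Let_def exotic_word_def exotic_deriv_def
    by (rule add[OF add[OF add[OF cycs(1) cycs(2)] cycs(3)] neg[OF br[OF tri[OF a(1) a(2) a(3)] tri[OF a(2) a(3) a(1)]]]]) auto
qed

lemma exotic_aut_fixes:
  assumes "s \<in> S" "s \<notin> {i, j, k}"
  shows "exotic_aut i j k (free_gen s) = free_gen s"
proof -
  let ?H = "{f \<in> carrier (AutoGroup (free_group S)). f (free_gen s) = free_gen s}"
  have s: "free_gen s \<in> carrier (free_group S)" using assms(1) by (rule free_gen_closed)
  have H: "subgroup ?H (AutoGroup (free_group S))"
  proof (rule A.subgroupI)
    show "?H \<noteq> {}" using A.one_closed F.AutoGroup_one[OF s] by blast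
    show "inv\<^bsub>AutoGroup (free_group S)\<^esub> f \<in> ?H" if "f \<in> ?H" for f
      using that F.AutoGroup_inv(2)[of f "free_gen s"] s A.inv_closed[of f] by (auto simp: F.carrier_AutoGroup)
    show "f \<otimes>\<^bsub>AutoGroup (free_group S)\<^esub> g \<in> ?H" if "f \<in> ?H" "g \<in> ?H" for f g
      using that A.m_closed[of f g] s by (auto simp: F.carrier_AutoGroup F.AutoGroup_mult)
  qed auto
  have chi: "partial_conj S p q True \<in> ?H" if "p \<in> {i, j, k}" "q \<in> {i, j, k}" "p \<noteq> q" for p q
  proof -
    have pq: "p \<in> S" "q \<in> S" "s \<noteq> p" using that ijk assms by auto
    then show ?thesis
      using partial_conj_auto[OF pq(1,2) that(3)] partial_conj_hom(3)[OF pq(1,2) assms(1), of True]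
      by (simp add: F.carrier_AutoGroup)
  qed
  have "exotic_aut i j k \<in> ?H"
    unfolding exotic_aut_AutoGroup Let_def
    by (intro A.exotic_word_subgroup(2)[OF H] subgroup.m_closed[OF H] chi) (use ijk in auto)
  then show ?thesis by blast
qed

text \<open>
  On the three chosen generators this is the torsion argument with exponent \<open>6 + 1\<close>; the other
  generators are fixed.
\<close>

theorem exotic_aut_pow_andreadakis:
  "exotic_aut i j k [^]\<^bsub>AutoGroup (free_group S)\<^esub> (7::nat) \<in> andreadakis (free_group S) 7"
proof (rule andreadakis_genI)
  let ?f = "exotic_aut i j k" and ?A = "AutoGroup (free_group S)"
  have f: "?f \<in> auto (free_group S)"
    using acts_by_exotic F.andreadakis_auto by (auto simp: acts_by_def)
  then show pow: "?f [^]\<^bsub>?A\<^esub> (7::nat) \<in> auto (free_group S)"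
    using A.nat_pow_closed[of ?f 7] by (simp add: F.carrier_AutoGroup)
  fix s assume s: "s \<in> S"
  show "lc_eq (free_group S) (Suc 7) ((?f [^]\<^bsub>?A\<^esub> (7::nat)) (free_gen s)) (free_gen s)"
  proof (cases "s \<in> {i, j, k}")
    case True
    have "lc_eq (free_group S) (Suc (Suc 6)) ((?f [^]\<^bsub>?A\<^esub> Suc 6) (free_gen s)) (free_gen s)"
    proof (rule F.acts_by_zero_pow[of "[i, j, k]" free_gen 6 ?f "exotic_deriv i j k" s])
      show "acts_by (free_group S) (set [i, j, k]) free_gen 6 ?f (exotic_deriv i j k)" using acts_by_exotic by simp
      show "distinct [i, j, k]" using ijk by auto
      show "lie_eval (nc_var :: 'a \<Rightarrow> 'a ncps) (exotic_deriv i j k s) = 0"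
        using exotic_deriv_zero[OF ijk(4-6) True] .
      show "free_gen ` set [i, j, k] \<subseteq> carrier (free_group S)" using ijk by (auto intro: free_gen_closed)
    qed (use True in auto)
    then show ?thesis by simp
  next
    case False
    have "(?f [^]\<^bsub>?A\<^esub> n) (free_gen s) = free_gen s" for n :: nat
    proof (induction n)
      case 0
      then show ?case using free_gen_closed[OF s] by (simp add: F.AutoGroup_one)
    next
      case (Suc n)
      have "?f [^]\<^bsub>?A\<^esub> n \<in> auto (free_group S)"
        using A.nat_pow_closed[of ?f n] f by (simp add: F.carrier_AutoGroup)
      then show ?case
        using Suc f exotic_aut_fixes[OF s False] free_gen_closed[OF s] by (simp add: F.AutoGroup_mult)
    qed
    then show ?thesis using free_gen_closed[OF s] by (simp add: F.lc_eq_refl)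
  qed
qed

end

end

section \<open>Integer-valued characters of the sixth lower central term\<close>

context three_generators
begin

definition magnus_rep :: "'a word \<Rightarrow> 'a ncps"
  where "magnus_rep = free_lift S magnus_group (\<lambda>p. 1 + nc_var p)"

lemma magnus_rep_hom: "magnus_rep \<in> hom F3 magnus_group"
  and magnus_rep_gen: "p \<in> S \<Longrightarrow> magnus_rep (free_gen p) = 1 + nc_var p"
proof -
  have *: "(\<lambda>p. 1 + nc_var p) \<in> S \<rightarrow> carrier magnus_group"
    by (intro Pi_I magnus_gen_closed)
  show "magnus_rep \<in> hom F3 magnus_group" "p \<in> S \<Longrightarrow> magnus_rep (free_gen p) = 1 + nc_var p"
    using M.free_lift[OF *] by (simp_all add: magnus_rep_def)
qed

definition outer_rep :: "'a set \<Rightarrow> ('a word \<Rightarrow> 'a word) \<Rightarrow> 'a ncps"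
  where "outer_rep U = (\<lambda>f. magnus_rep (outer_word (restrict_aut U S f)))"

lemma outer_rep_hom:
  assumes "S \<subseteq> U"
  shows "outer_rep U \<in> hom (mccool_group U) magnus_group"
proof -
  have "magnus_rep \<circ> (outer_word \<circ> restrict_aut U S) \<in> hom (mccool_group U) magnus_group"
    by (rule hom_compose[OF hom_compose[OF restrict_aut_hom[OF assms] outer_word_hom] magnus_rep_hom])
  then show ?thesis by (simp add: outer_rep_def comp_def)
qed

lemma outer_rep_partial_conj:
  assumes "S \<subseteq> U" "p \<in> U" "q \<in> U" "p \<noteq> q"
  shows "p \<notin> S \<or> q \<notin> S \<Longrightarrow> outer_rep U (partial_conj U p q True) = 1"
    and "p \<in> S \<Longrightarrow> q = succ p \<Longrightarrow> outer_rep U (partial_conj U p q True) = 1 + nc_var p"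
proof -
  interpret P: group "mccool_group S" by (rule group_mccool)
  interpret ow: group_hom "mccool_group S" F3 outer_word
    using outer_word_hom by unfold_locales
  interpret mr: group_hom F3 magnus_group magnus_rep
    using magnus_rep_hom by unfold_locales
  have one: "\<one>\<^bsub>mccool_group S\<^esub> = \<one>\<^bsub>AG\<^esub>" by (simp add: mccool_group_def)
  show "outer_rep U (partial_conj U p q True) = 1" if "p \<notin> S \<or> q \<notin> S"
  proof -
    have "\<not> (p \<in> S \<and> q \<in> S)" using that by blast
    then have "restrict_aut U S (partial_conj U p q True) = \<one>\<^bsub>mccool_group S\<^esub>"
      by (simp only: restrict_partial_conj[OF assms] if_False one)
    then show ?thesis using ow.hom_one mr.hom_one by (simp only: outer_rep_def magnus_simps)
  qed
  show "outer_rep U (partial_conj U p q True) = 1 + nc_var p" if p: "p \<in> S" and q: "q = succ p"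
    using restrict_partial_conj[OF assms] p succ_cyc(2)[OF p] q
      outer_word_eq[OF outer_class_gen[OF p]] magnus_rep_gen[OF p]
    by (simp add: outer_rep_def del: insert_iff)
qed

lemma outer_rep_inner:
  assumes "S \<subseteq> U" and p: "p \<in> S" and q: "q = succ p" and r: "r = succ q"
  shows "outer_rep U (partial_conj U p r True \<otimes>\<^bsub>mccool_group U\<^esub> partial_conj U q r True) = 1"
proof -
  interpret mr: group_hom F3 magnus_group magnus_rep
    using magnus_rep_hom by unfold_locales
  note cyc = succ_cyc[OF p]
  have mem: "p \<in> U" "q \<in> U" "r \<in> U" "p \<noteq> r" "q \<noteq> r" "q \<in> S" "r \<in> S" using assms cyc by auto
  have c: "partial_conj U p r True \<in> carrier (mccool_group U)" "partial_conj U q r True \<in> carrier (mccool_group U)"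
    using mem by (simp_all add: partial_conj_mccool)
  have "restrict_aut U S (partial_conj U p r True \<otimes>\<^bsub>mccool_group U\<^esub> partial_conj U q r True) =
      partial_conj S p r True \<otimes>\<^bsub>AG\<^esub> partial_conj S q r True"
    using hom_mult[OF restrict_aut_hom[OF assms(1)] c] restrict_partial_conj[OF assms(1) mem(1,3,4)]
      restrict_partial_conj[OF assms(1) mem(2,3,5)] p mem(6,7) by (simp del: insert_iff)
  also have "\<dots> = inner_aut F3 (free_gen r)" using inner_gen_eq[OF p] q r by simp
  finally show ?thesis
    using outer_word_eq[OF outer_class_inner[OF free_gen_closed[OF mem(7)]]] mr.hom_one by (simp add: outer_rep_def)
qed

definition outer_coeff :: "'a set \<Rightarrow> ('a word \<Rightarrow> 'a word) \<Rightarrow> int"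
  where "outer_coeff U f = coeff (outer_rep U f) [i, i, j, j, k, k]"

lemma outer_coeff_lower_central_7:
  assumes "S \<subseteq> U" "f \<in> lower_central (mccool_group U) 7"
  shows "outer_coeff U f = 0"
proof -
  interpret P: group "mccool_group U" by (rule group_mccool)
  interpret r: group_hom "mccool_group U" magnus_group "outer_rep U"
    using outer_rep_hom[OF assms(1)] by unfold_locales
  have "outer_rep U f \<in> magnus_filtration 7"
    using r.lower_central_img assms(2) lower_central_magnus[of 7] by fastforce
  then have "coeff (outer_rep U f - 1) [i, i, j, j, k, k] = 0"
    by (intro ncps_orderD[of 7]) (auto simp: magnus_filtration_def)
  then show ?thesis by (simp add: outer_coeff_def)
qed

lemma outer_coeff_hom:
  assumes "S \<subseteq> U"
  shows "outer_coeff U \<in> hom ((mccool_group U)\<lparr>carrier := lower_central (mccool_group U) 6\<rparr>) integer_group"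
proof (rule homI)
  interpret P: group "mccool_group U" by (rule group_mccool)
  interpret r: group_hom "mccool_group U" magnus_group "outer_rep U"
    using outer_rep_hom[OF assms(1)] by unfold_locales
  let ?P6 = "(mccool_group U)\<lparr>carrier := lower_central (mccool_group U) 6\<rparr>"
  fix f g assume "f \<in> carrier ?P6" "g \<in> carrier ?P6"
  then have fg: "f \<in> lower_central (mccool_group U) 6" "g \<in> lower_central (mccool_group U) 6" by simp_all
  have "outer_rep U f \<in> magnus_filtration 6" "outer_rep U g \<in> magnus_filtration 6"
    using r.lower_central_img fg lower_central_magnus[of 6] by fastforce+
  then have "coeff (outer_rep U f * outer_rep U g) [i, i, j, j, k, k] =
      coeff (outer_rep U f) [i, i, j, j, k, k] + coeff (outer_rep U g) [i, i, j, j, k, k]"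
    using hom_mult[OF magnus_coeff_hom[of "[i, i, j, j, k, k]" 6]] by simp
  then show "outer_coeff U (f \<otimes>\<^bsub>?P6\<^esub> g) = outer_coeff U f \<otimes>\<^bsub>integer_group\<^esub> outer_coeff U g"
    using r.hom_mult[OF P.lower_central_carrier[OF fg(1)] P.lower_central_carrier[OF fg(2)]]
    by (simp add: outer_coeff_def)
qed simp

lemma outer_coeff_exotic:
  assumes U: "S \<subseteq> U"
  shows "outer_coeff U (exotic_aut U i j k) = -1"
proof -
  interpret P: group "mccool_group U" by (rule group_mccool)
  interpret r: group_hom "mccool_group U" magnus_group "outer_rep U"
    using outer_rep_hom[OF U] by unfold_locales
  have mem: "i \<in> U" "j \<in> U" "k \<in> U" using U by auto
  note ne = ijk ijk[symmetric]
  have sc: "succ i = j" "succ j = k" "succ k = i" using ijk by (auto simp: succ_def)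
  have c: "partial_conj U p q True \<in> carrier (mccool_group U)" if "p \<in> U" "q \<in> U" "p \<noteq> q" for p q
    using that by (simp add: partial_conj_mccool)
  have "outer_rep U (exotic_aut U i j k) =
      exotic_word magnus_group (1 + nc_var i) (1 + nc_var j) (1 + nc_var k) 1 1 1"
    unfolding exotic_aut_def Let_def
    using mem ne sc
    by (subst r.hom_exotic_word)
      (simp_all only: c P.m_closed not_False_eq_True outer_rep_partial_conj(2)[OF U] outer_rep_inner[OF U] insert_iff simp_thms)
  then show ?thesis using exotic_word_magnus[OF ijk] by (simp add: outer_coeff_def)
qed

text \<open>
  Two different triples never contain each other, so the projection kills one of \<open>x, y, z\<close>.
\<close>

lemma outer_coeff_exotic_other:
  assumes U: "S \<subseteq> U" and xyz: "{x, y, z} \<subseteq> U" "x \<noteq> y" "y \<noteq> z" "z \<noteq> x" and other: "\<not> {x, y, z} \<subseteq> S"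
  shows "outer_coeff U (exotic_aut U x y z) = 0"
proof -
  interpret P: group "mccool_group U" by (rule group_mccool)
  interpret r: group_hom "mccool_group U" magnus_group "outer_rep U"
    using outer_rep_hom[OF U] by unfold_locales
  let ?\<chi> = "\<lambda>p q. partial_conj U p q True"
  have c: "?\<chi> p q \<in> carrier (mccool_group U)" if "p \<in> {x, y, z}" "q \<in> {x, y, z}" "p \<noteq> q" for p q
    using that xyz by (auto intro!: partial_conj_mccool)
  have triv: "outer_rep U (?\<chi> p q) = \<one>\<^bsub>magnus_group\<^esub>"
    if "p \<in> {x, y, z}" "q \<in> {x, y, z}" "p \<noteq> q" "p \<notin> S \<or> q \<notin> S" for p q
    using outer_rep_partial_conj(1)[OF U, of p q] that xyz by auto
  have triv2: "outer_rep U (?\<chi> p s \<otimes>\<^bsub>mccool_group U\<^esub> ?\<chi> q s) = \<one>\<^bsub>magnus_group\<^esub>"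
    if "p \<in> {x, y, z}" "q \<in> {x, y, z}" "s \<in> {x, y, z}" "p \<noteq> s" "q \<noteq> s" "s \<notin> S" for p q s
    using r.hom_mult[OF c[OF that(1,3,4)] c[OF that(2,3,5)]] triv[OF that(1,3,4)] triv[OF that(2,3,5)] that(6) by simp
  have "outer_rep U (exotic_aut U x y z) = \<one>\<^bsub>magnus_group\<^esub>"
  proof -
    have "x \<notin> S \<or> y \<notin> S \<or> z \<notin> S" using other by blast
    moreover have "exotic_aut U x y z = exotic_word (mccool_group U) (?\<chi> x y) (?\<chi> y z) (?\<chi> z x)
      (?\<chi> y x \<otimes>\<^bsub>mccool_group U\<^esub> ?\<chi> z x) (?\<chi> z y \<otimes>\<^bsub>mccool_group U\<^esub> ?\<chi> x y) (?\<chi> x z \<otimes>\<^bsub>mccool_group U\<^esub> ?\<chi> y z)"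
      by (simp only: exotic_aut_def Let_def)
    moreover have cl: "?\<chi> x y \<in> carrier (mccool_group U)" "?\<chi> y z \<in> carrier (mccool_group U)" "?\<chi> z x \<in> carrier (mccool_group U)"
      "?\<chi> y x \<otimes>\<^bsub>mccool_group U\<^esub> ?\<chi> z x \<in> carrier (mccool_group U)"
      "?\<chi> z y \<otimes>\<^bsub>mccool_group U\<^esub> ?\<chi> x y \<in> carrier (mccool_group U)"
      "?\<chi> x z \<otimes>\<^bsub>mccool_group U\<^esub> ?\<chi> y z \<in> carrier (mccool_group U)"
      using xyz(2-4) by (auto simp del: carrier_mccool_group mccool_group_mult intro!: P.m_closed c)
    moreover note r.hom_closed[OF cl(1)] r.hom_closed[OF cl(2)] r.hom_closed[OF cl(3)]
      r.hom_closed[OF cl(4)] r.hom_closed[OF cl(5)] r.hom_closed[OF cl(6)]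
    moreover have "x \<notin> S \<Longrightarrow> outer_rep U (?\<chi> x y) = \<one>\<^bsub>magnus_group\<^esub> \<and> outer_rep U (?\<chi> z x) = \<one>\<^bsub>magnus_group\<^esub>
        \<and> outer_rep U (?\<chi> y x \<otimes>\<^bsub>mccool_group U\<^esub> ?\<chi> z x) = \<one>\<^bsub>magnus_group\<^esub>"
      "y \<notin> S \<Longrightarrow> outer_rep U (?\<chi> x y) = \<one>\<^bsub>magnus_group\<^esub> \<and> outer_rep U (?\<chi> y z) = \<one>\<^bsub>magnus_group\<^esub>
        \<and> outer_rep U (?\<chi> z y \<otimes>\<^bsub>mccool_group U\<^esub> ?\<chi> x y) = \<one>\<^bsub>magnus_group\<^esub>"
      "z \<notin> S \<Longrightarrow> outer_rep U (?\<chi> y z) = \<one>\<^bsub>magnus_group\<^esub> \<and> outer_rep U (?\<chi> z x) = \<one>\<^bsub>magnus_group\<^esub>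
        \<and> outer_rep U (?\<chi> x z \<otimes>\<^bsub>mccool_group U\<^esub> ?\<chi> y z) = \<one>\<^bsub>magnus_group\<^esub>"
      using xyz(2-4) by (intro conjI triv triv2; blast)+
    ultimately show ?thesis
      by (simp only: r.hom_exotic_word[OF cl]) (rule M.exotic_word_degenerate, blast+)
  qed
  then show ?thesis by (simp add: outer_coeff_def)
qed

end

section \<open>The theorem\<close>

theorem theorem1:
  fixes n :: nat
  assumes "n \<ge> 3"
  defines "F \<equiv> free_group {1..n}"
    and "P \<equiv> mccool_group {1..n}"
  defines "Q \<equiv> (AutoGroup F \<lparr>carrier := andreadakis F 7 \<inter> carrier P\<rparr>) Mod lower_central P 7"
  shows "\<not> (\<forall>k\<ge>1. lower_central P k = andreadakis F k \<inter> carrier P)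
    \<and> (\<exists>C. central_subgroup C Q
           \<and> Q \<lparr>carrier := C\<rparr> \<cong> free_Abelian_group {1..n choose 3})"
proof -
  define U where "U = {1..n}"
  interpret F: group F unfolding F_def by (rule group_free_group)
  interpret A: group "AutoGroup F" by (rule F.AutoGroup)
  interpret P: group P unfolding P_def by (rule group_mccool)
  have P: "P = AutoGroup F\<lparr>carrier := mccool U\<rparr>" by (simp add: P_def F_def U_def mccool_group_def)
  have mcS: "subgroup (mccool U) (AutoGroup F)" using subgroup_mccool[of U] by (simp add: F_def U_def)
  define K where "K = andreadakis F 7 \<inter> mccool U"
  define G where "G = AutoGroup F\<lparr>carrier := K\<rparr>"
  have K: "subgroup K (AutoGroup F)"
    unfolding K_def by (rule A.subgroups_Inter_pair[OF F.subgroup_andreadakis mcS])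
  have KP: "subgroup K P" unfolding P by (rule A.subgroup_incl[OF K mcS]) (simp add: K_def)
  have GP: "G = P\<lparr>carrier := K\<rparr>" by (simp add: G_def P)
  interpret G: group G unfolding G_def by (rule subgroup.subgroup_is_group[OF K A.is_group])
  let ?N = "lower_central P 7" and ?\<Gamma> = "lower_central P 6"
  define L where "L = ?\<Gamma> \<inter> K"
  have NK: "?N \<subseteq> K"
    using lower_central_mccool[of 7 U] P.lower_central_carrier[of _ 7]
    by (auto simp: K_def P_def F_def U_def)
  have NL: "?N \<subseteq> L" using NK P.lc_antimono[of 6 7] by (auto simp: L_def)
  have N: "?N \<lhd> G"
    unfolding GP by (rule P.normal_restrict_supergroup[OF KP P.normal_lower_central NK])
  have L: "subgroup L G"
    unfolding GP L_def using P.subgroups_Inter_pair[OF P.subgroup_lower_central KP]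
    by (intro P.subgroup_incl[OF _ KP]) auto
  have Q: "Q = G Mod ?N" by (simp add: Q_def G_def K_def P)
  have central: "commut G l g \<in> ?N" if "l \<in> L" "g \<in> carrier G" for l g
  proof -
    have lg: "l \<in> K" "l \<in> ?\<Gamma>" "g \<in> K" using that by (auto simp: L_def G_def)
    have "l \<in> carrier P" "g \<in> carrier P" using lg subgroup.mem_carrier[OF KP] by blast+
    moreover have "commut P g l \<in> lower_central P (Suc 6)"
      using calculation lg by (intro P.commut_lc_Suc) auto
    ultimately have "commut P l g \<in> ?N" using P.lc_inv[of "commut P g l" 7] by (simp add: P.inv_commut)
    then show ?thesis unfolding GP using P.commut_subgroup(1)[OF KP lg(1,3)] by simp
  qed
  let ?TT = "{T. T \<subseteq> U \<and> card T = 3}"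
  have TT: "finite ?TT" "card ?TT = n choose 3" using n_subsets[of U 3] by (simp_all add: U_def)
  obtain \<beta> where \<beta>: "bij_betw \<beta> {1..n choose 3} ?TT"
    using ex_bij_betw_nat_finite_1[OF TT(1)] unfolding TT(2) by blast
  define t where "t T = (SOME x. case x of (i, j, k) \<Rightarrow> T = {i, j, k} \<and> i \<noteq> j \<and> j \<noteq> k \<and> k \<noteq> i)" for T :: "nat set"
  have t: "case t T of (i, j, k) \<Rightarrow> T = {i, j, k} \<and> i \<noteq> j \<and> j \<noteq> k \<and> k \<noteq> i" if T: "T \<in> ?TT" for T
  proof -
    obtain i j k where "T = {i, j, k}" "i \<noteq> j" "j \<noteq> k" "i \<noteq> k"
      using T unfolding mem_Collect_eq card_3_iff by blast
    then have "case (i, j, k) of (i, j, k) \<Rightarrow> T = {i, j, k} \<and> i \<noteq> j \<and> j \<noteq> k \<and> k \<noteq> i" by simp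
    then show ?thesis unfolding t_def by (rule someI)
  qed
  define w where "w m = (case t (\<beta> m) of (i, j, k) \<Rightarrow> exotic_aut U i j k)" for m
  define \<chi> where "\<chi> m = (case t (\<beta> m) of (i, j, k) \<Rightarrow> three_generators.outer_coeff i j k U)" for m
  have tri: "\<exists>i j k. \<beta> m = {i, j, k} \<and> {i, j, k} \<subseteq> U \<and> i \<noteq> j \<and> j \<noteq> k \<and> k \<noteq> i \<and>
      w m = exotic_aut U i j k \<and> \<chi> m = three_generators.outer_coeff i j k U" if "m \<in> {1..n choose 3}" for m
  proof -
    have "\<beta> m \<in> ?TT" using \<beta> that by (auto simp: bij_betw_def)
    then show ?thesis using t[of "\<beta> m"] by (cases "t (\<beta> m)") (auto simp: w_def \<chi>_def)
  qed
  have w\<Gamma>: "w m \<in> ?\<Gamma>" and wpow: "w m [^]\<^bsub>P\<^esub> (7::nat) \<in> L" if m: "m \<in> {1..n choose 3}" for m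
  proof -
    obtain i j k where ijk: "{i, j, k} \<subseteq> U" "i \<noteq> j" "j \<noteq> k" "k \<noteq> i" "w m = exotic_aut U i j k"
      using tri[OF m] by blast
    then have mem: "i \<in> U" "j \<in> U" "k \<in> U" by auto
    show *: "w m \<in> ?\<Gamma>"
      using exotic_aut_lower_central[OF mem ijk(2-4)] by (simp add: ijk(5) P_def U_def)
    have pw: "w m [^]\<^bsub>P\<^esub> (n::nat) = w m [^]\<^bsub>AutoGroup F\<^esub> n" for n
      by (simp add: P nat_pow_def)
    have "w m [^]\<^bsub>P\<^esub> (7::nat) \<in> andreadakis F 7"
      using exotic_aut_pow_andreadakis[OF mem ijk(2-4)] unfolding pw by (simp add: ijk(5) F_def U_def)
    moreover have pl: "w m [^]\<^bsub>P\<^esub> (n::nat) \<in> ?\<Gamma>" for n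
      by (induction n) (auto intro: P.lc_mult *)
    moreover have "w m [^]\<^bsub>P\<^esub> (7::nat) \<in> mccool U"
      using P.lower_central_carrier[OF pl] by (simp add: P)
    ultimately show "w m [^]\<^bsub>P\<^esub> (7::nat) \<in> L" by (simp add: L_def K_def)
  qed
  have \<chi>hom: "\<chi> m \<in> hom (P\<lparr>carrier := ?\<Gamma>\<rparr>) integer_group" and \<chi>N: "\<And>x. x \<in> ?N \<Longrightarrow> \<chi> m x = 0"
    if m: "m \<in> {1..n choose 3}" for m
  proof -
    obtain i j k where ijk: "{i, j, k} \<subseteq> U" "i \<noteq> j" "j \<noteq> k" "k \<noteq> i" "\<chi> m = three_generators.outer_coeff i j k U"
      using tri[OF m] by blast
    interpret T: three_generators i j k using ijk by unfold_locales
    show "\<chi> m \<in> hom (P\<lparr>carrier := ?\<Gamma>\<rparr>) integer_group"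
      using T.outer_coeff_hom[OF ijk(1)] by (simp add: ijk(5) P_def U_def)
    show "\<chi> m x = 0" if "x \<in> ?N" for x
      using T.outer_coeff_lower_central_7[OF ijk(1)] that by (simp add: ijk(5) P_def U_def)
  qed
  \<comment> \<open>The matrix of characters is minus the identity, which gives both independence and infinite order.\<close>
  have \<chi>w: "\<chi> m (w m') = (if m = m' then - 1 else 0)"
    if m: "m \<in> {1..n choose 3}" and m': "m' \<in> {1..n choose 3}" for m m'
  proof -
    obtain i j k where ijk: "\<beta> m = {i, j, k}" "{i, j, k} \<subseteq> U" "i \<noteq> j" "j \<noteq> k" "k \<noteq> i"
        "w m = exotic_aut U i j k" "\<chi> m = three_generators.outer_coeff i j k U"
      using tri[OF m] by blast
    obtain x y z where xyz: "\<beta> m' = {x, y, z}" "{x, y, z} \<subseteq> U" "x \<noteq> y" "y \<noteq> z" "z \<noteq> x"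
        "w m' = exotic_aut U x y z"
      using tri[OF m'] by blast
    interpret T: three_generators i j k using ijk by unfold_locales
    show ?thesis
    proof (cases "m = m'")
      case True
      then show ?thesis using T.outer_coeff_exotic[OF ijk(2)] ijk(6,7) by simp
    next
      case False
      then have "\<beta> m \<noteq> \<beta> m'" using \<beta> m m' by (auto simp: bij_betw_def inj_on_def)
      moreover have "card {x, y, z} = card {i, j, k}" using ijk(3-5) xyz(3-5) by auto
      ultimately have "\<not> {x, y, z} \<subseteq> {i, j, k}"
        using card_subset_eq[of "{i, j, k}" "{x, y, z}"] ijk(1) xyz(1) by auto
      then show ?thesis using T.outer_coeff_exotic_other[OF ijk(2) xyz(2-5)] False by (simp add: ijk(7) xyz(6))
    qed
  qed
  have \<chi>pow: "\<chi> m (w m' [^]\<^bsub>P\<^esub> (l::nat)) = int l * \<chi> m (w m')"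
    if m: "m \<in> {1..n choose 3}" and m': "m' \<in> {1..n choose 3}" for m m' l
  proof (induction l)
    case 0
    then show ?case using \<chi>N[OF m, of "\<one>\<^bsub>P\<^esub>"] by simp
  next
    case (Suc l)
    have "w m' [^]\<^bsub>P\<^esub> l \<in> ?\<Gamma>" by (induction l) (auto intro: P.lc_mult w\<Gamma>[OF m'])
    then show ?case using hom_mult[OF \<chi>hom[OF m], of "w m' [^]\<^bsub>P\<^esub> l" "w m'"] w\<Gamma>[OF m'] Suc
      by (simp add: algebra_simps)
  qed
  have "\<exists>C. central_subgroup C (G Mod ?N) \<and> (G Mod ?N)\<lparr>carrier := C\<rparr> \<cong> free_Abelian_group {1..n choose 3}"
  proof (rule G.central_free_Abelian_subgroup[OF N L NL central, where w = "\<lambda>m. w m [^]\<^bsub>P\<^esub> (7::nat)" and \<chi> = \<chi>])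
    fix m assume m: "m \<in> {1..n choose 3}"
    show "w m [^]\<^bsub>P\<^esub> (7::nat) \<in> L" by (rule wpow[OF m])
    show "\<chi> m \<in> hom (G\<lparr>carrier := L\<rparr>) integer_group"
      using \<chi>hom[OF m] by (auto simp: hom_def GP L_def)
    show "\<chi> m x = 0" if "x \<in> ?N" for x using that by (rule \<chi>N[OF m])
    show "\<chi> m (w m [^]\<^bsub>P\<^esub> (7::nat)) \<noteq> 0" using \<chi>pow[OF m m] \<chi>w[OF m m] by simp
  next
    fix m m' assume "m \<in> {1..n choose 3}" "m' \<in> {1..n choose 3}" "m \<noteq> m'"
    then show "\<chi> m (w m' [^]\<^bsub>P\<^esub> (7::nat)) = 0" using \<chi>pow \<chi>w by simp
  qed
  moreover have "\<not> (\<forall>k\<ge>1. lower_central P k = andreadakis F k \<inter> carrier P)"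
  proof
    assume eq: "\<forall>k\<ge>1. lower_central P k = andreadakis F k \<inter> carrier P"
    have "0 < n choose 3" using assms(1) by (rule zero_less_binomial)
    then have m: "1 \<in> {1..n choose 3}" unfolding atLeastAtMost_iff by linarith
    have "w 1 [^]\<^bsub>P\<^esub> (7::nat) \<in> ?N"
      using wpow[OF m] spec[OF eq, of 7] by (simp add: L_def K_def P)
    then have "\<chi> 1 (w 1 [^]\<^bsub>P\<^esub> (7::nat)) = 0" by (rule \<chi>N[OF m])
    then show False using \<chi>pow[OF m m] \<chi>w[OF m m] by simp
  qed
  ultimately show ?thesis unfolding Q by blast
qed

end
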